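(* Let $G(\lambda)=P(\lambda)+C(\lambda E-A)^{-1}B\in\mathbb{C}(\lambda)^{n\times n}$ with $P(\lambda)=\sum_{i=0}^m\lambda^iA_i$ an $n\times n$ matrix polynomial of degree $m\ge2$, $A,E\in\mathbb{C}^{r\times r}$, $E$ nonsingular, $C\in\mathbb{C}^{n\times r}$, $B\in\mathbb{C}^{r\times n}$, and let $\mathcal S(\lambda)=\left[\begin{array}{c|c}P(\lambda)&C\\ \hline B&A-\lambda E\end{array}\right]$. Let $$\mathbb{L}(\lambda)=\left[\begin{array}{c|c}L(\lambda)&e_{m-i_0(\sigma_1,\sigma)}\otimes C\\ \hline e_{m-c_0(\sigma,\sigma_2)}^T\otimes B&A-\lambda E\end{array}\right]$$ be an EGFP of $\mathcal S(\lambda)$ (equivalently, of $G(\lambda)$), where $L(\lambda)=M_{\tau_1}(Y_1)M_{\sigma_1}(X_1)(\lambda M^P_\tau-M^P_\sigma)M_{\sigma_2}(X_2)M_{\tau_2}(Y_2)$ is an EGFP of $P(\lambda)$ with $0\in\sigma$ and $-m\in\tau$. Suppose that $\mathcal S(\lambda)$ is regular and $\mu\in\mathbb{C}$ is an eigenvalue of $\mathcal S(\lambda)$. Let $Z=\begin{bmatrix}Z_{mn} \\ Z_r\end{bmatrix}$ be an $(mn+r)\times p$ matrix with $\mathrm{rank}(Z)=p$, where $Z_{mn}$ has $mn$ rows and $Z_r$ has $r$ rows. If $Z$ is a basis of $\mathcal N_r(\mathbb{L}(\mu))$ (resp., $\mathcal N_l(\mathbb{L}(\mu))$), then $\begin{bmatrix}(e^T_{m-c_0(\sigma,\sigma_2)}\otimes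 I_n)Z_{mn} \\ Z_r\end{bmatrix}$ (resp., $\begin{bmatrix}(e^T_{m-i_0(\sigma_1,\sigma)}\otimes I_n)Z_{mn} \\ Z_r\end{bmatrix}$) is a basis of $\mathcal N_r(\mathcal S(\mu))$ (resp., $\mathcal N_l(\mathcal S(\mu))$).
   Context: Notation: $\{0:m\}=\{0,1,\dots,m\}$, $-\{0:m\}=\{-m,\dots,-1,-0\}$, where $-0$ is a formal index different from $0$ (the successor of $-1$). $e_j$ is the $j$-th column of $I_m$; $\otimes$ is the Kronecker product. For a constant matrix $A$, $\mathcal N_r(A)=\{x:Ax=0\}$, $\mathcal N_l(A)=\{x:x^TA=0\}$; a matrix is called a basis of a subspace if its columns form one. $\mathcal S$ is regular if $\det\mathcal S\not\equiv0$; then $\mu$ is an eigenvalue if $\det\mathcal S(\mu)=0$. Index tuples: an index tuple is a finite, possibly empty, tuple of indices. $(\alpha,\beta)$ denotes concatenation and $-\alpha$ negates all entries. A subtuple is obtained by deleting some entries. A tuple $(i_1,\dots,i_t)$ satisfies the Successor Infix Property (SIP) if whenever $a<b$ and $i_a=i_b$ there is $c$ with $a<c<b$ and $i_c=i_a+1$ (for tuples from $-\{0:m\}$ this is understood after shifting by $m$, so $-0$ is the successor of $-1$). For $t\in\alpha$, $c_t(\alpha)=p$ (consecutions at $t$) if $(t,t+1,\dots,t+p)$ is a subtuple of $\alpha$ but $(t,\dots,t+p+1)$ is not; $i_t(\alpha)=q$ (inversions at $t$) if $(t+q,\dots,t+1,t)$ is a subtuple of $\alpha$ but $(t+q+1,t+q,\dots,t)$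 is not. If $t\notin\alpha$, $c_t(\alpha)=i_t(\alpha)=-1$. Elementary matrices (of size $mn\times mn$): for $X\in\mathbb{C}^{n\times n}$, $M_0(X)=\mathrm{diag}(I_{(m-1)n},X)$, $M_{-m}(X)=\mathrm{diag}(X,I_{(m-1)n})$, and for $i=1,\dots,m-1$ $$M_i(X)=\mathrm{diag}\Big(I_{(m-i-1)n},\begin{bmatrix}X & I_n \\ I_n & 0\end{bmatrix},I_{(i-1)n}\Big),\quad M_{-i}(X)=\mathrm{diag}\Big(I_{(m-i-1)n},\begin{bmatrix}0 & I_n \\ I_n & X\end{bmatrix},I_{(i-1)n}\Big).$$ $M_i^P=M_i(-A_i)$ for $0\le i\le m-1$, $M_{-i}^P=M_{-i}(A_i)$ for $1\le i\le m$. For a tuple $\mathbf t=(t_1,\dots,t_r)$, $M_{\mathbf t}^P=M_{t_1}^P\cdots M_{t_r}^P$; a matrix assignment for $\mathbf t$ is a tuple $X=(X_1,\dots,X_r)$ of $n\times n$ complex matrices, and $M_{\mathbf t}(X)=M_{t_1}(X_1)\cdots M_{t_r}(X_r)$. Empty products equal $I_{mn}$. An assignment is nonsingular if the matrices assigned to positions occupied by indices $\pm0,\pm m$ are nonsingular. EGFP of $P$: let $(\sigma,\omega)$ be a permutation of $\{0:m\}$ and $\tau=-\omega$. Let $\sigma_1,\sigma_2$ be index tuples with indices from $\sigma\setminus\{m-1,m\}$ such that $(\sigma_1,\sigma,\sigma_2)$ satisfies the SIP, and $\tau_1,\tau_2$ index tuples with indices from $\tau\setminus\{-1,-0\}$ such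 that $(\tau_1,\tau,\tau_2)$ satisfies the SIP. Let $X_1,X_2,Y_1,Y_2$ be arbitrary nonsingular matrix assignments for $\sigma_1,\sigma_2,\tau_1,\tau_2$. Then $L(\lambda)=M_{\tau_1}(Y_1)M_{\sigma_1}(X_1)(\lambda M^P_\tau-M^P_\sigma)M_{\sigma_2}(X_2)M_{\tau_2}(Y_2)$ is an EGFP of $P(\lambda)$. If $0\in\sigma$ and $-m\in\tau$, the pencil $\mathbb{L}(\lambda)$ displayed in the claim is called an EGFP of $G(\lambda)$, or of $\mathcal S(\lambda)$. *)

theory Defs
  imports
    "Jordan_Normal_Form.Matrix_Kernel"
    "Jordan_Normal_Form.DL_Rank"
    "HOL-Library.Sublist"
begin

section \<open>Index tuples\<close>

text \<open>Tuples over \<open>{0:m}\<close> are lists of naturals.  In a tuple over \<open>-{0:m}\<close> the index \<open>-0\<close> must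
  be kept apart from \<open>0\<close>, so the indices of elementary matrices carry a formal sign:
  \<open>Neg k\<close> stands for \<open>-k\<close>.\<close>

datatype sindex = Pos nat | Neg nat

definition SIP :: "nat list \<Rightarrow> bool" where
  "SIP \<alpha> \<longleftrightarrow> (\<forall>a b. a < b \<and> b < length \<alpha> \<and> \<alpha> ! a = \<alpha> ! b \<longrightarrow>
     (\<exists>c. a < c \<and> c < b \<and> \<alpha> ! c = \<alpha> ! a + 1))"

text \<open>Shifting \<open>-{0:m}\<close> by \<open>m\<close> sends \<open>-k\<close> to \<open>m - k\<close>.\<close>

fun shift :: "nat \<Rightarrow> sindex \<Rightarrow> nat" where
  "shift m (Pos k) = m + k"
| "shift m (Neg k) = m - k"

definition consecutions :: "nat \<Rightarrow> nat list \<Rightarrow> int" where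
  "consecutions t \<alpha> = (if t \<in> set \<alpha>
     then int (THE p. subseq [t..<Suc (t + p)] \<alpha> \<and> \<not> subseq [t..<Suc (t + p + 1)] \<alpha>)
     else - 1)"

definition inversions :: "nat \<Rightarrow> nat list \<Rightarrow> int" where
  "inversions t \<alpha> = (if t \<in> set \<alpha>
     then int (THE q. subseq (rev [t..<Suc (t + q)]) \<alpha> \<and> \<not> subseq (rev [t..<Suc (t + q + 1)]) \<alpha>)
     else - 1)"

section \<open>Elementary matrices\<close>

text \<open>\<open>M_m(X)\<close> and \<open>M_{-0}(X)\<close> are left unspecified: since \<open>0 \<in> \<sigma>\<close> and \<open>-m \<in> \<tau>\<close> below, neither
  index occurs.\<close>

fun elem_mat :: "nat \<Rightarrow> nat \<Rightarrow> sindex \<Rightarrow> complex mat \<Rightarrow> complex mat" where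
  "elem_mat m n (Pos i) X =
     (if i = 0 then diag_block_mat [1\<^sub>m ((m - 1) * n), X]
      else if i < m then
        diag_block_mat [1\<^sub>m ((m - i - 1) * n),
                        four_block_mat X (1\<^sub>m n) (1\<^sub>m n) (0\<^sub>m n n),
                        1\<^sub>m ((i - 1) * n)]
      else undefined)"
| "elem_mat m n (Neg i) X =
     (if i = m then diag_block_mat [X, 1\<^sub>m ((m - 1) * n)]
      else if 0 < i \<and> i < m then
        diag_block_mat [1\<^sub>m ((m - i - 1) * n),
                        four_block_mat (0\<^sub>m n n) (1\<^sub>m n) (1\<^sub>m n) X,
                        1\<^sub>m ((i - 1) * n)]
      else undefined)"

definition elem_prod :: "nat \<Rightarrow> nat \<Rightarrow> sindex list \<Rightarrow> complex mat list \<Rightarrow> complex mat" where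
  "elem_prod m n t X = foldr (\<lambda>(i, Y) Q. elem_mat m n i Y * Q) (zip t X) (1\<^sub>m (m * n))"

text \<open>The assignment turning \<open>M_t(X)\<close> into \<open>M_t^P\<close>: \<open>-A_i\<close> at the index \<open>i\<close>, \<open>A_i\<close> at \<open>-i\<close>.\<close>

fun coeff_assign :: "(nat \<Rightarrow> complex mat) \<Rightarrow> sindex \<Rightarrow> complex mat" where
  "coeff_assign As (Pos i) = - As i"
| "coeff_assign As (Neg i) = As i"

definition elem_prod_P :: "nat \<Rightarrow> nat \<Rightarrow> (nat \<Rightarrow> complex mat) \<Rightarrow> sindex list \<Rightarrow> complex mat" where
  "elem_prod_P m n As t = elem_prod m n t (map (coeff_assign As) t)"

definition nonsingular_assignment ::
  "nat \<Rightarrow> nat \<Rightarrow> sindex list \<Rightarrow> complex mat list \<Rightarrow> bool" where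
  "nonsingular_assignment m n t X \<longleftrightarrow>
     length X = length t \<and> set X \<subseteq> carrier_mat n n \<and>
     (\<forall>k < length t. t ! k \<in> {Pos 0, Neg 0, Pos m, Neg m} \<longrightarrow> invertible_mat (X ! k))"

section \<open>Matrix polynomial, system matrix and pencils\<close>

text \<open>Matrix polynomials and pencils are represented by their complex matrix-valued polynomial
  functions.\<close>

definition matrix_poly :: "nat \<Rightarrow> nat \<Rightarrow> (nat \<Rightarrow> complex mat) \<Rightarrow> complex \<Rightarrow> complex mat" where
  "matrix_poly m n As z = mat n n (\<lambda>(i, j). \<Sum>k\<le>m. z ^ k * As k $$ (i, j))"

definition matrix_poly_of_degree :: "nat \<Rightarrow> nat \<Rightarrow> (nat \<Rightarrow> complex mat) \<Rightarrow> bool" where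
  "matrix_poly_of_degree m n As \<longleftrightarrow> (\<forall>i\<le>m. As i \<in> carrier_mat n n) \<and> As m \<noteq> 0\<^sub>m n n"

definition system_matrix :: "nat \<Rightarrow> nat \<Rightarrow> (nat \<Rightarrow> complex mat) \<Rightarrow>
    complex mat \<Rightarrow> complex mat \<Rightarrow> complex mat \<Rightarrow> complex mat \<Rightarrow> complex \<Rightarrow> complex mat" where
  "system_matrix m n As A E B C z =
     four_block_mat (matrix_poly m n As z) C B (A - z \<cdot>\<^sub>m E)"

definition regular :: "(complex \<Rightarrow> complex mat) \<Rightarrow> bool" where
  "regular S \<longleftrightarrow> (\<lambda>z. det (S z)) \<noteq> (\<lambda>z. 0)"

definition eigenvalue_of :: "(complex \<Rightarrow> complex mat) \<Rightarrow> complex \<Rightarrow> bool" where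
  "eigenvalue_of S \<mu> \<longleftrightarrow> det (S \<mu>) = 0"

definition kronecker :: "complex mat \<Rightarrow> complex mat \<Rightarrow> complex mat" (infixl "\<otimes>\<^sub>k" 75) where
  "X \<otimes>\<^sub>k Y = mat (dim_row X * dim_row Y) (dim_col X * dim_col Y)
     (\<lambda>(i, j). X $$ (i div dim_row Y, j div dim_col Y) * Y $$ (i mod dim_row Y, j mod dim_col Y))"

text \<open>The \<open>j\<close>-th column of \<open>I_m\<close>, counted from 1, as an \<open>m \<times> 1\<close> matrix.\<close>

definition e_col :: "nat \<Rightarrow> nat \<Rightarrow> complex mat" where
  "e_col m j = mat_of_cols m [col (1\<^sub>m m) (j - 1)]"

text \<open>The combinatorial data of an EGFP; here \<open>\<tau> = -\<omega>\<close>.\<close>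

definition EGFP_data :: "nat \<Rightarrow> nat \<Rightarrow> nat list \<Rightarrow> nat list \<Rightarrow> sindex list \<Rightarrow>
    nat list \<Rightarrow> nat list \<Rightarrow> sindex list \<Rightarrow> sindex list \<Rightarrow>
    complex mat list \<Rightarrow> complex mat list \<Rightarrow> complex mat list \<Rightarrow> complex mat list \<Rightarrow> bool" where
  "EGFP_data m n \<sigma> \<omega> \<tau> \<sigma>1 \<sigma>2 \<tau>1 \<tau>2 X1 X2 Y1 Y2 \<longleftrightarrow>
     distinct (\<sigma> @ \<omega>) \<and> set (\<sigma> @ \<omega>) = {0..m} \<and> \<tau> = map Neg \<omega> \<and>
     set \<sigma>1 \<subseteq> set \<sigma> - {m - 1, m} \<and> set \<sigma>2 \<subseteq> set \<sigma> - {m - 1, m} \<and>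
     SIP (\<sigma>1 @ \<sigma> @ \<sigma>2) \<and>
     set \<tau>1 \<subseteq> set \<tau> - {Neg 1, Neg 0} \<and> set \<tau>2 \<subseteq> set \<tau> - {Neg 1, Neg 0} \<and>
     SIP (map (shift m) (\<tau>1 @ \<tau> @ \<tau>2)) \<and>
     nonsingular_assignment m n (map Pos \<sigma>1) X1 \<and> nonsingular_assignment m n (map Pos \<sigma>2) X2 \<and>
     nonsingular_assignment m n \<tau>1 Y1 \<and> nonsingular_assignment m n \<tau>2 Y2"

definition EGFP_P :: "nat \<Rightarrow> nat \<Rightarrow> (nat \<Rightarrow> complex mat) \<Rightarrow> nat list \<Rightarrow> sindex list \<Rightarrow>
    nat list \<Rightarrow> nat list \<Rightarrow> sindex list \<Rightarrow> sindex list \<Rightarrow>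
    complex mat list \<Rightarrow> complex mat list \<Rightarrow> complex mat list \<Rightarrow> complex mat list \<Rightarrow>
    complex \<Rightarrow> complex mat" where
  "EGFP_P m n As \<sigma> \<tau> \<sigma>1 \<sigma>2 \<tau>1 \<tau>2 X1 X2 Y1 Y2 z =
     elem_prod m n \<tau>1 Y1 * elem_prod m n (map Pos \<sigma>1) X1 *
     (z \<cdot>\<^sub>m elem_prod_P m n As \<tau> - elem_prod_P m n As (map Pos \<sigma>)) *
     elem_prod m n (map Pos \<sigma>2) X2 * elem_prod m n \<tau>2 Y2"

definition EGFP_S :: "nat \<Rightarrow> nat \<Rightarrow> (nat \<Rightarrow> complex mat) \<Rightarrow>
    complex mat \<Rightarrow> complex mat \<Rightarrow> complex mat \<Rightarrow> complex mat \<Rightarrow> nat list \<Rightarrow> sindex list \<Rightarrow>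
    nat list \<Rightarrow> nat list \<Rightarrow> sindex list \<Rightarrow> sindex list \<Rightarrow>
    complex mat list \<Rightarrow> complex mat list \<Rightarrow> complex mat list \<Rightarrow> complex mat list \<Rightarrow>
    complex \<Rightarrow> complex mat" where
  "EGFP_S m n As A E B C \<sigma> \<tau> \<sigma>1 \<sigma>2 \<tau>1 \<tau>2 X1 X2 Y1 Y2 z =
     four_block_mat
       (EGFP_P m n As \<sigma> \<tau> \<sigma>1 \<sigma>2 \<tau>1 \<tau>2 X1 X2 Y1 Y2 z)
       (e_col m (nat (int m - inversions 0 (\<sigma>1 @ \<sigma>))) \<otimes>\<^sub>k C)
       (transpose_mat (e_col m (nat (int m - consecutions 0 (\<sigma> @ \<sigma>2)))) \<otimes>\<^sub>k B)
       (A - z \<cdot>\<^sub>m E)"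

section \<open>Null spaces and bases\<close>

text \<open>The right null space is \<open>mat_kernel\<close>.  For the left one, \<open>x\<^sup>T A = 0\<close> is read with \<open>x\<^sup>T\<close> as a
  one-row matrix (no conjugation).\<close>

definition left_null_space :: "complex mat \<Rightarrow> complex vec set" where
  "left_null_space A =
     {x \<in> carrier_vec (dim_row A). mat_of_rows (dim_row A) [x] * A = 0\<^sub>m 1 (dim_col A)}"

text \<open>The columns form a basis as a family, hence the distinctness requirement.\<close>

definition is_basis_of :: "complex mat \<Rightarrow> complex vec set \<Rightarrow> bool" where
  "is_basis_of Z W \<longleftrightarrow> distinct (cols Z) \<and>
     vectorspace.basis class_ring
       (module_vec TYPE(complex) (dim_row Z) \<lparr>carrier := W\<rparr>) (set (cols Z))"

end

theory Submission
  imports Defs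
begin

text \<open>Cut a vector of length \<open>m n\<close> into \<open>m\<close> blocks and number them from below, so that \<open>M_i\<close> and
  \<open>M_{-i}\<close> touch only the blocks \<open>i\<close> and \<open>i - 1\<close>, and the block row selected by
  \<open>e_{m-k}^T \<otimes> I_n\<close> is block \<open>k\<close>.  The theorem follows from the fact that the map
  \<open>(x, y) \<mapsto> (block c_0(\<sigma>, \<sigma>_2) of x, y)\<close> is a bijection from the right null space of the pencil at
  \<open>\<mu>\<close> onto that of the system matrix (\<open>recovery_bij\<close>): a linear bijection sends bases to bases.

  The bijection comes from reducing the pencil to a Fiedler pencil and reading that as a circuit.
  The outer factors are invertible, and the successor infix property guarantees that each of their
  elementary factors either shifts the distinguished block by one or leaves it alone.  So the
  factors to the left of \<open>M_0\<close> turn \<open>e_m \<otimes> C\<close> into \<open>e_{m-i_0(\<sigma>_1,\<sigma>)} \<otimes> C\<close>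
  (\<open>col_index_place\<close>), and those to its right turn block \<open>c_0(\<sigma>,\<sigma>_2)\<close> of \<open>x\<close> into the block
  \<open>0\<close> on which \<open>M_0\<close> acts (\<open>row_index_select\<close>).  Since \<open>M_{-i}(A_i)\<close> is the inverse of
  \<open>M_i(-A_i)\<close> for \<open>0 < i < m\<close>, all factors of \<open>M_\<tau>\<close> except \<open>M_{-m}\<close> can be moved to the other
  term of the pencil; this leaves \<open>\<mu> M_{-m} - M_\<pi>\<close> with \<open>\<pi>\<close> a permutation of \<open>{0..m-1}\<close>
  (\<open>pencil_reduction\<close>).

  Each factor of \<open>M_\<pi>\<close> is a gate with two inputs.  Let \<open>p_i\<close> and \<open>t_i\<close> be the upper and the lower
  input of the gate with index \<open>i\<close>; the term \<open>C y\<close> enters as the lower input \<open>t_0 = -C y\<close> of the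
  gate with index \<open>0\<close>.  In these variables the null vector equation is a Horner scheme:
  \<open>p_{k+1}\<close> is \<open>\<mu> p_k\<close> or \<open>p_k\<close>, and \<open>t_k - A_k p_k\<close> is \<open>t_{k+1}\<close> or \<open>\<mu> t_{k+1}\<close>, depending on whether \<open>\<pi>\<close> has an inversion
  or a consecution at \<open>k\<close> (\<open>pencil_eq_iff_horner\<close>).  Solving for \<open>p\<close> upwards and then for \<open>t\<close>
  downwards, the vector \<open>p_0\<close> determines the whole solution, and the condition that is left at
  \<open>t_0\<close> reads \<open>P(\<mu>) p_0 + C y = 0\<close> (\<open>horner_value\<close>).  The vector \<open>p_0\<close> is exactly the selected
  block.

  For left null spaces everything is transposed: this reverses all tuples and therefore exchanges
  inversions and consecutions, and the roles of \<open>B\<close> and \<open>C\<close>.\<close>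

section \<open>Bases of null spaces\<close>

lemma ex1_transfer_bij:
  assumes "bij_betw f A B" and "\<And>a. a \<in> A \<Longrightarrow> P a \<longleftrightarrow> Q (f a)"
  shows "(\<exists>!a. a \<in> A \<and> P a) \<longleftrightarrow> (\<exists>!b. b \<in> B \<and> Q b)"
proof -
  have B: "b \<in> B \<longleftrightarrow> (\<exists>a \<in> A. b = f a)" for b
    using assms(1) by (auto simp: bij_betw_def)
  have inj: "f a = f a' \<longleftrightarrow> a = a'" if "a \<in> A" "a' \<in> A" for a a'
    using assms(1) that by (auto simp: bij_betw_def inj_on_eq_iff)
  show ?thesis
  proof
    assume "\<exists>!a. a \<in> A \<and> P a"
    then obtain a where a: "a \<in> A \<and> P a" and u: "\<forall>a'. a' \<in> A \<and> P a' \<longrightarrow> a' = a"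
      by - (erule ex1E, rule that)
    show "\<exists>!b. b \<in> B \<and> Q b"
    proof (rule ex1I[of _ "f a"])
      show "f a \<in> B \<and> Q (f a)" using a assms(2) B by auto
    next
      fix b assume b: "b \<in> B \<and> Q b"
      then obtain a' where a': "a' \<in> A" "b = f a'" using B by auto
      then have "a' = a" using u assms(2)[OF a'(1)] b by simp
      then show "b = f a" using a' by simp
    qed
  next
    assume "\<exists>!b. b \<in> B \<and> Q b"
    then obtain b where b: "b \<in> B \<and> Q b" and u: "\<forall>b'. b' \<in> B \<and> Q b' \<longrightarrow> b' = b"
      by - (erule ex1E, rule that)
    obtain a where a: "a \<in> A" "b = f a" using b B by auto
    show "\<exists>!a. a \<in> A \<and> P a"
    proof (rule ex1I[of _ a])
      show "a \<in> A \<and> P a" using a b assms(2) by simp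
    next
      fix a' assume a': "a' \<in> A \<and> P a'"
      then have "f a' = b" using u B assms(2)[of a'] by blast
      then show "a' = a" using a' a inj[of a' a] by simp
    qed
  qed
qed

text \<open>Being a basis means that the columns give unique coordinates.  The statement avoids the set of
  columns, and with it the difference between families and sets, so that it can be transported
  along linear bijections.\<close>
lemma is_basis_of_iff_unique_coords:
  fixes L Z :: "complex mat"
  assumes L: "L \<in> carrier_mat nr N" and Z: "Z \<in> carrier_mat N p"
  shows "is_basis_of Z (mat_kernel L) \<longleftrightarrow>
    (\<forall>c \<in> carrier_vec p. Z *\<^sub>v c \<in> mat_kernel L) \<and>
    (\<forall>v \<in> mat_kernel L. \<exists>!c. c \<in> carrier_vec p \<and> Z *\<^sub>v c = v)" (is "?B \<longleftrightarrow> ?cl \<and> ?un")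
proof -
  interpret kernel nr N L by (unfold_locales, rule L)
  let ?S = "set (cols Z)"
  have dimZ: "dim_row Z = N" "dim_col Z = p" using Z by auto
  have B: "?B \<longleftrightarrow> distinct (cols Z) \<and> Ker.basis ?S"
    unfolding is_basis_of_def dimZ ..
  have unit: "Z *\<^sub>v unit_vec p i = col Z i" if "i < p" for i
    using that Z by (intro eq_vecI) auto
  \<comment> \<open>equal columns would give one kernel vector two coordinate vectors\<close>
  have dist: "distinct (cols Z)" if c: ?cl and u: ?un
  proof -
    have "i = j" if ij: "i < p" "j < p" "col Z i = col Z j" for i j
    proof -
      have "col Z i \<in> mat_kernel L" using c unit[OF ij(1)] by (metis unit_vec_carrier)
      then have "unit_vec p i = (unit_vec p j :: complex vec)"
        using u unit[OF ij(1)] unit[OF ij(2)] ij(3) by (metis unit_vec_carrier)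
      then have "unit_vec p i $ i = (unit_vec p j $ i :: complex)" by (rule arg_cong)
      then show "i = j" using ij by (simp split: if_splits)
    qed
    then show ?thesis by (auto simp: distinct_conv_nth dimZ)
  qed
  have cols_ker: "?S \<subseteq> mat_kernel L" if ?cl
  proof
    fix v assume "v \<in> ?S"
    then obtain i where "i < p" "v = col Z i" by (auto simp: cols_def dimZ)
    then show "v \<in> mat_kernel L" using that unit by (metis unit_vec_carrier)
  qed
  \<comment> \<open>coefficient functions on the set of columns correspond to coordinate vectors\<close>
  have crit: "Ker.basis ?S \<longleftrightarrow> ?un" if d: "distinct (cols Z)" and s: "?S \<subseteq> mat_kernel L"
  proof -
    let ?co = "\<lambda>a. vec p (\<lambda>i. a (col Z i)) :: complex vec"
    have lc: "Ker.lincomb a ?S = Z *\<^sub>v ?co a" for a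
      unfolding lincomb_same[OF s] NC.mat_mult_eq_lincomb[OF Z d] ..
    have inj: "inj_on ?co (?S \<rightarrow>\<^sub>E UNIV)"
    proof (rule inj_onI)
      fix a b :: "complex vec \<Rightarrow> complex"
      assume ab: "a \<in> ?S \<rightarrow>\<^sub>E UNIV" "b \<in> ?S \<rightarrow>\<^sub>E UNIV" "?co a = ?co b"
      have "a v = b v" if "v \<in> ?S" for v
      proof -
        from that obtain i where i: "i < p" "v = col Z i" by (auto simp: cols_def dimZ)
        have "?co a $ i = ?co b $ i" using ab(3) by simp
        then show ?thesis using i by simp
      qed
      then show "a = b" using ab(1,2) by (intro ext) (metis PiE_arb)
    qed
    have surj: "\<exists>a \<in> ?S \<rightarrow>\<^sub>E UNIV. ?co a = c" if c: "c \<in> carrier_vec p" for c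
    proof -
      define a where "a = restrict (\<lambda>v. c $ find_first v (cols Z)) ?S"
      have ai: "a (col Z i) = c $ i" if i: "i < p" for i
      proof -
        have "cols Z ! i = col Z i" using i dimZ by simp
        then have "find_first (col Z i) (cols Z) = i"
          using find_first_unique[OF d, of i] i dimZ by simp
        moreover have "col Z i \<in> ?S" using i dimZ by (simp add: cols_def)
        ultimately show ?thesis by (simp add: a_def)
      qed
      have "?co a = c" using c ai by (intro eq_vecI) simp_all
      moreover have "a \<in> ?S \<rightarrow>\<^sub>E UNIV" by (simp add: a_def)
      ultimately show ?thesis by (rule bexI)
    qed
    have bij: "bij_betw ?co (?S \<rightarrow>\<^sub>E UNIV) (carrier_vec p)"
      unfolding bij_betw_def
    proof (intro conjI inj equalityI subsetI)
      fix c :: "complex vec" assume "c \<in> carrier_vec p"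
      from surj[OF this] show "c \<in> ?co ` (?S \<rightarrow>\<^sub>E UNIV)" by (metis imageI)
    qed auto
    have "(\<exists>!a. a \<in> ?S \<rightarrow>\<^sub>E UNIV \<and> Ker.lincomb a ?S = v) \<longleftrightarrow>
          (\<exists>!c. c \<in> carrier_vec p \<and> Z *\<^sub>v c = v)" for v
      by (rule ex1_transfer_bij[OF bij]) (simp only: lc)
    with Ker.basis_criterion[OF finite_set s] show ?thesis by (simp only: Ball_def)
  qed
  have cl: "?cl" if s: "?S \<subseteq> mat_kernel L" and d: "distinct (cols Z)"
  proof
    fix c :: "complex vec" assume c: "c \<in> carrier_vec p"
    have "Ker.lincomb (\<lambda>a. c $ find_first a (cols Z)) ?S \<in> mat_kernel L"
      by (rule Ker.lincomb_closed[OF s]) simp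
    then show "Z *\<^sub>v c \<in> mat_kernel L"
      unfolding lincomb_same[OF s] NC.lincomb_eq_mat_mult[OF Z c d] .
  qed
  show ?thesis
  proof
    assume ?B
    then have d: "distinct (cols Z)" and b: "Ker.basis ?S" using B by auto
    from b have s: "?S \<subseteq> mat_kernel L" unfolding Ker.basis_def by simp
    show "?cl \<and> ?un" using cl[OF s d] crit[OF d s] b by simp
  next
    assume cu: "?cl \<and> ?un"
    then have d: "distinct (cols Z)" and s: "?S \<subseteq> mat_kernel L"
      using dist cols_ker by auto
    show ?B using B crit[OF d s] d cu by simp
  qed
qed

lemma is_basis_of_image:
  fixes L L' T Z :: "complex mat"
  assumes L: "L \<in> carrier_mat nr N" and L': "L' \<in> carrier_mat nr' N'"
    and Z: "Z \<in> carrier_mat N p" and T: "T \<in> carrier_mat N' N"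
    and bij: "bij_betw (\<lambda>v. T *\<^sub>v v) (mat_kernel L) (mat_kernel L')"
    and basis: "is_basis_of Z (mat_kernel L)"
  shows "is_basis_of (T * Z) (mat_kernel L')"
proof -
  from basis[unfolded is_basis_of_iff_unique_coords[OF L Z]]
  have cl: "\<And>c. c \<in> carrier_vec p \<Longrightarrow> Z *\<^sub>v c \<in> mat_kernel L"
    and un: "\<And>v. v \<in> mat_kernel L \<Longrightarrow> \<exists>!c. c \<in> carrier_vec p \<and> Z *\<^sub>v c = v" by auto
  have TZ: "T * Z \<in> carrier_mat N' p" using T Z by simp
  have app: "(T * Z) *\<^sub>v c = T *\<^sub>v (Z *\<^sub>v c)" if "c \<in> carrier_vec p" for c
    using assoc_mult_mat_vec[OF T Z that] .
  show ?thesis unfolding is_basis_of_iff_unique_coords[OF L' TZ]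
  proof (intro conjI ballI)
    fix c :: "complex vec" assume "c \<in> carrier_vec p"
    then show "(T * Z) *\<^sub>v c \<in> mat_kernel L'"
      using app cl bij by (auto dest: bij_betwE)
  next
    fix v assume "v \<in> mat_kernel L'"
    then have "v \<in> (\<lambda>u. T *\<^sub>v u) ` mat_kernel L" using bij by (simp add: bij_betw_def)
    then obtain u where u: "u \<in> mat_kernel L" "T *\<^sub>v u = v" by (metis imageE)
    from un[OF u(1)] obtain c where c: "c \<in> carrier_vec p" "Z *\<^sub>v c = u"
      and cu: "\<And>d. d \<in> carrier_vec p \<Longrightarrow> Z *\<^sub>v d = u \<Longrightarrow> d = c" by blast
    show "\<exists>!c. c \<in> carrier_vec p \<and> T * Z *\<^sub>v c = v"
    proof (rule ex1I[of _ c])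
      show "c \<in> carrier_vec p \<and> T * Z *\<^sub>v c = v" using c u app by auto
    next
      fix d assume d: "d \<in> carrier_vec p \<and> T * Z *\<^sub>v d = v"
      then have "T *\<^sub>v (Z *\<^sub>v d) = T *\<^sub>v u" using app u by auto
      moreover have "inj_on (\<lambda>v. T *\<^sub>v v) (mat_kernel L)" using bij by (simp add: bij_betw_def)
      ultimately have "Z *\<^sub>v d = u" using cl d u(1) by (simp add: inj_on_eq_iff)
      then show "d = c" using cu d by auto
    qed
  qed
qed

lemma left_null_space_eq_kernel_transpose:
  "left_null_space M = mat_kernel (transpose_mat M)"
proof -
  have "mat_of_rows (dim_row M) [x] * M = 0\<^sub>m 1 (dim_col M) \<longleftrightarrow>
        transpose_mat M *\<^sub>v x = 0\<^sub>v (dim_col M)" if x: "x \<in> carrier_vec (dim_row M)" for x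
  proof -
    have "(mat_of_rows (dim_row M) [x] * M) $$ (0, j) = (transpose_mat M *\<^sub>v x) $ j"
      if "j < dim_col M" for j
      using that x by (simp add: comm_scalar_prod[of x "dim_row M"])
    then show ?thesis by (auto simp: vec_eq_iff mat_eq_iff)
  qed
  then show ?thesis unfolding left_null_space_def mat_kernel_def by auto
qed

section \<open>Inversions, consecutions and the successor infix property\<close>

text \<open>The number of entries that a greedy left-to-right scan matches with \<open>0, 1, 2, \<dots>\<close>.  Greedy
  matching is optimal, so this is \<open>c_0 + 1\<close>, also for tuples without the index \<open>0\<close>; and unlike
  \<open>consecutions\<close> it can be updated when an entry is appended.\<close>
definition climb :: "nat list \<Rightarrow> nat" where
  "climb \<alpha> = foldl (\<lambda>q j. if j = q then Suc q else q) 0 \<alpha>"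

lemma climb_Nil [simp]: "climb [] = 0"
  by (simp add: climb_def)

lemma climb_snoc [simp]: "climb (\<alpha> @ [j]) = (if j = climb \<alpha> then Suc (climb \<alpha>) else climb \<alpha>)"
  by (simp add: climb_def)

lemma subseq_rev_rev: "subseq (rev xs) (rev ys) \<longleftrightarrow> subseq xs ys"
proof -
  have "subseq (rev xs) (rev ys)" if "subseq xs ys" for xs ys :: "'a list"
    using that
  proof (induction rule: list_emb.induct)
    case (list_emb_Cons xs ys y)
    then show ?case using subseq_rev_drop_many by simp
  next
    case (list_emb_Cons2 x y xs ys)
    then show ?case by simp
  qed simp
  from this[of xs ys] this[of "rev xs" "rev ys"] show ?thesis by auto
qed

lemma subseq_snoc_snoc:
  "subseq (xs @ [x]) (ys @ [y]) \<longleftrightarrow> (if x = y then subseq xs ys else subseq (xs @ [x]) ys)"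
proof -
  have "subseq (xs @ [x]) (ys @ [y]) \<longleftrightarrow> subseq (x # rev xs) (y # rev ys)"
    using subseq_rev_rev[of "xs @ [x]" "ys @ [y]"] by simp
  moreover have "subseq (rev xs) (rev ys) \<longleftrightarrow> subseq xs ys" by (rule subseq_rev_rev)
  moreover have "subseq (x # rev xs) (rev ys) \<longleftrightarrow> subseq (xs @ [x]) ys"
    using subseq_rev_rev[of "xs @ [x]" ys] by simp
  ultimately show ?thesis by (auto simp: subseq_Cons2_iff)
qed

lemma subseq_upt_iff_climb: "subseq [0..<k] \<alpha> \<longleftrightarrow> k \<le> climb \<alpha>"
proof (induction \<alpha> arbitrary: k rule: rev_induct)
  case Nil
  then show ?case by (cases k) auto
next
  case (snoc j \<alpha>)
  show ?case
  proof (cases k)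
    case (Suc k')
    then show ?thesis using snoc[of k'] snoc[of k] by (auto simp: subseq_snoc_snoc)
  qed simp
qed

lemma mem_0_iff_climb_pos: "0 \<in> set \<alpha> \<longleftrightarrow> 0 < climb \<alpha>"
  using subseq_upt_iff_climb[of 1 \<alpha>] by (auto simp: subseq_singleton_left)

lemma consecutions_0: "consecutions 0 \<alpha> = int (climb \<alpha>) - 1"
proof (cases "0 \<in> set \<alpha>")
  case True
  then obtain c where c: "climb \<alpha> = Suc c" using mem_0_iff_climb_pos by (auto simp: gr0_conv_Suc)
  have "(THE p. subseq [0..<Suc (0 + p)] \<alpha> \<and> \<not> subseq [0..<Suc (0 + p + 1)] \<alpha>) = c"
    by (rule the_equality) (auto simp only: subseq_upt_iff_climb c)
  then show ?thesis using True c by (simp add: consecutions_def)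
next
  case False
  then show ?thesis using mem_0_iff_climb_pos by (auto simp: consecutions_def)
qed

text \<open>An inversion chain \<open>(q, \<dots>, 1, 0)\<close> read backwards is a consecution chain.\<close>
lemma inversions_0: "inversions 0 \<alpha> = int (climb (rev \<alpha>)) - 1"
proof -
  have swap: "subseq (rev xs) \<alpha> \<longleftrightarrow> subseq xs (rev \<alpha>)" for xs :: "nat list"
    using subseq_rev_rev[of xs "rev \<alpha>"] by simp
  have "inversions 0 \<alpha> = consecutions 0 (rev \<alpha>)"
    unfolding inversions_def consecutions_def swap set_rev ..
  then show ?thesis using consecutions_0 by simp
qed

text \<open>The scan starts at the first \<open>0\<close>.\<close>
lemma climb_append_no_0:
  assumes "0 \<notin> set \<beta>"
  shows "climb (\<beta> @ \<alpha>) = climb \<alpha>"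
proof -
  have "foldl (\<lambda>q j. if j = q then Suc q else q) 0 \<beta> = 0"
    using assms by (induction \<beta>) auto
  then show ?thesis by (simp add: climb_def)
qed

text \<open>The last matched entry \<open>q\<close> has no \<open>q + 1\<close> to its right, since the scan would match it.\<close>
lemma climb_last_step:
  assumes "climb \<alpha> = Suc q"
  shows "\<exists>\<alpha>1 \<alpha>2. \<alpha> = \<alpha>1 @ q # \<alpha>2 \<and> Suc q \<notin> set \<alpha>2"
  using assms
proof (induction \<alpha> rule: rev_induct)
  case (snoc j \<alpha>)
  show ?case
  proof (cases "j = climb \<alpha>")
    case True
    then have "\<alpha> @ [j] = \<alpha> @ q # []" using snoc.prems by simp
    then show ?thesis by (intro exI[of _ \<alpha>] exI[of _ "[]"]) simp
  next
    case False
    then have c: "climb \<alpha> = Suc q" using snoc.prems by simp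
    from snoc.IH[OF this] obtain \<alpha>1 \<alpha>2 where "\<alpha> = \<alpha>1 @ q # \<alpha>2" "Suc q \<notin> set \<alpha>2" by blast
    then show ?thesis using False c by (intro exI[of _ \<alpha>1] exI[of _ "\<alpha>2 @ [j]"]) auto
  qed
qed simp

lemma climb_last_mem: "0 < climb \<alpha> \<Longrightarrow> climb \<alpha> - 1 \<in> set \<alpha>"
  using climb_last_step[of \<alpha> "climb \<alpha> - 1"] by (metis Suc_pred' in_set_conv_decomp)

lemma SIP_between:
  assumes "SIP (\<alpha> @ x # \<beta> @ x # \<delta>)"
  shows "Suc x \<in> set \<beta>"
proof -
  let ?l = "\<alpha> @ x # \<beta> @ x # \<delta>"
  let ?a = "length \<alpha>" and ?b = "Suc (length \<alpha> + length \<beta>)"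
  have "?l ! ?a = x" "?l ! ?b = x" by (auto simp: nth_append)
  moreover have "?a < ?b" "?b < length ?l" by auto
  ultimately obtain c where c: "?a < c" "c < ?b" "?l ! c = x + 1"
    using assms unfolding SIP_def by metis
  then obtain d where d: "c = Suc ?a + d" by (metis Suc_leI le_Suc_ex)
  then have "d < length \<beta>" using c by simp
  moreover from this have "?l ! c = \<beta> ! d" by (simp add: d nth_append)
  ultimately show ?thesis using c(3) by (metis Suc_eq_plus1 nth_mem)
qed

lemma SIP_infix:
  assumes "SIP (\<alpha> @ \<beta> @ \<gamma>)"
  shows "SIP \<beta>"
  unfolding SIP_def
proof (intro allI impI)
  fix a b assume ab: "a < b \<and> b < length \<beta> \<and> \<beta> ! a = \<beta> ! b"
  let ?l = "\<alpha> @ \<beta> @ \<gamma>" and ?s = "length \<alpha>"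
  have nth: "?l ! (?s + i) = \<beta> ! i" if "i < length \<beta>" for i
    using that by (simp add: nth_append)
  have "?s + a < ?s + b" "?s + b < length ?l" "?l ! (?s + a) = ?l ! (?s + b)"
    using ab nth[of a] nth[of b] by auto
  then obtain c where c: "?s + a < c" "c < ?s + b" "?l ! c = ?l ! (?s + a) + 1"
    using assms unfolding SIP_def by blast
  then obtain d where d: "c = ?s + d" by (metis add_lessD1 less_imp_add_positive add.assoc)
  then show "\<exists>c>a. c < b \<and> \<beta> ! c = \<beta> ! a + 1"
    using c ab nth[of d] nth[of a] by auto
qed

lemma SIP_rev:
  assumes "SIP \<alpha>"
  shows "SIP (rev \<alpha>)"
  unfolding SIP_def
proof (intro allI impI)
  fix a b assume ab: "a < b \<and> b < length (rev \<alpha>) \<and> rev \<alpha> ! a = rev \<alpha> ! b"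
  let ?r = "\<lambda>i. length \<alpha> - Suc i"
  have nth: "rev \<alpha> ! i = \<alpha> ! ?r i" if "i < length \<alpha>" for i
    using that by (simp add: rev_nth)
  have "?r b < ?r a" "?r a < length \<alpha>" "\<alpha> ! ?r b = \<alpha> ! ?r a"
    using ab nth[of a] nth[of b] by auto
  then obtain c where c: "?r b < c" "c < ?r a" "\<alpha> ! c = \<alpha> ! ?r b + 1"
    using assms unfolding SIP_def by blast
  have "?r (?r c) = c" using c by auto
  then have "rev \<alpha> ! ?r c = rev \<alpha> ! a + 1"
    using c ab nth[of "?r c"] nth[of a] nth[of b] by auto
  moreover have "a < ?r c" "?r c < b" using c by auto
  ultimately show "\<exists>c>a. c < b \<and> rev \<alpha> ! c = rev \<alpha> ! a + 1" by blast
qed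

text \<open>Appending an index \<open>j\<close> that has just been matched would need, by the SIP, a \<open>j + 1\<close> after the
  last matched entry, which would have extended the match.  So an appended entry either extends
  the match or is not the last matched index.\<close>
lemma SIP_snoc_imp_climb_neq:
  assumes "SIP (\<gamma> @ [j])"
  shows "climb \<gamma> \<noteq> Suc j"
proof
  assume "climb \<gamma> = Suc j"
  then obtain \<gamma>1 \<gamma>2 where "\<gamma> = \<gamma>1 @ j # \<gamma>2" "Suc j \<notin> set \<gamma>2"
    using climb_last_step by blast
  then show False using SIP_between[of \<gamma>1 j \<gamma>2 "[]"] assms by simp
qed

section \<open>Block rows and elementary matrices\<close>

text \<open>Blocks are counted from below, starting with \<open>0\<close>, because the elementary matrix with index
  \<open>i\<close> then acts on the blocks \<open>i\<close> and \<open>i - 1\<close>.\<close>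
definition blk :: "nat \<Rightarrow> nat \<Rightarrow> nat \<Rightarrow> complex vec \<Rightarrow> complex vec" where
  "blk m n k v = vec n (\<lambda>i. v $ ((m - 1 - k) * n + i))"

lemma block_index_less:
  fixes k m i n :: nat
  assumes k: "k < m" and i: "i < n"
  shows "(m - 1 - k) * n + i < m * n"
proof -
  have "(m - 1 - k) * n + i < (m - 1 - k) * n + n" using i by (rule add_strict_left_mono)
  also have "\<dots> = Suc (m - 1 - k) * n" by simp
  also have "\<dots> \<le> m * n" using k by (intro mult_le_mono1) simp
  finally show ?thesis .
qed

lemma blk_carrier [simp]: "blk m n k v \<in> carrier_vec n"
  by (simp add: blk_def)

lemma dim_blk [simp]: "dim_vec (blk m n k v) = n"
  by (simp add: blk_def)

lemma blk_linear:
  assumes "k < m" "v \<in> carrier_vec (m * n)" "w \<in> carrier_vec (m * n)"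
  shows "blk m n k (v + w) = blk m n k v + blk m n k w"
    and "blk m n k (v - w) = blk m n k v - blk m n k w"
    and "blk m n k (a \<cdot>\<^sub>v v) = a \<cdot>\<^sub>v blk m n k v"
  using assms block_index_less[of k m _ n] by (auto simp: blk_def intro!: eq_vecI)

lemma vec_eq_blkI:
  assumes v: "v \<in> carrier_vec (m * n)" and w: "w \<in> carrier_vec (m * n)"
    and eq: "\<And>k. k < m \<Longrightarrow> blk m n k v = blk m n k w"
  shows "v = w"
proof (rule eq_vecI)
  fix j assume "j < dim_vec w"
  then have j: "j < m * n" using w by simp
  then have n: "0 < n" by (cases n) auto
  define k where "k = m - 1 - j div n"
  have q: "j div n < m" using j n by (simp add: less_mult_imp_div_less)
  then have k: "k < m" "m - 1 - k = j div n" by (auto simp: k_def)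
  have "blk m n k v $ (j mod n) = blk m n k w $ (j mod n)" using eq[OF k(1)] by simp
  then have "v $ (j div n * n + j mod n) = w $ (j div n * n + j mod n)"
    unfolding blk_def k(2) using n by simp
  then show "v $ j = w $ j" by simp
qed (use v w in simp)

lemma vec_of_blocks:
  assumes "\<And>k. k < m \<Longrightarrow> f k \<in> carrier_vec n"
  shows "\<exists>v \<in> carrier_vec (m * n). \<forall>k<m. blk m n k v = f k"
proof (intro bexI allI impI)
  let ?v = "vec (m * n) (\<lambda>j. f (m - 1 - j div n) $ (j mod n))"
  show "?v \<in> carrier_vec (m * n)" by simp
  fix k assume k: "k < m"
  have "m - Suc (m - Suc k) = k" using k by simp
  then show "blk m n k ?v = f k"
    using assms[OF k] block_index_less[OF k, of _ n] by (intro eq_vecI) (auto simp: blk_def)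
qed

text \<open>This is \<open>e_{m-k} \<otimes> c\<close>.\<close>
definition place :: "nat \<Rightarrow> nat \<Rightarrow> nat \<Rightarrow> complex vec \<Rightarrow> complex vec" where
  "place m n k c = vec (m * n) (\<lambda>j. if j div n = m - 1 - k then c $ (j mod n) else 0)"

lemma place_carrier [simp]: "place m n k c \<in> carrier_vec (m * n)"
  by (simp add: place_def)

lemma blk_place:
  assumes "k < m" "j < m" "c \<in> carrier_vec n"
  shows "blk m n k (place m n j c) = (if k = j then c else 0\<^sub>v n)"
proof -
  have "m - Suc k = m - Suc j \<longleftrightarrow> k = j" using assms by auto
  then show ?thesis using assms block_index_less[OF assms(1), of _ n]
    by (intro eq_vecI) (auto simp: blk_def place_def)
qed

text \<open>The indices for which \<open>elem_mat\<close> is specified.\<close>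
definition index_ok :: "nat \<Rightarrow> sindex \<Rightarrow> bool" where
  "index_ok m t \<longleftrightarrow> (case t of Pos i \<Rightarrow> i < m | Neg i \<Rightarrow> 0 < i \<and> i \<le> m)"

lemma diag3_carrier:
  assumes "M \<in> carrier_mat N N"
  shows "diag_block_mat [1\<^sub>m a, M, 1\<^sub>m b] \<in> carrier_mat (a + (N + b)) (a + (N + b))"
  using assms by (intro carrier_matI) (auto simp: dim_diag_block_mat)

lemma middle_dim:
  assumes "0 < i" "i < m"
  shows "(m - i - 1) * n + ((n + n) + (i - 1) * n) = m * (n::nat)"
proof -
  obtain p q where pq: "m - i - 1 = p" "i - 1 = q" by blast
  then have "m = p + 2 + q" using assms by simp
  then show ?thesis unfolding pq by (simp add: add_mult_distrib)
qed

lemma corner_dim: "0 < m \<Longrightarrow> n + (m - 1) * n = m * (n::nat)"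
  by (metis Suc_diff_1 mult_Suc)

lemma elem_mat_carrier:
  assumes "index_ok m t" "X \<in> carrier_mat n n"
  shows "elem_mat m n t X \<in> carrier_mat (m * n) (m * n)"
proof (cases t)
  case (Pos i)
  show ?thesis
  proof (cases "i = 0")
    case True
    have "elem_mat m n t X \<in> carrier_mat ((m - 1) * n + n) ((m - 1) * n + n)"
      using Pos True assms(2) by (intro carrier_matI) (auto simp: dim_diag_block_mat)
    then show ?thesis using corner_dim[of m n] assms Pos by (simp add: index_ok_def add.commute)
  next
    case False
    then have "elem_mat m n t X \<in> carrier_mat ((m - i - 1) * n + ((n + n) + (i - 1) * n))
        ((m - i - 1) * n + ((n + n) + (i - 1) * n))"
      using Pos assms by (auto simp: index_ok_def intro!: diag3_carrier four_block_carrier_mat)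
    then show ?thesis using middle_dim[of i m n] False assms Pos by (simp add: index_ok_def)
  qed
next
  case (Neg i)
  show ?thesis
  proof (cases "i = m")
    case True
    have "elem_mat m n t X \<in> carrier_mat (n + (m - 1) * n) (n + (m - 1) * n)"
      using Neg True assms(2) by (intro carrier_matI) (auto simp: dim_diag_block_mat)
    then show ?thesis using corner_dim[of m n] assms Neg True by (simp add: index_ok_def)
  next
    case False
    then have "elem_mat m n t X \<in> carrier_mat ((m - i - 1) * n + ((n + n) + (i - 1) * n))
        ((m - i - 1) * n + ((n + n) + (i - 1) * n))"
      using Neg assms by (auto simp: index_ok_def intro!: diag3_carrier four_block_carrier_mat)
    then show ?thesis using middle_dim[of i m n] False assms Neg by (simp add: index_ok_def)
  qed
qed

lemma obtain_append:
  assumes "v \<in> carrier_vec (a + b)"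
  obtains v1 v2 where "v1 \<in> carrier_vec a" "v2 \<in> carrier_vec b" "v = v1 @\<^sub>v v2"
  using vec_first_last_append[OF assms] vec_first_carrier vec_last_carrier by metis

lemma diag2_mult_vec:
  assumes "M \<in> carrier_mat a a" "N \<in> carrier_mat b b" "v \<in> carrier_vec a" "w \<in> carrier_vec b"
  shows "diag_block_mat [M, N] *\<^sub>v (v @\<^sub>v w) = (M *\<^sub>v v) @\<^sub>v (N *\<^sub>v w)"
  using mult_mat_vec_split[OF assms] assms
  unfolding diag_block_mat.simps(2)[of M] diag_block_mat_singleton Let_def by simp

lemma diag3_mult_vec:
  fixes M :: "complex mat"
  assumes "M \<in> carrier_mat N N" "u \<in> carrier_vec a" "v \<in> carrier_vec N" "w \<in> carrier_vec b"
  shows "diag_block_mat [1\<^sub>m a, M, 1\<^sub>m b] *\<^sub>v (u @\<^sub>v (v @\<^sub>v w)) = u @\<^sub>v ((M *\<^sub>v v) @\<^sub>v w)"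
proof -
  obtain D where D_def: "D = diag_block_mat [M, 1\<^sub>m b]" by blast
  have D: "D \<in> carrier_mat (N + b) (N + b)"
    using assms(1) unfolding D_def by (intro carrier_matI) (auto simp: dim_diag_block_mat)
  have vw: "v @\<^sub>v w \<in> carrier_vec (N + b)" using assms by simp
  have "diag_block_mat [1\<^sub>m a, M, 1\<^sub>m b] = diag_block_mat [1\<^sub>m a, D]"
    unfolding D_def diag_block_mat.simps(2)[of "1\<^sub>m a"] diag_block_mat_singleton ..
  also have "\<dots> *\<^sub>v (u @\<^sub>v (v @\<^sub>v w)) = (1\<^sub>m a *\<^sub>v u) @\<^sub>v (D *\<^sub>v (v @\<^sub>v w))"
    by (rule diag2_mult_vec[OF one_carrier_mat D assms(2) vw])
  also have "D *\<^sub>v (v @\<^sub>v w) = (M *\<^sub>v v) @\<^sub>v (1\<^sub>m b *\<^sub>v w)"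
    unfolding D_def by (rule diag2_mult_vec[OF assms(1) one_carrier_mat assms(3,4)])
  finally show ?thesis unfolding one_mult_mat_vec[OF assms(2)] one_mult_mat_vec[OF assms(4)] .
qed

lemma mult_mat_vec_pair:
  fixes v w :: "complex vec"
  assumes "X \<in> carrier_mat n n" "v \<in> carrier_vec n" "w \<in> carrier_vec n"
  shows "four_block_mat X (1\<^sub>m n) (1\<^sub>m n) (0\<^sub>m n n) *\<^sub>v (v @\<^sub>v w) = (X *\<^sub>v v + w) @\<^sub>v v"
    and "four_block_mat (0\<^sub>m n n) (1\<^sub>m n) (1\<^sub>m n) X *\<^sub>v (v @\<^sub>v w) = w @\<^sub>v (v + X *\<^sub>v w)"
proof -
  have z: "0\<^sub>m n n *\<^sub>v u = 0\<^sub>v n" if "u \<in> carrier_vec n" for u :: "complex vec"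
    using that by (intro eq_vecI) auto
  show "four_block_mat X (1\<^sub>m n) (1\<^sub>m n) (0\<^sub>m n n) *\<^sub>v (v @\<^sub>v w) = (X *\<^sub>v v + w) @\<^sub>v v"
    using assms z by (subst four_block_mat_mult_vec[of _ n n _ n _ n]) auto
  show "four_block_mat (0\<^sub>m n n) (1\<^sub>m n) (1\<^sub>m n) X *\<^sub>v (v @\<^sub>v w) = w @\<^sub>v (v + X *\<^sub>v w)"
    using assms z by (subst four_block_mat_mult_vec[of _ n n _ n _ n]) auto
qed

text \<open>The decomposition of a vector along the diagonal blocks of \<open>M_i\<close> and \<open>M_{-i}\<close>: \<open>b\<close> and \<open>c\<close> are
  the blocks \<open>i\<close> and \<open>i - 1\<close>.\<close>
lemma blk_append4:
  assumes "a \<in> carrier_vec ((m - i - 1) * n)" "b \<in> carrier_vec n" "c \<in> carrier_vec n"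
    and "d \<in> carrier_vec ((i - 1) * n)" "0 < i" "i < m" "k < m"
  shows "blk m n k (a @\<^sub>v ((b @\<^sub>v c) @\<^sub>v d)) =
    (if k = i then b else if k = i - 1 then c
     else if i < k then vec n (\<lambda>j. a $ ((m - 1 - k) * n + j))
     else vec n (\<lambda>j. d $ ((i - 2 - k) * n + j)))" (is "blk m n k ?v = _")
proof -
  have nth: "?v $ ((m - 1 - k) * n + j) =
    (if k = i then b $ j else if k = i - 1 then c $ j
     else if i < k then a $ ((m - 1 - k) * n + j) else d $ ((i - 2 - k) * n + j))"
    if j: "j < n" for j
  proof -
    have dims: "dim_vec ?v = m * n"
      using middle_dim[of i m n] assms by simp
    have lt: "(m - 1 - k) * n + j < m * n" by (rule block_index_less[OF assms(7) j])
    consider "k = i" | "k = i - 1" | "i < k" | "k < i - 1" using assms by linarith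
    then show ?thesis
    proof cases
      case 1
      then show ?thesis using assms j by (simp add: diff_commute)
    next
      case 2
      then have "m - 1 - k = (m - i - 1) + 1" using assms by simp
      then have "(m - 1 - k) * n + j = (m - i - 1) * n + (n + j)" by (simp only: add_mult_distrib)
      moreover have "i - 1 \<noteq> i" using assms by simp
      ultimately show ?thesis using assms j lt dims 2 by simp
    next
      case 3
      then have "Suc (m - 1 - k) \<le> m - i - 1" using assms by simp
      then have "Suc (m - 1 - k) * n \<le> (m - i - 1) * n" by (rule mult_le_mono1)
      then have "(m - 1 - k) * n + j < (m - i - 1) * n" using j by simp
      moreover have "k \<noteq> i" "k \<noteq> i - 1" using 3 by simp_all
      ultimately show ?thesis using assms j lt dims 3 by simp
    next
      case 4
      then have "m - 1 - k = (m - i - 1) + 2 + (i - 2 - k)" using assms by simp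
      then have "(m - 1 - k) * n + j = (m - i - 1) * n + (2 * n + ((i - 2 - k) * n + j))"
        by (simp only: add_mult_distrib add.assoc)
      moreover have "k \<noteq> i" "k \<noteq> i - 1" "\<not> i < k" using 4 by simp_all
      ultimately show ?thesis using assms j lt dims 4 by simp
    qed
  qed
  show ?thesis (is "_ = ?r")
  proof (rule eq_vecI)
    show dim: "dim_vec (blk m n k ?v) = dim_vec ?r" using assms(2,3) by simp
    fix j assume "j < dim_vec ?r"
    then have j: "j < n" using dim by simp
    then have "blk m n k ?v $ j = ?v $ ((m - 1 - k) * n + j)" by (simp add: blk_def)
    then show "blk m n k ?v $ j = ?r $ j" unfolding nth[OF j] using j by simp
  qed
qed

lemma blk_elem_mid:
  assumes i: "0 < i" "i < m" and X: "X \<in> carrier_mat n n" and v: "v \<in> carrier_vec (m * n)"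
    and k: "k < m"
  shows "blk m n k (elem_mat m n (Pos i) X *\<^sub>v v) =
      (if k = i then X *\<^sub>v blk m n i v + blk m n (i - 1) v
       else if k = i - 1 then blk m n i v else blk m n k v)"
    and "blk m n k (elem_mat m n (Neg i) X *\<^sub>v v) =
      (if k = i then blk m n (i - 1) v
       else if k = i - 1 then blk m n i v + X *\<^sub>v blk m n (i - 1) v else blk m n k v)"
proof -
  have "v \<in> carrier_vec ((m - i - 1) * n + ((n + n) + (i - 1) * n))"
    using v middle_dim[OF i] by simp
  then obtain a u where a: "a \<in> carrier_vec ((m - i - 1) * n)"
    and u: "u \<in> carrier_vec ((n + n) + (i - 1) * n)" and v1: "v = a @\<^sub>v u"
    by (rule obtain_append)
  from u obtain w d where w: "w \<in> carrier_vec (n + n)" and d: "d \<in> carrier_vec ((i - 1) * n)"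
    and v2: "u = w @\<^sub>v d" by (rule obtain_append)
  from w obtain b c where b: "b \<in> carrier_vec n" and c: "c \<in> carrier_vec n"
    and v3: "w = b @\<^sub>v c" by (rule obtain_append)
  have veq: "v = a @\<^sub>v ((b @\<^sub>v c) @\<^sub>v d)" unfolding v1 v2 v3 ..
  have bc: "b @\<^sub>v c \<in> carrier_vec (n + n)" using b c by simp
  have M: "four_block_mat X (1\<^sub>m n) (1\<^sub>m n) (0\<^sub>m n n) \<in> carrier_mat (n + n) (n + n)"
    "four_block_mat (0\<^sub>m n n) (1\<^sub>m n) (1\<^sub>m n) X \<in> carrier_mat (n + n) (n + n)"
    using X by auto
  have P: "elem_mat m n (Pos i) X *\<^sub>v v = a @\<^sub>v (((X *\<^sub>v b + c) @\<^sub>v b) @\<^sub>v d)"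
    using i diag3_mult_vec[OF M(1) a bc d] mult_mat_vec_pair(1)[OF X b c] veq by simp
  have N: "elem_mat m n (Neg i) X *\<^sub>v v = a @\<^sub>v ((c @\<^sub>v (b + X *\<^sub>v c)) @\<^sub>v d)"
    using i diag3_mult_vec[OF M(2) a bc d] mult_mat_vec_pair(2)[OF X b c] veq by simp
  have Xb: "X *\<^sub>v b + c \<in> carrier_vec n" and Xc: "b + X *\<^sub>v c \<in> carrier_vec n" using X b c by auto
  have bi: "blk m n i v = b" "blk m n (i - 1) v = c"
    unfolding veq using i blk_append4[OF a b c d i] by auto
  show "blk m n k (elem_mat m n (Pos i) X *\<^sub>v v) =
      (if k = i then X *\<^sub>v blk m n i v + blk m n (i - 1) v
       else if k = i - 1 then blk m n i v else blk m n k v)"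
    unfolding P bi blk_append4[OF a Xb b d i k] unfolding veq blk_append4[OF a b c d i k] by simp
  show "blk m n k (elem_mat m n (Neg i) X *\<^sub>v v) =
      (if k = i then blk m n (i - 1) v
       else if k = i - 1 then blk m n i v + X *\<^sub>v blk m n (i - 1) v else blk m n k v)"
    unfolding N bi blk_append4[OF a c Xc d i k] unfolding veq blk_append4[OF a b c d i k] by simp
qed

lemma blk_elem_Pos0:
  assumes m: "0 < m" and X: "X \<in> carrier_mat n n" and v: "v \<in> carrier_vec (m * n)" and k: "k < m"
  shows "blk m n k (elem_mat m n (Pos 0) X *\<^sub>v v) =
      (if k = 0 then X *\<^sub>v blk m n 0 v else blk m n k v)"
proof -
  have dim: "(m - 1) * n + n = m * n" using corner_dim[OF m, of n] by (simp add: add.commute)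
  with v have "v \<in> carrier_vec ((m - 1) * n + n)" by simp
  then obtain a b where a: "a \<in> carrier_vec ((m - 1) * n)" and b: "b \<in> carrier_vec n"
    and veq: "v = a @\<^sub>v b" by (rule obtain_append)
  have P: "elem_mat m n (Pos 0) X *\<^sub>v v = a @\<^sub>v (X *\<^sub>v b)"
    using diag2_mult_vec[OF one_carrier_mat X a b] a veq by simp
  have blk: "blk m n k (a @\<^sub>v c) =
      (if k = 0 then c else vec n (\<lambda>j. a $ ((m - 1 - k) * n + j)))" if c: "c \<in> carrier_vec n" for c
  proof -
    have "(m - 1 - k) * n + j < (m - 1) * n" if "k \<noteq> 0" "j < n" for j
    proof -
      have "Suc (m - 1 - k) * n \<le> (m - 1) * n" using that k by (intro mult_le_mono1) simp
      then show ?thesis using that by simp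
    qed
    then show ?thesis using a c dim block_index_less[OF k, of _ n] unfolding blk_def
      by (intro eq_vecI) auto
  qed
  have Xb: "X *\<^sub>v b \<in> carrier_vec n" using X b by simp
  have b0: "blk m n 0 v = b" using a b dim unfolding veq blk_def by (intro eq_vecI) auto
  show ?thesis unfolding P b0 blk[OF Xb] unfolding veq blk[OF b] by simp
qed

lemma blk_elem_Negm:
  assumes m: "0 < m" and X: "X \<in> carrier_mat n n" and v: "v \<in> carrier_vec (m * n)" and k: "k < m"
  shows "blk m n k (elem_mat m n (Neg m) X *\<^sub>v v) =
      (if k = m - 1 then X *\<^sub>v blk m n (m - 1) v else blk m n k v)"
proof -
  have "v \<in> carrier_vec (n + (m - 1) * n)" using v corner_dim[OF m] by simp
  then obtain a b where a: "a \<in> carrier_vec n" and b: "b \<in> carrier_vec ((m - 1) * n)"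
    and veq: "v = a @\<^sub>v b" by (rule obtain_append)
  have P: "elem_mat m n (Neg m) X *\<^sub>v v = (X *\<^sub>v a) @\<^sub>v b"
    using diag2_mult_vec[OF X one_carrier_mat a b] b veq by simp
  have blk: "blk m n k (c @\<^sub>v b) =
      (if k = m - 1 then c else vec n (\<lambda>j. b $ ((m - 2 - k) * n + j)))"
    if c: "c \<in> carrier_vec n" for c
  proof -
    have "(m - 1 - k) * n + j = n + ((m - 2 - k) * n + j)" if "k \<noteq> m - 1" for j
    proof -
      have "m - 1 - k = Suc (m - 2 - k)" using that k by simp
      then show ?thesis by simp
    qed
    then show ?thesis using b c corner_dim[OF m, of n] block_index_less[OF k, of _ n] unfolding blk_def
      by (intro eq_vecI) auto
  qed
  have Xa: "X *\<^sub>v a \<in> carrier_vec n" using X a by simp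
  have b0: "blk m n (m - 1) v = a" using a b unfolding veq blk_def by (intro eq_vecI) auto
  show ?thesis unfolding P b0 blk[OF Xa] unfolding veq blk[OF a] by simp
qed

text \<open>From here on the action on blocks replaces the definition of the elementary matrices.\<close>

declare elem_mat.simps [simp del]

section \<open>Products of elementary matrices\<close>

definition assignment_ok :: "nat \<Rightarrow> nat \<Rightarrow> sindex list \<Rightarrow> complex mat list \<Rightarrow> bool" where
  "assignment_ok m n ts Xs \<longleftrightarrow> list_all2 (\<lambda>t X. index_ok m t \<and> X \<in> carrier_mat n n) ts Xs"

lemma assignment_ok_simps [simp]:
  "assignment_ok m n [] Xs \<longleftrightarrow> Xs = []"
  "assignment_ok m n ts [] \<longleftrightarrow> ts = []"
  "assignment_ok m n (t # ts) (X # Xs) \<longleftrightarrow>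
     index_ok m t \<and> X \<in> carrier_mat n n \<and> assignment_ok m n ts Xs"
  by (auto simp: assignment_ok_def)

lemma assignment_ok_ConsE:
  assumes "assignment_ok m n (t # ts) Xs"
  obtains Y Ys where "Xs = Y # Ys" "index_ok m t" "Y \<in> carrier_mat n n" "assignment_ok m n ts Ys"
  using assms by (cases Xs) auto

lemma assignment_ok_append:
  assumes "assignment_ok m n ss Xs" "assignment_ok m n ts Ys"
  shows "assignment_ok m n (ss @ ts) (Xs @ Ys)"
  using assms by (simp add: assignment_ok_def list_all2_appendI)

lemma assignment_ok_iff:
  "assignment_ok m n ts Xs \<longleftrightarrow>
     length Xs = length ts \<and> (\<forall>t \<in> set ts. index_ok m t) \<and> set Xs \<subseteq> carrier_mat n n"
proof (induction ts arbitrary: Xs)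
  case (Cons t ts)
  then show ?case by (cases Xs) auto
qed auto

lemma elem_prod_Nil [simp]: "elem_prod m n [] Xs = 1\<^sub>m (m * n)"
  by (simp add: elem_prod_def)

lemma elem_prod_Cons [simp]:
  "elem_prod m n (t # ts) (X # Xs) = elem_mat m n t X * elem_prod m n ts Xs"
  by (simp add: elem_prod_def)

lemma elem_prod_carrier:
  "assignment_ok m n ts Xs \<Longrightarrow> elem_prod m n ts Xs \<in> carrier_mat (m * n) (m * n)"
proof (induction ts arbitrary: Xs)
  case (Cons t ts)
  then show ?case by (auto elim!: assignment_ok_ConsE intro!: mult_carrier_mat elem_mat_carrier)
qed simp

lemma elem_prod_append:
  assumes "assignment_ok m n ss Xs" "assignment_ok m n ts Ys"
  shows "elem_prod m n (ss @ ts) (Xs @ Ys) = elem_prod m n ss Xs * elem_prod m n ts Ys"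
  using assms(1)
proof (induction ss arbitrary: Xs)
  case Nil
  then show ?case using elem_prod_carrier[OF assms(2)] by simp
next
  case (Cons s ss)
  then obtain Z Zs where Z: "Xs = Z # Zs" "index_ok m s" "Z \<in> carrier_mat n n"
    "assignment_ok m n ss Zs" by (auto elim: assignment_ok_ConsE)
  then show ?case
    using Cons.IH[OF Z(4)] elem_prod_carrier[OF Z(4)] elem_prod_carrier[OF assms(2)]
      elem_mat_carrier[OF Z(2,3)] by (simp add: assoc_mult_mat[of _ "m * n" "m * n" _ "m * n" _ "m * n"])
qed

lemma elem_prod_Cons_vec:
  assumes "index_ok m t" "X \<in> carrier_mat n n" "assignment_ok m n ts Xs" "v \<in> carrier_vec (m * n)"
  shows "elem_prod m n (t # ts) (X # Xs) *\<^sub>v v = elem_mat m n t X *\<^sub>v (elem_prod m n ts Xs *\<^sub>v v)"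
  using assoc_mult_mat_vec[OF elem_mat_carrier[OF assms(1,2)] elem_prod_carrier[OF assms(3)] assms(4)]
  by simp

lemma elem_prod_append_vec:
  assumes "assignment_ok m n ss Xs" "assignment_ok m n ts Ys" "v \<in> carrier_vec (m * n)"
  shows "elem_prod m n (ss @ ts) (Xs @ Ys) *\<^sub>v v =
    elem_prod m n ss Xs *\<^sub>v (elem_prod m n ts Ys *\<^sub>v v)"
  unfolding elem_prod_append[OF assms(1,2)]
  by (rule assoc_mult_mat_vec[OF elem_prod_carrier[OF assms(1)] elem_prod_carrier[OF assms(2)] assms(3)])

lemma elem_mat_vec_carrier:
  "index_ok m t \<Longrightarrow> X \<in> carrier_mat n n \<Longrightarrow> v \<in> carrier_vec (m * n) \<Longrightarrow>
    elem_mat m n t X *\<^sub>v v \<in> carrier_vec (m * n)"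
  using elem_mat_carrier mult_mat_vec_carrier by blast

lemma elem_prod_vec_carrier:
  "assignment_ok m n ts Xs \<Longrightarrow> v \<in> carrier_vec (m * n) \<Longrightarrow>
    elem_prod m n ts Xs *\<^sub>v v \<in> carrier_vec (m * n)"
  using elem_prod_carrier mult_mat_vec_carrier by blast

lemma mult_mat_zero_vec [simp]:
  fixes X :: "complex mat"
  shows "X \<in> carrier_mat a b \<Longrightarrow> X *\<^sub>v 0\<^sub>v b = 0\<^sub>v a"
  by (intro eq_vecI) auto

lemma blk_elem_Pos:
  assumes "i < m" "X \<in> carrier_mat n n" "v \<in> carrier_vec (m * n)" "k < m"
  shows "blk m n k (elem_mat m n (Pos i) X *\<^sub>v v) =
      (if k = i then if i = 0 then X *\<^sub>v blk m n 0 v else X *\<^sub>v blk m n i v + blk m n (i - 1) v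
       else if Suc k = i then blk m n i v else blk m n k v)"
proof (cases "i = 0")
  case True
  then show ?thesis using blk_elem_Pos0[of m X n v k] assms by simp
next
  case False
  then have "k = i - 1 \<longleftrightarrow> Suc k = i" by auto
  then show ?thesis using blk_elem_mid(1)[of i m X n v k] assms False by simp
qed

lemma blk_elem_Neg:
  assumes "0 < i" "i \<le> m" "X \<in> carrier_mat n n" "v \<in> carrier_vec (m * n)" "k < m"
  shows "blk m n k (elem_mat m n (Neg i) X *\<^sub>v v) =
      (if Suc k = i then if i = m then X *\<^sub>v blk m n (m - 1) v
                    else blk m n i v + X *\<^sub>v blk m n (i - 1) v
       else if k = i then blk m n (i - 1) v else blk m n k v)"
proof (cases "i = m")
  case True
  have "k = m - 1 \<longleftrightarrow> Suc k = i" using True assms(5) by auto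
  then show ?thesis using blk_elem_Negm[of m X n v k] assms True by auto
next
  case False
  have "k = i - 1 \<longleftrightarrow> Suc k = i" using assms(1) by auto
  then show ?thesis using blk_elem_mid(2)[of i m X n v k] assms False by auto
qed

text \<open>The identity \<open>M_{-i}(X) = M_i(-X)^{-1}\<close>, in the form in which it is used on vectors.\<close>
lemma elem_mat_cancel_mid:
  assumes "0 < i" "i < m" "X \<in> carrier_mat n n" "v \<in> carrier_vec (m * n)"
  shows "elem_mat m n (Pos i) (- X) *\<^sub>v (elem_mat m n (Neg i) X *\<^sub>v v) = v"
    and "elem_mat m n (Neg i) X *\<^sub>v (elem_mat m n (Pos i) (- X) *\<^sub>v v) = v"
proof -
  have ok: "index_ok m (Pos i)" "index_ok m (Neg i)" using assms by (auto simp: index_ok_def)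
  have nX: "- X \<in> carrier_mat n n" using assms by simp
  note c = elem_mat_vec_carrier[OF ok(1) nX] elem_mat_vec_carrier[OF ok(2) assms(3)]
  have cancel: "- X *\<^sub>v u + (w + X *\<^sub>v u) = w" "w + X *\<^sub>v u + - X *\<^sub>v u = w"
    "- X *\<^sub>v u + w + X *\<^sub>v u = w"
    if "u \<in> carrier_vec n" "w \<in> carrier_vec n" for u w
    using that assms(3) by (auto intro!: eq_vecI simp: uminus_scalar_prod)
  show "elem_mat m n (Pos i) (- X) *\<^sub>v (elem_mat m n (Neg i) X *\<^sub>v v) = v" (is "?l = v")
  proof (rule vec_eq_blkI)
    fix k assume k: "k < m"
    note P = blk_elem_Pos[OF assms(2) nX c(2)[OF assms(4)]]
    note N = blk_elem_Neg[OF assms(1) less_imp_le[OF assms(2)] assms(3,4)]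
    consider "k = i" | "Suc k = i" | "k \<noteq> i" "Suc k \<noteq> i" by blast
    then show "blk m n k ?l = blk m n k v"
    proof cases
      case 1
      then show ?thesis using assms(1,2) k by (simp add: P N cancel)
    next
      case 2
      then have "k = i - 1" "i - 1 \<noteq> i" by simp_all
      then show ?thesis using assms(1,2) k by (simp add: P N)
    qed (use assms(1,2) k in \<open>simp add: P N\<close>)
  qed (use c assms in simp_all)
  show "elem_mat m n (Neg i) X *\<^sub>v (elem_mat m n (Pos i) (- X) *\<^sub>v v) = v" (is "?l = v")
  proof (rule vec_eq_blkI)
    fix k assume k: "k < m"
    note N = blk_elem_Neg[OF assms(1) less_imp_le[OF assms(2)] assms(3) c(1)[OF assms(4)]]
    note P = blk_elem_Pos[OF assms(2) nX assms(4)]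
    consider "k = i" | "Suc k = i" | "k \<noteq> i" "Suc k \<noteq> i" by blast
    then show "blk m n k ?l = blk m n k v"
    proof cases
      case 1
      moreover have "i - 1 \<noteq> i" using assms(1) by simp
      ultimately show ?thesis using assms(1,2) k by (simp add: P N)
    next
      case 2
      then have "k = i - 1" "i - 1 \<noteq> i" by simp_all
      then show ?thesis using assms(1,2) k by (simp add: P N cancel)
    qed (use assms(1,2) k in \<open>simp add: P N\<close>)
  qed (use c assms in simp_all)
qed

lemma elem_mat_bij:
  assumes ok: "index_ok m t" and X: "X \<in> carrier_mat n n"
    and inv: "t \<in> {Pos 0, Neg m} \<Longrightarrow> invertible_mat X"
  shows "bij_betw (\<lambda>v. elem_mat m n t X *\<^sub>v v) (carrier_vec (m * n)) (carrier_vec (m * n))"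
proof -
  have "\<exists>s Y. index_ok m s \<and> Y \<in> carrier_mat n n \<and> (\<forall>v \<in> carrier_vec (m * n).
      elem_mat m n s Y *\<^sub>v (elem_mat m n t X *\<^sub>v v) = v \<and>
      elem_mat m n t X *\<^sub>v (elem_mat m n s Y *\<^sub>v v) = v)"
  proof (cases "t \<in> {Pos 0, Neg m}")
    case True
    then have m: "0 < m" using ok by (auto simp: index_ok_def)
    obtain Y where "inverts_mat X Y" "inverts_mat Y X"
      using inv[OF True] unfolding invertible_mat_def by blast
    then have XY: "X * Y = 1\<^sub>m n" and YX: "Y * X = 1\<^sub>m (dim_row Y)"
      using X unfolding inverts_mat_def by auto
    have "dim_col Y = n" using arg_cong[OF XY, of dim_col] by simp
    moreover have "dim_row Y = n" using arg_cong[OF YX, of dim_col] X by simp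
    ultimately have Y: "Y \<in> carrier_mat n n" by (intro carrier_matI)
    have c: "X *\<^sub>v (Y *\<^sub>v u) = u" "Y *\<^sub>v (X *\<^sub>v u) = u" if "u \<in> carrier_vec n" for u
      using assoc_mult_mat_vec[OF X Y that] assoc_mult_mat_vec[OF Y X that] XY YX Y that by auto
    have "elem_mat m n t A *\<^sub>v (elem_mat m n t B *\<^sub>v v) = v"
      if A: "A \<in> carrier_mat n n" and B: "B \<in> carrier_mat n n"
        and AB: "\<And>u. u \<in> carrier_vec n \<Longrightarrow> A *\<^sub>v (B *\<^sub>v u) = u"
        and v: "v \<in> carrier_vec (m * n)" for A B v
    proof (rule vec_eq_blkI)
      show Bv: "elem_mat m n t A *\<^sub>v (elem_mat m n t B *\<^sub>v v) \<in> carrier_vec (m * n)"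
        using elem_mat_vec_carrier[OF ok] A B v by blast
      have Bv: "elem_mat m n t B *\<^sub>v v \<in> carrier_vec (m * n)"
        using elem_mat_vec_carrier[OF ok] B v by blast
      fix k assume k: "k < m"
      from True consider "t = Pos 0" | "t = Neg m" by blast
      then show "blk m n k (elem_mat m n t A *\<^sub>v (elem_mat m n t B *\<^sub>v v)) = blk m n k v"
      proof cases
        case 1
        then show ?thesis
          using blk_elem_Pos0[OF m A Bv k] blk_elem_Pos0[OF m B v k] blk_elem_Pos0[OF m B v m] AB
          by simp
      next
        case 2
        have "m - 1 < m" using m by simp
        with 2 show ?thesis
          using blk_elem_Negm[OF m A Bv k] blk_elem_Negm[OF m B v k] blk_elem_Negm[OF m B v, of "m - 1"] AB
          by simp
      qed
    qed (rule v)
    then show ?thesis using ok X Y c by blast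
  next
    case False
    then obtain i where i: "0 < i" "i < m" "t = Pos i \<or> t = Neg i"
      using ok by (cases t) (auto simp: index_ok_def)
    have oks: "index_ok m (Pos i)" "index_ok m (Neg i)" using i by (auto simp: index_ok_def)
    have nX: "- X \<in> carrier_mat n n" and nn: "- (- X) = X" using X by auto
    from i(3) show ?thesis
    proof
      assume "t = Pos i"
      then show ?thesis using elem_mat_cancel_mid[OF i(1,2) nX] oks nX unfolding nn by blast
    next
      assume "t = Neg i"
      then show ?thesis using elem_mat_cancel_mid[OF i(1,2) X] oks nX by blast
    qed
  qed
  then obtain s Y where Y: "index_ok m s" "Y \<in> carrier_mat n n" "\<And>v. v \<in> carrier_vec (m * n) \<Longrightarrow>
      elem_mat m n s Y *\<^sub>v (elem_mat m n t X *\<^sub>v v) = v \<and>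
      elem_mat m n t X *\<^sub>v (elem_mat m n s Y *\<^sub>v v) = v" by blast
  show ?thesis
    by (rule bij_betw_byWitness[where f' = "\<lambda>v. elem_mat m n s Y *\<^sub>v v"])
      (use Y elem_mat_vec_carrier[OF ok X] elem_mat_vec_carrier[OF Y(1,2)] in auto)
qed

lemma elem_prod_bij:
  assumes "assignment_ok m n ts Xs" and "nonsingular_assignment m n ts Xs"
  shows "bij_betw (\<lambda>v. elem_prod m n ts Xs *\<^sub>v v) (carrier_vec (m * n)) (carrier_vec (m * n))"
  using assms
proof (induction ts arbitrary: Xs)
  case Nil
  have "bij_betw (\<lambda>v. v) (carrier_vec (m * n)) (carrier_vec (m * n) :: complex vec set)"
    by (simp add: bij_betw_def)
  then show ?case by (rule bij_betw_cong[THEN iffD2, rotated]) simp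
next
  case (Cons t ts)
  obtain Y Ys where Y: "Xs = Y # Ys" "index_ok m t" "Y \<in> carrier_mat n n" "assignment_ok m n ts Ys"
    using Cons.prems(1) by (rule assignment_ok_ConsE)
  have ns: "nonsingular_assignment m n ts Ys" and inv: "t \<in> {Pos 0, Neg m} \<Longrightarrow> invertible_mat Y"
    using Cons.prems(2) Y(1) unfolding nonsingular_assignment_def
    by (auto simp: nth_Cons split: nat.splits)
  have "bij_betw ((\<lambda>v. elem_mat m n t Y *\<^sub>v v) \<circ> (\<lambda>v. elem_prod m n ts Ys *\<^sub>v v))
      (carrier_vec (m * n)) (carrier_vec (m * n))"
    by (rule bij_betw_trans[OF Cons.IH[OF Y(4) ns] elem_mat_bij[OF Y(2,3) inv]])
  then show ?case unfolding Y(1)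
    by (rule bij_betw_cong[THEN iffD2, rotated]) (use elem_prod_Cons_vec[OF Y(2-4)] in simp)
qed

text \<open>Going through the factors from left to right, the factor with index \<open>j\<close> takes its block \<open>j - 1\<close>
  from block \<open>j\<close> of its argument; so if the selected block is \<open>j - 1\<close>, the selection moves to
  \<open>j\<close>, exactly as \<open>climb\<close> does.  The only other factor that changes the selected block is the one
  whose index is the number of that block; the SIP excludes it.\<close>
lemma blk_elem_prod_climb:
  assumes "assignment_ok m n (map Pos \<rho>) Xs" "SIP (\<gamma> @ \<rho>)" "0 < climb \<gamma>"
    and "set \<gamma> \<subseteq> {..<m}" "v \<in> carrier_vec (m * n)"
  shows "blk m n (climb \<gamma> - 1) (elem_prod m n (map Pos \<rho>) Xs *\<^sub>v v) =
    blk m n (climb (\<gamma> @ \<rho>) - 1) v"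
  using assms
proof (induction \<rho> arbitrary: \<gamma> Xs)
  case Nil
  then show ?case by simp
next
  case (Cons j \<rho>)
  obtain Y Ys where Y: "Xs = Y # Ys" "index_ok m (Pos j)" "Y \<in> carrier_mat n n"
    "assignment_ok m n (map Pos \<rho>) Ys"
    using Cons.prems(1) by (auto elim: assignment_ok_ConsE)
  let ?w = "elem_prod m n (map Pos \<rho>) Ys *\<^sub>v v"
  have w: "?w \<in> carrier_vec (m * n)" by (rule elem_prod_vec_carrier[OF Y(4) Cons.prems(5)])
  obtain k where k: "climb \<gamma> = Suc k" using Cons.prems(3) by (cases "climb \<gamma>") auto
  have km: "k < m" using climb_last_mem[OF Cons.prems(3)] k Cons.prems(4) by auto
  have jm: "j < m" using Y(2) by (simp add: index_ok_def)
  have "SIP (\<gamma> @ [j])" using SIP_infix[of "[]" "\<gamma> @ [j]" \<rho>] Cons.prems(2) by simp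
  from SIP_snoc_imp_climb_neq[OF this] have jk: "j \<noteq> k" using k by auto
  have "blk m n k (elem_mat m n (Pos j) Y *\<^sub>v ?w) = blk m n (climb (\<gamma> @ [j]) - 1) ?w"
    using blk_elem_Pos[OF jm Y(3) w km] jk k by auto
  also have "\<dots> = blk m n (climb ((\<gamma> @ [j]) @ \<rho>) - 1) v"
    by (rule Cons.IH[OF Y(4)]) (use Cons.prems k jm in auto)
  finally show ?case
    unfolding Y(1) list.map elem_prod_Cons_vec[OF Y(2-4) Cons.prems(5)] k by simp
qed

lemma blk_elem_prod_Neg:
  assumes "assignment_ok m n (map Neg \<rho>) Xs" "k \<notin> set \<rho>" "Suc k \<notin> set \<rho>" "k < m"
    and "v \<in> carrier_vec (m * n)"
  shows "blk m n k (elem_prod m n (map Neg \<rho>) Xs *\<^sub>v v) = blk m n k v"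
  using assms
proof (induction \<rho> arbitrary: Xs)
  case (Cons j \<rho>)
  obtain Y Ys where Y: "Xs = Y # Ys" "index_ok m (Neg j)" "Y \<in> carrier_mat n n"
    "assignment_ok m n (map Neg \<rho>) Ys"
    using Cons.prems(1) by (auto elim: assignment_ok_ConsE)
  have j: "0 < j" "j \<le> m" using Y(2) by (auto simp: index_ok_def)
  show ?case
    unfolding Y(1) list.map elem_prod_Cons_vec[OF Y(2-4) Cons.prems(5)]
    using blk_elem_Neg[OF j Y(3) elem_prod_vec_carrier[OF Y(4) Cons.prems(5)] Cons.prems(4)]
      Cons.IH[OF Y(4)] Cons.prems by auto
qed simp

text \<open>The dual of \<open>blk_elem_prod_climb\<close>: the factor with index \<open>j\<close> moves a vector that is concentrated
  in block \<open>j - 1\<close> to block \<open>j\<close>.\<close>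
lemma elem_prod_place_climb:
  assumes "assignment_ok m n (map Pos \<rho>) Xs" "SIP (\<rho> @ \<gamma>)" "0 < climb (rev \<gamma>)"
    and "set (\<rho> @ \<gamma>) \<subseteq> {..<m}" "c \<in> carrier_vec n"
  shows "elem_prod m n (map Pos \<rho>) Xs *\<^sub>v place m n (climb (rev \<gamma>) - 1) c =
    place m n (climb (rev (\<rho> @ \<gamma>)) - 1) c"
  using assms
proof (induction \<rho> arbitrary: Xs)
  case Nil
  then show ?case by simp
next
  case (Cons j \<rho>)
  obtain Y Ys where Y: "Xs = Y # Ys" "index_ok m (Pos j)" "Y \<in> carrier_mat n n"
    "assignment_ok m n (map Pos \<rho>) Ys"
    using Cons.prems(1) by (auto elim: assignment_ok_ConsE)
  let ?\<delta> = "rev (\<rho> @ \<gamma>)"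
  have IH: "elem_prod m n (map Pos \<rho>) Ys *\<^sub>v place m n (climb (rev \<gamma>) - 1) c =
      place m n (climb ?\<delta> - 1) c"
    by (rule Cons.IH[OF Y(4)])
      (use Cons.prems SIP_infix[of "[j]" "\<rho> @ \<gamma>" "[]"] in auto)
  have "0 \<in> set ?\<delta>" using Cons.prems(3) by (auto simp: mem_0_iff_climb_pos[symmetric])
  then have pos: "0 < climb ?\<delta>" using mem_0_iff_climb_pos by blast
  then obtain k where k: "climb ?\<delta> = Suc k" by (cases "climb ?\<delta>") auto
  have "k \<in> set ?\<delta>" using climb_last_mem[OF pos] k by simp
  then have km: "k < m" using Cons.prems(4) by auto
  have jm: "j < m" using Y(2) by (simp add: index_ok_def)
  have "SIP (?\<delta> @ [j])" using SIP_rev[OF Cons.prems(2)] by simp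
  from SIP_snoc_imp_climb_neq[OF this] have jk: "j \<noteq> k" using k by auto
  have "elem_mat m n (Pos j) Y *\<^sub>v place m n k c = place m n (climb (?\<delta> @ [j]) - 1) c"
  proof (rule vec_eq_blkI)
    fix l assume l: "l < m"
    show "blk m n l (elem_mat m n (Pos j) Y *\<^sub>v place m n k c) =
        blk m n l (place m n (climb (?\<delta> @ [j]) - 1) c)"
      unfolding climb_snoc k
      using blk_elem_Pos[OF jm Y(3) place_carrier l] jk jm km l Cons.prems(5) Y(3)
      by (auto simp: blk_place)
  qed (use elem_mat_vec_carrier[OF Y(2,3)] in simp_all)
  then show ?case
    unfolding Y(1) list.map elem_prod_Cons_vec[OF Y(2-4) place_carrier] IH k by simp
qed

lemma elem_prod_Neg_place:
  assumes "assignment_ok m n (map Neg \<rho>) Xs" "k \<notin> set \<rho>" "Suc k \<notin> set \<rho>" "k < m"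
    and "c \<in> carrier_vec n"
  shows "elem_prod m n (map Neg \<rho>) Xs *\<^sub>v place m n k c = place m n k c"
  using assms
proof (induction \<rho> arbitrary: Xs)
  case (Cons j \<rho>)
  obtain Y Ys where Y: "Xs = Y # Ys" "index_ok m (Neg j)" "Y \<in> carrier_mat n n"
    "assignment_ok m n (map Neg \<rho>) Ys"
    using Cons.prems(1) by (auto elim: assignment_ok_ConsE)
  have j: "0 < j" "j \<le> m" using Y(2) by (auto simp: index_ok_def)
  have "elem_mat m n (Neg j) Y *\<^sub>v place m n k c = place m n k c"
  proof (rule vec_eq_blkI)
    fix l assume l: "l < m"
    show "blk m n l (elem_mat m n (Neg j) Y *\<^sub>v place m n k c) = blk m n l (place m n k c)"
      using blk_elem_Neg[OF j Y(3) place_carrier l] j l Cons.prems Y(3)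
      by (auto simp: blk_place)
  qed (use elem_mat_vec_carrier[OF Y(2,3)] in simp_all)
  then show ?case
    unfolding Y(1) list.map elem_prod_Cons_vec[OF Y(2-4) place_carrier]
    using Cons.IH[OF Y(4)] Cons.prems by simp
qed simp

text \<open>The products \<open>M_t^P\<close> are the case in which the assignment is given by the coefficients.\<close>
lemma coeff_assignment_ok:
  assumes "\<And>t. t \<in> set ts \<Longrightarrow> index_ok m t" "\<And>i. i \<le> m \<Longrightarrow> As i \<in> carrier_mat n n"
  shows "assignment_ok m n ts (map (coeff_assign As) ts)"
proof -
  have "coeff_assign As t \<in> carrier_mat n n" if "t \<in> set ts" for t
    using assms(1)[OF that] assms(2) by (cases t) (auto simp: index_ok_def)
  then show ?thesis using assms(1) by (auto simp: assignment_ok_iff)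
qed

lemma elem_prod_P_append_vec:
  assumes "\<And>t. t \<in> set ss \<union> set ts \<Longrightarrow> index_ok m t" "\<And>i. i \<le> m \<Longrightarrow> As i \<in> carrier_mat n n"
    and "v \<in> carrier_vec (m * n)"
  shows "elem_prod_P m n As (ss @ ts) *\<^sub>v v = elem_prod_P m n As ss *\<^sub>v (elem_prod_P m n As ts *\<^sub>v v)"
  unfolding elem_prod_P_def map_append
  by (rule elem_prod_append_vec) (use assms in \<open>auto intro: coeff_assignment_ok\<close>)

lemma elem_prod_P_Cons_vec:
  assumes "\<And>t. t \<in> insert s (set ts) \<Longrightarrow> index_ok m t" "\<And>i. i \<le> m \<Longrightarrow> As i \<in> carrier_mat n n"
    and "v \<in> carrier_vec (m * n)"
  shows "elem_prod_P m n As (s # ts) *\<^sub>v v =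
    elem_mat m n s (coeff_assign As s) *\<^sub>v (elem_prod_P m n As ts *\<^sub>v v)"
proof -
  have "assignment_ok m n (s # ts) (map (coeff_assign As) (s # ts))"
    by (rule coeff_assignment_ok) (use assms in auto)
  then show ?thesis
    unfolding elem_prod_P_def list.map by (intro elem_prod_Cons_vec) (use assms(3) in auto)
qed

lemma elem_prod_P_Nil_vec: "v \<in> carrier_vec (m * n) \<Longrightarrow> elem_prod_P m n As [] *\<^sub>v v = v"
  by (simp add: elem_prod_P_def)

lemma elem_prod_P_carrier:
  assumes "\<And>t. t \<in> set ts \<Longrightarrow> index_ok m t" "\<And>i. i \<le> m \<Longrightarrow> As i \<in> carrier_mat n n"
  shows "elem_prod_P m n As ts \<in> carrier_mat (m * n) (m * n)"
  unfolding elem_prod_P_def by (rule elem_prod_carrier[OF coeff_assignment_ok]) (use assms in auto)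

lemma elem_prod_P_vec_carrier:
  assumes "\<And>t. t \<in> set ts \<Longrightarrow> index_ok m t" "\<And>i. i \<le> m \<Longrightarrow> As i \<in> carrier_mat n n"
    and "v \<in> carrier_vec (m * n)"
  shows "elem_prod_P m n As ts *\<^sub>v v \<in> carrier_vec (m * n)"
  using elem_prod_P_carrier[of ts m As n] assms mult_mat_vec_carrier by blast

lemma elem_prod_P_cancel:
  assumes A: "\<And>i. i \<le> m \<Longrightarrow> As i \<in> carrier_mat n n"
    and "\<And>i. i \<in> set \<rho> \<Longrightarrow> 0 < i \<and> i < m" "v \<in> carrier_vec (m * n)"
  shows "elem_prod_P m n As (map Pos (rev \<rho>)) *\<^sub>v (elem_prod_P m n As (map Neg \<rho>) *\<^sub>v v) = v"
    and "elem_prod_P m n As (map Neg \<rho>) *\<^sub>v (elem_prod_P m n As (map Pos (rev \<rho>)) *\<^sub>v v) = v"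
proof -
  have "elem_prod_P m n As (map Pos (rev \<rho>)) *\<^sub>v (elem_prod_P m n As (map Neg \<rho>) *\<^sub>v v) = v \<and>
    elem_prod_P m n As (map Neg \<rho>) *\<^sub>v (elem_prod_P m n As (map Pos (rev \<rho>)) *\<^sub>v v) = v"
    using assms(2,3)
  proof (induction \<rho> arbitrary: v)
    case Nil
    then show ?case by (simp add: elem_prod_P_Nil_vec)
  next
    case (Cons i \<rho>)
    have i: "0 < i" "i < m" using Cons.prems(1) by auto
    have ok: "\<And>t. t \<in> set (map Pos (rev \<rho>)) \<Longrightarrow> index_ok m t" "\<And>t. t \<in> set (map Neg \<rho>) \<Longrightarrow> index_ok m t"
      "index_ok m (Pos i)" "index_ok m (Neg i)"
      using Cons.prems(1) by (auto simp: index_ok_def less_imp_le)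
    have Ai: "As i \<in> carrier_mat n n" using A i by simp
    have cP: "elem_prod_P m n As (map Pos (rev \<rho>)) *\<^sub>v u \<in> carrier_vec (m * n)"
      and cN: "elem_prod_P m n As (map Neg \<rho>) *\<^sub>v u \<in> carrier_vec (m * n)"
      if "u \<in> carrier_vec (m * n)" for u
      by (rule elem_prod_P_vec_carrier[OF ok(1) A that] elem_prod_P_vec_carrier[OF ok(2) A that];
          assumption)+
    have snoc: "elem_prod_P m n As (map Pos (rev (i # \<rho>))) *\<^sub>v u =
        elem_prod_P m n As (map Pos (rev \<rho>)) *\<^sub>v (elem_mat m n (Pos i) (- As i) *\<^sub>v u)"
      if "u \<in> carrier_vec (m * n)" for u
      using elem_prod_P_append_vec[of "map Pos (rev \<rho>)" "[Pos i]" m As n u]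
        elem_prod_P_Cons_vec[of "Pos i" "[]" m As n u] A ok that elem_prod_P_Nil_vec
      by (auto simp: elem_prod_P_Nil_vec)
    have cons: "elem_prod_P m n As (map Neg (i # \<rho>)) *\<^sub>v u =
        elem_mat m n (Neg i) (As i) *\<^sub>v (elem_prod_P m n As (map Neg \<rho>) *\<^sub>v u)"
      if "u \<in> carrier_vec (m * n)" for u
      using elem_prod_P_Cons_vec[of "Neg i" "map Neg \<rho>" m As n u] A ok that by auto
    have IH: "elem_prod_P m n As (map Pos (rev \<rho>)) *\<^sub>v (elem_prod_P m n As (map Neg \<rho>) *\<^sub>v u) = u"
      "elem_prod_P m n As (map Neg \<rho>) *\<^sub>v (elem_prod_P m n As (map Pos (rev \<rho>)) *\<^sub>v u) = u"
      if "u \<in> carrier_vec (m * n)" for u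
      using Cons.IH[OF _ that] Cons.prems(1) by auto
    have mv: "elem_mat m n (Pos i) (- As i) *\<^sub>v v \<in> carrier_vec (m * n)"
      using elem_mat_vec_carrier[OF ok(3), of "- As i" n v] Cons.prems(2) Ai by simp
    note nv = cN[OF Cons.prems(2)]
    have mnv: "elem_mat m n (Neg i) (As i) *\<^sub>v (elem_prod_P m n As (map Neg \<rho>) *\<^sub>v v) \<in> carrier_vec (m * n)"
      by (rule elem_mat_vec_carrier[OF ok(4) Ai nv])
    have "elem_prod_P m n As (map Pos (rev (i # \<rho>))) *\<^sub>v (elem_prod_P m n As (map Neg (i # \<rho>)) *\<^sub>v v) = v"
      unfolding cons[OF Cons.prems(2)] snoc[OF mnv] elem_mat_cancel_mid(1)[OF i Ai nv]
      by (rule IH(1)[OF Cons.prems(2)])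
    moreover have "elem_prod_P m n As (map Neg (i # \<rho>)) *\<^sub>v
        (elem_prod_P m n As (map Pos (rev (i # \<rho>))) *\<^sub>v v) = v"
      unfolding snoc[OF Cons.prems(2)] cons[OF cP[OF mv]] IH(2)[OF mv]
      by (rule elem_mat_cancel_mid(2)[OF i Ai Cons.prems(2)])
    ultimately show ?case ..
  qed
  then show "elem_prod_P m n As (map Pos (rev \<rho>)) *\<^sub>v (elem_prod_P m n As (map Neg \<rho>) *\<^sub>v v) = v"
    and "elem_prod_P m n As (map Neg \<rho>) *\<^sub>v (elem_prod_P m n As (map Pos (rev \<rho>)) *\<^sub>v v) = v" by auto
qed

section \<open>A Fiedler pencil as a circuit\<close>

text \<open>Position \<open>k\<close> is an inversion of a permutation if \<open>k + 1\<close> stands to the left of \<open>k\<close>.\<close>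
definition inversion_at :: "nat list \<Rightarrow> nat \<Rightarrow> bool" where
  "inversion_at \<pi> k \<longleftrightarrow> Suc k \<in> set (takeWhile (\<lambda>x. x \<noteq> k) \<pi>)"

lemma inversion_at_cases:
  assumes "distinct (\<xi> @ j # \<eta>)"
  shows "Suc j \<in> set \<eta> \<Longrightarrow> \<not> inversion_at (\<xi> @ j # \<eta>) j"
    and "Suc j \<in> set \<xi> \<Longrightarrow> inversion_at (\<xi> @ j # \<eta>) j"
    and "j = Suc i \<Longrightarrow> i \<in> set \<eta> \<Longrightarrow> inversion_at (\<xi> @ j # \<eta>) i"
    and "j = Suc i \<Longrightarrow> i \<in> set \<xi> \<Longrightarrow> \<not> inversion_at (\<xi> @ j # \<eta>) i"
proof -
  have "takeWhile (\<lambda>x. x \<noteq> j) (\<xi> @ j # \<eta>) = \<xi>"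
    using assms by (subst takeWhile_append2) auto
  then show "Suc j \<in> set \<eta> \<Longrightarrow> \<not> inversion_at (\<xi> @ j # \<eta>) j"
    and "Suc j \<in> set \<xi> \<Longrightarrow> inversion_at (\<xi> @ j # \<eta>) j"
    using assms by (auto simp: inversion_at_def)
  show "inversion_at (\<xi> @ j # \<eta>) i" if "j = Suc i" "i \<in> set \<eta>"
  proof -
    have "takeWhile (\<lambda>x. x \<noteq> i) (\<xi> @ j # \<eta>) = \<xi> @ j # takeWhile (\<lambda>x. x \<noteq> i) \<eta>"
      using assms that by (subst takeWhile_append2) auto
    then show ?thesis using that by (simp add: inversion_at_def)
  qed
  show "\<not> inversion_at (\<xi> @ j # \<eta>) i" if "j = Suc i" "i \<in> set \<xi>"
  proof -
    have "takeWhile (\<lambda>x. x \<noteq> i) (\<xi> @ j # \<eta>) = takeWhile (\<lambda>x. x \<noteq> i) \<xi>"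
      using that by (intro takeWhile_append1) auto
    then show ?thesis using that assms set_takeWhileD by (fastforce simp: inversion_at_def)
  qed
qed

text \<open>The gate with index \<open>j\<close>.  It is \<open>M_j(-A_j)\<close>, except that the gate with index \<open>0\<close>, which has no
  lower input of its own, receives the vector \<open>d\<close> there.  In the application \<open>d = -C y\<close>, so that
  the column block \<open>e \<otimes> C\<close> of the pencil becomes part of the circuit.\<close>
fun affine_step :: "nat \<Rightarrow> nat \<Rightarrow> (nat \<Rightarrow> complex mat) \<Rightarrow> complex vec \<Rightarrow> nat \<Rightarrow> complex vec \<Rightarrow> complex vec" where
  "affine_step m n As d j v =
     elem_mat m n (Pos j) (- As j) *\<^sub>v v + (if j = 0 then place m n 0 d else 0\<^sub>v (m * n))"

text \<open>The rightmost entry of the tuple acts first, as in a matrix product.\<close>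
definition affine_run :: "nat \<Rightarrow> nat \<Rightarrow> (nat \<Rightarrow> complex mat) \<Rightarrow> complex vec \<Rightarrow> nat list \<Rightarrow> complex vec \<Rightarrow> complex vec" where
  "affine_run m n As d \<pi> v = foldr (affine_step m n As d) \<pi> v"

lemma affine_run_simps [simp]:
  "affine_run m n As d [] v = v"
  "affine_run m n As d (j # \<pi>) v = affine_step m n As d j (affine_run m n As d \<pi> v)"
  "affine_run m n As d (\<pi> @ \<pi>') v = affine_run m n As d \<pi> (affine_run m n As d \<pi>' v)"
  by (simp_all add: affine_run_def)

declare affine_step.simps [simp del]

context
  fixes m n :: nat and As :: "nat \<Rightarrow> complex mat"
  assumes m_pos: "0 < m" and As: "\<And>i. i \<le> m \<Longrightarrow> As i \<in> carrier_mat n n"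
begin

lemma affine_step_carrier:
  "j < m \<Longrightarrow> v \<in> carrier_vec (m * n) \<Longrightarrow> affine_step m n As d j v \<in> carrier_vec (m * n)"
  using elem_mat_vec_carrier[of m "Pos j" "- As j" n v] As[of j]
  by (auto simp: affine_step.simps index_ok_def)

lemma affine_run_carrier:
  "set \<pi> \<subseteq> {..<m} \<Longrightarrow> v \<in> carrier_vec (m * n) \<Longrightarrow> affine_run m n As d \<pi> v \<in> carrier_vec (m * n)"
  by (induction \<pi>) (auto intro: affine_step_carrier)

lemma blk_affine_step:
  assumes "j < m" "d \<in> carrier_vec n" "v \<in> carrier_vec (m * n)" "k < m"
  shows "blk m n k (affine_step m n As d j v) =
    (if k = j then (if j = 0 then d else blk m n (j - 1) v) - As j *\<^sub>v blk m n j v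
     else if Suc k = j then blk m n j v else blk m n k v)"
proof -
  have A: "As j \<in> carrier_mat n n" "- As j \<in> carrier_mat n n" using As assms(1) by auto
  have M: "elem_mat m n (Pos j) (- As j) *\<^sub>v v \<in> carrier_vec (m * n)"
    by (rule elem_mat_vec_carrier[OF _ A(2) assms(3)]) (use assms(1) in \<open>simp add: index_ok_def\<close>)
  have neg: "- As j *\<^sub>v u + w = w - As j *\<^sub>v u" if "u \<in> carrier_vec n" "w \<in> carrier_vec n" for u w
    using that A by (intro eq_vecI) (auto simp: uminus_scalar_prod)
  have P: "blk m n k (elem_mat m n (Pos j) (- As j) *\<^sub>v v) =
      (if k = j then if j = 0 then - As j *\<^sub>v blk m n 0 v else - As j *\<^sub>v blk m n j v + blk m n (j - 1) v
       else if Suc k = j then blk m n j v else blk m n k v)"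
    by (rule blk_elem_Pos[OF assms(1) A(2) assms(3,4)])
  show ?thesis
  proof (cases "j = 0")
    case True
    have "blk m n k (affine_step m n As d j v) =
        blk m n k (elem_mat m n (Pos j) (- As j) *\<^sub>v v) + (if k = 0 then d else 0\<^sub>v n)"
      unfolding affine_step.simps using True M assms m_pos by (simp add: blk_linear blk_place)
    then show ?thesis unfolding P using True neg[of "blk m n 0 v" d] assms(2) by simp
  next
    case False
    then have eq: "affine_step m n As d j v = elem_mat m n (Pos j) (- As j) *\<^sub>v v"
      using M by (simp add: affine_step.simps)
    show ?thesis unfolding eq P neg[OF blk_carrier blk_carrier] using False by simp
  qed
qed

lemma affine_run_no_0:
  assumes "0 \<notin> set \<rho>" "set \<rho> \<subseteq> {..<m}" "v \<in> carrier_vec (m * n)"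
  shows "affine_run m n As d \<rho> v = elem_prod_P m n As (map Pos \<rho>) *\<^sub>v v"
  using assms
proof (induction \<rho>)
  case Nil
  then show ?case by (simp add: elem_prod_P_Nil_vec)
next
  case (Cons j \<rho>)
  have ok: "\<And>t. t \<in> insert (Pos j) (set (map Pos \<rho>)) \<Longrightarrow> index_ok m t"
    using Cons.prems(2) by (auto simp: index_ok_def)
  have "elem_mat m n (Pos j) (- As j) *\<^sub>v affine_run m n As d \<rho> v \<in> carrier_vec (m * n)"
    using elem_mat_vec_carrier[of m "Pos j" "- As j" n] As[of j] ok affine_run_carrier[of \<rho> v d] Cons.prems
    by auto
  moreover have "elem_prod_P m n As (map Pos (j # \<rho>)) *\<^sub>v v =
      elem_mat m n (Pos j) (- As j) *\<^sub>v (elem_prod_P m n As (map Pos \<rho>) *\<^sub>v v)"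
    using elem_prod_P_Cons_vec[of "Pos j" "map Pos \<rho>" m As n v, OF ok As Cons.prems(3)] by simp
  ultimately show ?case
    using Cons.IH Cons.prems by (simp add: affine_step.simps)
qed

end

text \<open>The vectors on the wires of the circuit with input \<open>v\<close>: \<open>p k\<close> and \<open>t k\<close> are the upper and the lower
  input of the gate with index \<open>k\<close>.  At an inversion of \<open>J\<close> the gate \<open>k\<close> acts before the gate
  \<open>k + 1\<close>, so its upper input is still the input block \<open>k\<close>, and its upper output is the lower
  input of the gate \<open>k + 1\<close>.  At a consecution the gate \<open>k + 1\<close> acts first: it takes the input block
  \<open>k\<close> and passes its own upper input on to the gate \<open>k\<close>.\<close>
definition wires :: "nat \<Rightarrow> nat \<Rightarrow> (nat \<Rightarrow> complex mat) \<Rightarrow> complex vec \<Rightarrow> (nat \<Rightarrow> bool) \<Rightarrow>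
    complex vec \<Rightarrow> (nat \<Rightarrow> complex vec) \<Rightarrow> (nat \<Rightarrow> complex vec) \<Rightarrow> bool" where
  "wires m n As d J v p t \<longleftrightarrow>
     (\<forall>k. p k \<in> carrier_vec n \<and> t k \<in> carrier_vec n) \<and> t 0 = d \<and> p (m - 1) = blk m n (m - 1) v \<and>
     (\<forall>k. Suc k < m \<longrightarrow> J k \<longrightarrow> p k = blk m n k v \<and> t (Suc k) = t k - As k *\<^sub>v p k) \<and>
     (\<forall>k. Suc k < m \<longrightarrow> \<not> J k \<longrightarrow> p k = p (Suc k) \<and> t (Suc k) = blk m n k v)"

lemma wires_rules:
  assumes "wires m n As d J v p t"
  shows
  "t 0 = d" "p (m - 1) = blk m n (m - 1) v" "p k \<in> carrier_vec n" "t k \<in> carrier_vec n"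
  "Suc k < m \<Longrightarrow> J k \<Longrightarrow> blk m n k v = p k"
  "Suc k < m \<Longrightarrow> J k \<Longrightarrow> t k - As k *\<^sub>v p k = t (Suc k)"
  "Suc k < m \<Longrightarrow> \<not> J k \<Longrightarrow> p (Suc k) = p k"
  "Suc k < m \<Longrightarrow> \<not> J k \<Longrightarrow> blk m n k v = t (Suc k)"
  using assms unfolding wires_def by metis+

text \<open>Block \<open>k\<close> after the gates in \<open>\<eta>\<close>, a suffix of \<open>\<pi>\<close>, have acted.  Only the gates \<open>k\<close> and \<open>k + 1\<close>
  touch this block, and the last of the two that has acted decides its value.\<close>
definition suffix_value :: "nat \<Rightarrow> nat \<Rightarrow> (nat \<Rightarrow> complex mat) \<Rightarrow> nat list \<Rightarrow> complex vec \<Rightarrow>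
    (nat \<Rightarrow> complex vec) \<Rightarrow> (nat \<Rightarrow> complex vec) \<Rightarrow> nat list \<Rightarrow> nat \<Rightarrow> complex vec" where
  "suffix_value m n As \<pi> v p t \<eta> k =
    (if k \<in> set \<eta> then if Suc k \<in> set \<eta> \<and> inversion_at \<pi> k then p (Suc k) else t k - As k *\<^sub>v p k
     else if Suc k \<in> set \<eta> then p (Suc k) else blk m n k v)"

context
  fixes m n :: nat and As :: "nat \<Rightarrow> complex mat" and \<pi> :: "nat list" and d v :: "complex vec"
    and p t :: "nat \<Rightarrow> complex vec"
  assumes m_pos: "0 < m" and As: "\<And>i. i \<le> m \<Longrightarrow> As i \<in> carrier_mat n n"
    and perm: "distinct \<pi>" "set \<pi> = {..<m}"
    and W: "wires m n As d (inversion_at \<pi>) v p t"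
    and v: "v \<in> carrier_vec (m * n)"
begin

lemmas wiresD = wires_rules[OF W]

text \<open>The two claims support each other: the value of the blocks after a suffix gives the upper input of
  the next gate, and the inputs of that gate give the blocks after the longer suffix.\<close>
lemma affine_run_suffix:
  "\<pi> = \<xi> @ \<eta> \<Longrightarrow> k < m \<Longrightarrow> blk m n k (affine_run m n As d \<eta> v) =
    suffix_value m n As \<pi> v p t \<eta> k"
  and upper_input: "\<pi> = \<xi> @ j # \<eta> \<Longrightarrow> blk m n j (affine_run m n As d \<eta> v) = p j"
proof -
  have upper: "blk m n j (affine_run m n As d \<eta> v) = p j"
    if split: "\<pi> = \<xi> @ j # \<eta>"
      and IH: "\<And>k. k < m \<Longrightarrow> blk m n k (affine_run m n As d \<eta> v) =
        suffix_value m n As \<pi> v p t \<eta> k" for \<xi> j \<eta>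
  proof -
    have d: "distinct (\<xi> @ j # \<eta>)" and j: "j < m" "j \<notin> set \<eta>" using perm split by auto
    note lop = inversion_at_cases[OF d, folded split]
    show ?thesis
    proof (cases "Suc j < m")
      case True
      then have "Suc j \<in> set \<pi>" using perm(2) by simp
      then have "Suc j \<in> set \<xi> \<or> Suc j \<in> set \<eta>" unfolding split by simp
      then show ?thesis
      proof
        assume "Suc j \<in> set \<xi>"
        moreover from this have "Suc j \<notin> set \<eta>" using d by auto
        ultimately show ?thesis
          using IH[OF j(1)] j lop(2) wiresD(5)[OF True] by (simp add: suffix_value_def)
      next
        assume "Suc j \<in> set \<eta>"
        then show ?thesis
          using IH[OF j(1)] j lop(1) wiresD(7)[OF True] by (simp add: suffix_value_def)
      qed
    next
      case False
      then have jm: "j = m - 1" using j by simp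
      have "Suc j \<notin> set \<pi>" using False perm(2) by simp
      then have "Suc j \<notin> set \<eta>" unfolding split by simp
      then show ?thesis using IH[OF j(1)] j wiresD(2) jm by (simp add: suffix_value_def)
    qed
  qed
  have main: "\<pi> = \<xi> @ \<eta> \<Longrightarrow> k < m \<Longrightarrow> blk m n k (affine_run m n As d \<eta> v) =
    suffix_value m n As \<pi> v p t \<eta> k" for \<xi> \<eta> k
  proof (induction \<eta> arbitrary: \<xi> k)
    case (Cons j \<eta>)
    have split: "\<pi> = (\<xi> @ [j]) @ \<eta>" using Cons.prems(1) by simp
    note IH = Cons.IH[OF split]
    have d: "distinct (\<xi> @ j # \<eta>)" and j: "j < m" "j \<notin> set \<eta>" using perm Cons.prems(1) by auto
    note lop = inversion_at_cases[OF d, folded Cons.prems(1)]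
    have sub: "set \<eta> \<subseteq> {..<m}" using perm Cons.prems(1) by auto
    have dc: "d \<in> carrier_vec n" using wiresD(1) wiresD(4)[of 0] by simp
    have car: "affine_run m n As d \<eta> v \<in> carrier_vec (m * n)"
      by (rule affine_run_carrier[OF m_pos As sub v])
    note up = upper[OF Cons.prems(1) IH]
    note step = blk_affine_step[OF m_pos As j(1) dc car Cons.prems(2)]
    \<comment> \<open>the lower input of the factor with index \<open>j\<close>\<close>
    have low: "(if j = 0 then d else blk m n (j - 1) (affine_run m n As d \<eta> v)) = t j"
    proof (cases j)
      case 0
      then show ?thesis using wiresD(1) by simp
    next
      case (Suc i)
      have i: "i < m" "Suc i < m" using j Suc by auto
      have "i \<in> set \<pi>" using perm(2) i by simp
      then have "i \<in> set \<xi> \<or> i \<in> set \<eta>" unfolding Cons.prems(1) using Suc by simp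
      then show ?thesis
      proof
        assume "i \<in> set \<eta>"
        moreover from this have "inversion_at \<pi> i" by (rule lop(3)[OF Suc])
        ultimately show ?thesis
          using IH[OF i(1)] j Suc wiresD(6)[OF i(2)] by (simp add: suffix_value_def)
      next
        assume xi: "i \<in> set \<xi>"
        then have "i \<notin> set \<eta>" using d by auto
        moreover from xi have "\<not> inversion_at \<pi> i" by (rule lop(4)[OF Suc])
        ultimately show ?thesis
          using IH[OF i(1)] j Suc wiresD(8)[OF i(2)] by (simp add: suffix_value_def)
      qed
    qed
    consider "k = j" | "Suc k = j" | "k \<noteq> j" "Suc k \<noteq> j" by blast
    then show ?case
    proof cases
      case 1
      then show ?thesis using step low up lop(1) j by (auto simp: suffix_value_def)
    next
      case 2
      then show ?thesis using step up j lop(3)[of k] by (auto simp: suffix_value_def)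
    next
      case 3
      then show ?thesis using step IH[OF Cons.prems(2)] by (simp add: suffix_value_def)
    qed
  next
    case Nil
    show ?case unfolding suffix_value_def by simp
  qed
  show "\<pi> = \<xi> @ \<eta> \<Longrightarrow> k < m \<Longrightarrow> blk m n k (affine_run m n As d \<eta> v) =
    suffix_value m n As \<pi> v p t \<eta> k" by (rule main)
  show "blk m n j (affine_run m n As d \<eta> v) = p j" if s: "\<pi> = \<xi> @ j # \<eta>"
    by (rule upper[OF s]) (rule main[of "\<xi> @ [j]"], simp add: s)
qed

end

section \<open>Horner recursions\<close>

text \<open>Lets a sequence be prescribed from the index \<open>m - 1\<close> downwards.  The invariant \<open>C\<close> is required at
  all indices, so that no bounds are needed when the carrier of a member is asked for.\<close>
lemma downward_recursion:
  fixes g :: "nat \<Rightarrow> 'a \<Rightarrow> 'a"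
  assumes "a \<in> C" "\<And>k x. x \<in> C \<Longrightarrow> g k x \<in> C"
  shows "\<exists>p. (\<forall>k. p k \<in> C) \<and> p (m - 1) = a \<and> (\<forall>k. Suc k < m \<longrightarrow> p k = g k (p (Suc k)))"
proof -
  define q where "q = rec_nat a (\<lambda>i. g (m - 1 - Suc i))"
  have q: "q 0 = a" "q (Suc i) = g (m - 1 - Suc i) (q i)" for i by (simp_all add: q_def)
  have "q i \<in> C" for i by (induction i) (simp_all add: q assms)
  moreover have "q (m - 1 - k) = g k (q (m - 1 - Suc k))" if "Suc k < m" for k
  proof -
    have "m - 1 - k = Suc (m - 1 - Suc k)" "m - 1 - Suc (m - 1 - Suc k) = k" using that by auto
    then show ?thesis using q(2)[of "m - 1 - Suc k"] by simp
  qed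
  ultimately show ?thesis using q(1) by (intro exI[of _ "\<lambda>k. q (m - 1 - k)"]) simp
qed

lemma upward_recursion:
  fixes g :: "nat \<Rightarrow> 'a \<Rightarrow> 'a"
  assumes "a \<in> C" "\<And>k x. x \<in> C \<Longrightarrow> g k x \<in> C"
  shows "\<exists>t. (\<forall>k. t k \<in> C) \<and> t 0 = a \<and> (\<forall>k. t (Suc k) = g k (t k))"
proof -
  define t where "t = rec_nat a g"
  have t: "t 0 = a" "t (Suc k) = g k (t k)" for k by (simp_all add: t_def)
  have "t k \<in> C" for k by (induction k) (simp_all add: t assms)
  then show ?thesis using t by blast
qed

text \<open>The upper inputs are known from the top index downwards, the lower inputs from \<open>0\<close> upwards.\<close>
lemma wires_exist:
  assumes As: "\<And>i. i \<le> m \<Longrightarrow> As i \<in> carrier_mat n n" and d: "d \<in> carrier_vec n"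
  shows "\<exists>p t. wires m n As d J v p t"
proof -
  have "(if J k then blk m n k v else x) \<in> carrier_vec n" if "x \<in> carrier_vec n" for k x
    using that by simp
  from downward_recursion[where g = "\<lambda>k x. if J k then blk m n k v else x", OF blk_carrier this]
  obtain p where p: "\<forall>k. p k \<in> carrier_vec n" "p (m - 1) = blk m n (m - 1) v"
    "\<forall>k. Suc k < m \<longrightarrow> p k = (if J k then blk m n k v else p (Suc k))" by blast
  have "(if Suc k < m \<and> J k then x - As k *\<^sub>v p k else blk m n k v) \<in> carrier_vec n"
    if "x \<in> carrier_vec n" for k x
    using that p(1) As[of k] by auto
  from upward_recursion[where g = "\<lambda>k x. if Suc k < m \<and> J k then x - As k *\<^sub>v p k else blk m n k v", OF d this]
  obtain t where t: "\<forall>k. t k \<in> carrier_vec n" "t 0 = d"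
    "\<forall>k. t (Suc k) = (if Suc k < m \<and> J k then t k - As k *\<^sub>v p k else blk m n k v)" by blast
  show ?thesis
    unfolding wires_def by (intro exI[of _ p] exI[of _ t]) (use p t in simp)
qed

text \<open>A Horner scheme for \<open>P(\<mu>)\<close> in which each step multiplies by \<open>\<mu>\<close> either the argument \<open>p\<close> or the
  partial value \<open>t\<close>.\<close>
definition horner :: "nat \<Rightarrow> (nat \<Rightarrow> complex mat) \<Rightarrow> complex \<Rightarrow> (nat \<Rightarrow> bool) \<Rightarrow>
    (nat \<Rightarrow> complex vec) \<Rightarrow> (nat \<Rightarrow> complex vec) \<Rightarrow> bool" where
  "horner m As \<mu> J p t \<longleftrightarrow>
     (\<forall>k. Suc k < m \<longrightarrow> J k \<longrightarrow> p (Suc k) = \<mu> \<cdot>\<^sub>v p k \<and> t k = As k *\<^sub>v p k + t (Suc k)) \<and>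
     (\<forall>k. Suc k < m \<longrightarrow> \<not> J k \<longrightarrow> p (Suc k) = p k \<and> t k = As k *\<^sub>v p k + \<mu> \<cdot>\<^sub>v t (Suc k)) \<and>
     t (m - 1) = As (m - 1) *\<^sub>v p (m - 1) + \<mu> \<cdot>\<^sub>v (As m *\<^sub>v p (m - 1))"

lemma matrix_poly_mult_vec:
  assumes "\<And>i. i \<le> m \<Longrightarrow> As i \<in> carrier_mat n n" "x \<in> carrier_vec n" "l < n"
  shows "(matrix_poly m n As \<mu> *\<^sub>v x) $ l = (\<Sum>i\<le>m. \<mu> ^ i * (As i *\<^sub>v x) $ l)"
proof -
  have "(matrix_poly m n As \<mu> *\<^sub>v x) $ l = (\<Sum>j<n. (\<Sum>i\<le>m. \<mu> ^ i * As i $$ (l, j)) * x $ j)"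
    using assms by (simp add: matrix_poly_def scalar_prod_def atLeast0LessThan)
  also have "\<dots> = (\<Sum>i\<le>m. \<mu> ^ i * (\<Sum>j<n. As i $$ (l, j) * x $ j))"
    by (simp add: sum_distrib_left sum_distrib_right mult.assoc sum.swap[of _ "{..m}"])
  also have "\<dots> = (\<Sum>i\<le>m. \<mu> ^ i * (As i *\<^sub>v x) $ l)"
  proof (rule sum.cong)
    fix i assume "i \<in> {..m}"
    then have "As i \<in> carrier_mat n n" using assms(1) by simp
    then show "\<mu> ^ i * (\<Sum>j<n. As i $$ (l, j) * x $ j) = \<mu> ^ i * (As i *\<^sub>v x) $ l"
      using assms(2,3) by (simp add: scalar_prod_def atLeast0LessThan)
  qed simp
  finally show ?thesis .
qed

text \<open>After \<open>k\<close> steps, \<open>a\<close> of which multiplied the argument and \<open>b\<close> the partial value, the term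
  \<open>A_k p_k\<close> carries the factor \<open>\<mu>^a\<close> and is itself multiplied by \<open>\<mu>^b\<close>.  As \<open>a + b = k\<close>, it
  contributes \<open>\<mu>^k A_k p_0\<close>, whatever the pattern \<open>J\<close> is.\<close>
lemma horner_value:
  assumes m: "0 < m" and As: "\<And>i. i \<le> m \<Longrightarrow> As i \<in> carrier_mat n n"
    and H: "horner m As \<mu> J p t"
    and p: "\<And>k. p k \<in> carrier_vec n" and t: "\<And>k. t k \<in> carrier_vec n"
  shows "t 0 = matrix_poly m n As \<mu> *\<^sub>v p 0"
proof -
  have inv: "\<exists>a b. a + b = k \<and> p k = \<mu> ^ a \<cdot>\<^sub>v p 0 \<and>
      (\<forall>l<n. t 0 $ l = (\<Sum>i<k. \<mu> ^ i * (As i *\<^sub>v p 0) $ l) + \<mu> ^ b * t k $ l)" if "k < m" for k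
    using that
  proof (induction k)
    case 0
    then show ?case by (intro exI[of _ 0]) simp
  next
    case (Suc k)
    then obtain a b where ab: "a + b = k" "p k = \<mu> ^ a \<cdot>\<^sub>v p 0"
      and s: "\<And>l. l < n \<Longrightarrow> t 0 $ l = (\<Sum>i<k. \<mu> ^ i * (As i *\<^sub>v p 0) $ l) + \<mu> ^ b * t k $ l"
      by auto
    have A: "As k \<in> carrier_mat n n" using As Suc.prems by simp
    have Ap: "As k *\<^sub>v p k = \<mu> ^ a \<cdot>\<^sub>v (As k *\<^sub>v p 0)"
      unfolding ab(2) by (rule mult_mat_vec[OF A p])
    have pw: "\<mu> ^ b * (\<mu> ^ a * x) = \<mu> ^ k * x" for x
      unfolding ab(1)[symmetric] by (simp add: power_add mult_ac)
    show ?case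
    proof (cases "J k")
      case True
      then have R: "p (Suc k) = \<mu> \<cdot>\<^sub>v p k" "t k = As k *\<^sub>v p k + t (Suc k)"
        using H Suc.prems unfolding horner_def by auto
      have "t 0 $ l = (\<Sum>i<Suc k. \<mu> ^ i * (As i *\<^sub>v p 0) $ l) + \<mu> ^ b * t (Suc k) $ l" if l: "l < n" for l
        using s[OF l] l t[of "Suc k"] A unfolding R(2) Ap
        by (simp add: pw distrib_left del: index_mult_mat_vec)
      moreover have "p (Suc k) = \<mu> ^ Suc a \<cdot>\<^sub>v p 0" unfolding R ab(2) by (simp add: smult_smult_assoc)
      ultimately show ?thesis using ab(1) by (intro exI[of _ "Suc a"] exI[of _ b]) simp
    next
      case False
      then have R: "p (Suc k) = p k" "t k = As k *\<^sub>v p k + \<mu> \<cdot>\<^sub>v t (Suc k)"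
        using H Suc.prems unfolding horner_def by auto
      have "t 0 $ l = (\<Sum>i<Suc k. \<mu> ^ i * (As i *\<^sub>v p 0) $ l) + \<mu> ^ Suc b * t (Suc k) $ l" if l: "l < n" for l
        using s[OF l] l t[of "Suc k"] A unfolding R(2) Ap
        by (simp add: pw distrib_left del: index_mult_mat_vec)
      then show ?thesis using ab R(1) by (intro exI[of _ a] exI[of _ "Suc b"]) simp
    qed
  qed
  obtain m' where m': "m = Suc m'" using m by (cases m) auto
  from inv[of m'] m' obtain a b where ab: "a + b = m'" "p m' = \<mu> ^ a \<cdot>\<^sub>v p 0"
      and s: "\<And>l. l < n \<Longrightarrow> t 0 $ l = (\<Sum>i<m'. \<mu> ^ i * (As i *\<^sub>v p 0) $ l) + \<mu> ^ b * t m' $ l"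
    by auto
  have A: "As m' \<in> carrier_mat n n" "As m \<in> carrier_mat n n" using As m' by simp_all
  have Ap: "As m' *\<^sub>v p m' = \<mu> ^ a \<cdot>\<^sub>v (As m' *\<^sub>v p 0)" "As m *\<^sub>v p m' = \<mu> ^ a \<cdot>\<^sub>v (As m *\<^sub>v p 0)"
    unfolding ab(2) by (rule mult_mat_vec[OF A(1) p] mult_mat_vec[OF A(2) p])+
  have pw: "\<mu> ^ b * (\<mu> ^ a * x) = \<mu> ^ m' * x" "\<mu> ^ b * (\<mu> * (\<mu> ^ a * x)) = \<mu> ^ m * x" for x
    unfolding m' ab(1)[symmetric] by (simp_all add: power_add mult_ac)
  have tm: "t m' = As m' *\<^sub>v p m' + \<mu> \<cdot>\<^sub>v (As m *\<^sub>v p m')"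
    using H unfolding horner_def m' by simp
  show "t 0 = matrix_poly m n As \<mu> *\<^sub>v p 0"
  proof (rule eq_vecI)
    fix l assume "l < dim_vec (matrix_poly m n As \<mu> *\<^sub>v p 0)"
    then have l: "l < n" by (simp add: matrix_poly_def)
    have "t m' $ l = \<mu> ^ a * (As m' *\<^sub>v p 0) $ l + \<mu> * (\<mu> ^ a * (As m *\<^sub>v p 0) $ l)"
      unfolding tm Ap using l A by (simp del: index_mult_mat_vec)
    then have "t 0 $ l = (\<Sum>i<m'. \<mu> ^ i * (As i *\<^sub>v p 0) $ l) + \<mu> ^ m' * (As m' *\<^sub>v p 0) $ l
        + \<mu> ^ m * (As m *\<^sub>v p 0) $ l"
      unfolding s[OF l] by (simp only: distrib_left pw add.assoc)
    also have "\<dots> = (\<Sum>i\<le>m. \<mu> ^ i * (As i *\<^sub>v p 0) $ l)"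
      unfolding m' lessThan_Suc_atMost[symmetric] by (simp del: index_mult_mat_vec)
    finally show "t 0 $ l = (matrix_poly m n As \<mu> *\<^sub>v p 0) $ l"
      using matrix_poly_mult_vec[OF As p l] by simp
  qed (use t[of 0] in \<open>simp add: matrix_poly_def\<close>)
qed

context
  fixes m n :: nat and As :: "nat \<Rightarrow> complex mat" and \<pi> :: "nat list" and \<mu> :: complex
  assumes m_pos: "0 < m" and As: "\<And>i. i \<le> m \<Longrightarrow> As i \<in> carrier_mat n n"
    and perm: "distinct \<pi>" "set \<pi> = {..<m}"
begin

text \<open>The output of the circuit in block \<open>k\<close> is \<open>p (k + 1)\<close> at an inversion and \<open>t k - A_k p k\<close> otherwise,
  while the input was \<open>p k\<close> or \<open>t (k + 1)\<close>; equating the output with \<open>\<mu>\<close> times the input gives the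
  Horner step.  In the top block \<open>M_{-m}\<close> contributes the leading coefficient \<open>A_m\<close>.\<close>
lemma pencil_eq_iff_horner:
  assumes W: "wires m n As d (inversion_at \<pi>) v p t" and v: "v \<in> carrier_vec (m * n)"
  shows "\<mu> \<cdot>\<^sub>v (elem_mat m n (Neg m) (As m) *\<^sub>v v) = affine_run m n As d \<pi> v \<longleftrightarrow>
    horner m As \<mu> (inversion_at \<pi>) p t"
proof -
  let ?J = "inversion_at \<pi>"
  note wD = wires_rules[OF W]
  have Am: "As m \<in> carrier_mat n n" using As by simp
  have okm: "index_ok m (Neg m)" using m_pos by (simp add: index_ok_def)
  have M: "elem_mat m n (Neg m) (As m) *\<^sub>v v \<in> carrier_vec (m * n)"
    by (rule elem_mat_vec_carrier[OF okm Am v])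
  have R: "affine_run m n As d \<pi> v \<in> carrier_vec (m * n)"
    by (rule affine_run_carrier[OF m_pos As _ v]) (use perm in auto)
  have L: "blk m n k (\<mu> \<cdot>\<^sub>v (elem_mat m n (Neg m) (As m) *\<^sub>v v)) =
      (if Suc k = m then \<mu> \<cdot>\<^sub>v (As m *\<^sub>v p k) else \<mu> \<cdot>\<^sub>v blk m n k v)" if k: "k < m" for k
    using blk_linear(3)[OF k M M] blk_elem_Negm[OF m_pos Am v k] wD(2) k by auto
  have Rb: "blk m n k (affine_run m n As d \<pi> v) =
      (if Suc k < m \<and> ?J k then p (Suc k) else t k - As k *\<^sub>v p k)" if k: "k < m" for k
    using affine_run_suffix[OF m_pos As perm W v append_Nil[symmetric] k]
    unfolding suffix_value_def perm(2) using k by simp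
  have move: "x = y - z \<longleftrightarrow> y = z + x"
    if "x \<in> carrier_vec n" "y \<in> carrier_vec n" "z \<in> carrier_vec n" for x y z :: "complex vec"
    using that by (auto simp: vec_eq_iff algebra_simps)
  have Ap: "As k *\<^sub>v p k \<in> carrier_vec n" if "k < m" for k
    using As[of k] that wD(3) by auto
  have blkwise: "\<mu> \<cdot>\<^sub>v (elem_mat m n (Neg m) (As m) *\<^sub>v v) = affine_run m n As d \<pi> v \<longleftrightarrow>
    (\<forall>k<m. (if Suc k = m then \<mu> \<cdot>\<^sub>v (As m *\<^sub>v p k) else \<mu> \<cdot>\<^sub>v blk m n k v) =
      (if Suc k < m \<and> ?J k then p (Suc k) else t k - As k *\<^sub>v p k))" (is "?eq \<longleftrightarrow> ?bw")
  proof -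
    have "?eq \<longleftrightarrow> (\<forall>k<m. blk m n k (\<mu> \<cdot>\<^sub>v (elem_mat m n (Neg m) (As m) *\<^sub>v v)) =
        blk m n k (affine_run m n As d \<pi> v))"
    proof
      assume all: "\<forall>k<m. blk m n k (\<mu> \<cdot>\<^sub>v (elem_mat m n (Neg m) (As m) *\<^sub>v v)) =
        blk m n k (affine_run m n As d \<pi> v)"
      show ?eq
      proof (rule vec_eq_blkI)
        show "\<mu> \<cdot>\<^sub>v (elem_mat m n (Neg m) (As m) *\<^sub>v v) \<in> carrier_vec (m * n)" using M by simp
      qed (use R all in simp_all)
    qed simp
    also have "\<dots> \<longleftrightarrow> ?bw"
      by (intro all_cong1 imp_cong refl) (simp only: L Rb)
    finally show ?thesis .
  qed
  have top: "\<mu> \<cdot>\<^sub>v (As m *\<^sub>v p k) = t k - As k *\<^sub>v p k \<longleftrightarrow> t k = As k *\<^sub>v p k + \<mu> \<cdot>\<^sub>v (As m *\<^sub>v p k)"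
    if "k < m" for k
    by (rule move) (use Ap[OF that] wD(3,4) Am in auto)
  have step: "\<mu> \<cdot>\<^sub>v blk m n k v = (if ?J k then p (Suc k) else t k - As k *\<^sub>v p k) \<longleftrightarrow>
      (if ?J k then p (Suc k) = \<mu> \<cdot>\<^sub>v p k \<and> t k = As k *\<^sub>v p k + t (Suc k)
       else p (Suc k) = p k \<and> t k = As k *\<^sub>v p k + \<mu> \<cdot>\<^sub>v t (Suc k))" if k: "Suc k < m" for k
  proof (cases "?J k")
    case True
    have "t k = As k *\<^sub>v p k + t (Suc k)"
      using move[OF wD(4)[of "Suc k"] wD(4)[of k] Ap[of k]] wD(6)[OF k True] k by simp
    then show ?thesis using True wD(5)[OF k True] by (simp add: eq_commute[of "\<mu> \<cdot>\<^sub>v p k"])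
  next
    case False
    have "\<mu> \<cdot>\<^sub>v t (Suc k) \<in> carrier_vec n" using wD(4) by simp
    from move[OF this wD(4)[of k] Ap[of k]] show ?thesis
      using False wD(7,8)[OF k False] k by simp
  qed
  obtain m' where m': "m = Suc m'" using m_pos by (cases m) auto
  show ?thesis
  proof
    assume ?eq
    then have bw: ?bw using blkwise by simp
    have "t m' = As m' *\<^sub>v p m' + \<mu> \<cdot>\<^sub>v (As m *\<^sub>v p m')"
      using bw[rule_format, of m'] top[of m'] m' by simp
    moreover have "if ?J k then p (Suc k) = \<mu> \<cdot>\<^sub>v p k \<and> t k = As k *\<^sub>v p k + t (Suc k)
       else p (Suc k) = p k \<and> t k = As k *\<^sub>v p k + \<mu> \<cdot>\<^sub>v t (Suc k)" if k: "Suc k < m" for k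
      using bw[rule_format, of k] step[OF k] k by (simp split: if_splits)
    ultimately show "horner m As \<mu> ?J p t" unfolding horner_def m' diff_Suc_1 by presburger
  next
    assume H: "horner m As \<mu> ?J p t"
    have ?bw
    proof (intro allI impI)
      fix k assume k: "k < m"
      show "(if Suc k = m then \<mu> \<cdot>\<^sub>v (As m *\<^sub>v p k) else \<mu> \<cdot>\<^sub>v blk m n k v) =
        (if Suc k < m \<and> ?J k then p (Suc k) else t k - As k *\<^sub>v p k)"
      proof (cases "Suc k = m")
        case True
        then have "t k = As k *\<^sub>v p k + \<mu> \<cdot>\<^sub>v (As m *\<^sub>v p k)"
          using H unfolding horner_def by auto
        then show ?thesis using top[OF k] True by simp
      next
        case False
        then have sk: "Suc k < m" using k by simp
        then have "if ?J k then p (Suc k) = \<mu> \<cdot>\<^sub>v p k \<and> t k = As k *\<^sub>v p k + t (Suc k)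
          else p (Suc k) = p k \<and> t k = As k *\<^sub>v p k + \<mu> \<cdot>\<^sub>v t (Suc k)"
          using H unfolding horner_def by simp
        then show ?thesis using step[OF sk] sk False by auto
      qed
    qed
    then show ?eq using blkwise by simp
  qed
qed

end

lemma horner_step:
  assumes "horner m As \<mu> J p t" "Suc k < m"
  shows "t k = As k *\<^sub>v p k + (if J k then t (Suc k) else \<mu> \<cdot>\<^sub>v t (Suc k))"
    and "p (Suc k) = (if J k then \<mu> \<cdot>\<^sub>v p k else p k)"
proof -
  have "J k \<longrightarrow> p (Suc k) = \<mu> \<cdot>\<^sub>v p k \<and> t k = As k *\<^sub>v p k + t (Suc k)"
    and "\<not> J k \<longrightarrow> p (Suc k) = p k \<and> t k = As k *\<^sub>v p k + \<mu> \<cdot>\<^sub>v t (Suc k)"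
    using assms unfolding horner_def by blast+
  then show "t k = As k *\<^sub>v p k + (if J k then t (Suc k) else \<mu> \<cdot>\<^sub>v t (Suc k))"
    and "p (Suc k) = (if J k then \<mu> \<cdot>\<^sub>v p k else p k)"
    by (cases "J k"; simp only: simp_thms if_True if_False)+
qed

text \<open>The argument \<open>p\<close> is determined upwards from \<open>p 0\<close>, and \<open>t\<close> downwards from its top value.  No
  division by \<open>\<mu>\<close> occurs, so \<open>\<mu> = 0\<close> is no exception.\<close>
lemma horner_unique:
  assumes H: "horner m As \<mu> J p t" "horner m As \<mu> J p' t'" and "p 0 = p' 0" and "k < m"
  shows "p k = p' k" and "t k = t' k"
proof -
  have p: "p k = p' k" if "k < m" for k
    using that
  proof (induction k)
    case (Suc k)
    then show ?case using horner_step(2)[OF H(1), of k] horner_step(2)[OF H(2), of k] by simp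
  qed (use assms(3) in simp)
  then show "p k = p' k" using assms(4) .
  have "i < m \<Longrightarrow> t (m - 1 - i) = t' (m - 1 - i)" for i
  proof (induction i)
    case 0
    then show ?case using H p[of "m - 1"] by (simp add: horner_def)
  next
    case (Suc i)
    let ?k = "m - 1 - Suc i"
    have k: "Suc ?k = m - 1 - i" "Suc ?k < m" "?k < m" using Suc.prems by auto
    have "t (Suc ?k) = t' (Suc ?k)" unfolding k(1) using Suc by simp
    moreover have "t ?k = As ?k *\<^sub>v p ?k + (if J ?k then t (Suc ?k) else \<mu> \<cdot>\<^sub>v t (Suc ?k))"
      by (rule horner_step(1)[OF H(1) k(2)])
    moreover have "t' ?k = As ?k *\<^sub>v p' ?k + (if J ?k then t' (Suc ?k) else \<mu> \<cdot>\<^sub>v t' (Suc ?k))"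
      by (rule horner_step(1)[OF H(2) k(2)])
    ultimately show ?case using p[OF k(3)] by (simp only:)
  qed
  from this[of "m - 1 - k"] show "t k = t' k" using assms(4) by simp
qed

lemma vec_eq_add_diff:
  fixes u x :: "complex vec"
  assumes "u \<in> carrier_vec n" "x \<in> carrier_vec n"
  shows "x = u + x - u"
  using assms by (intro eq_vecI) auto

lemma horner_exist:
  assumes As: "\<And>i. i \<le> m \<Longrightarrow> As i \<in> carrier_mat n n" and x: "x \<in> carrier_vec n"
  shows "\<exists>p t. (\<forall>k. p k \<in> carrier_vec n \<and> t k \<in> carrier_vec n) \<and> p 0 = x \<and> horner m As \<mu> J p t"
proof -
  have "(if J k then \<mu> \<cdot>\<^sub>v y else y) \<in> carrier_vec n" if "y \<in> carrier_vec n" for k and y :: "complex vec"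
    using that by simp
  from upward_recursion[where g = "\<lambda>k y. if J k then \<mu> \<cdot>\<^sub>v y else y", OF x this]
  obtain p where p: "\<forall>k. p k \<in> carrier_vec n" "p 0 = x"
    "\<forall>k. p (Suc k) = (if J k then \<mu> \<cdot>\<^sub>v p k else p k)" by blast
  let ?g = "\<lambda>k y. if Suc k < m then As k *\<^sub>v p k + (if J k then y else \<mu> \<cdot>\<^sub>v y) else y"
  let ?a = "As (m - 1) *\<^sub>v p (m - 1) + \<mu> \<cdot>\<^sub>v (As m *\<^sub>v p (m - 1))"
  have "?g k y \<in> carrier_vec n" if "y \<in> carrier_vec n" for k y
    using that p(1) As[of k] by auto
  moreover have "?a \<in> carrier_vec n" using As[of "m - 1"] As[of m] p(1) by simp
  ultimately obtain t where t: "\<forall>k. t k \<in> carrier_vec n" "t (m - 1) = ?a"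
    "\<forall>k. Suc k < m \<longrightarrow> t k = ?g k (t (Suc k))"
    using downward_recursion[where g = ?g and a = ?a and C = "carrier_vec n" and m = m] by blast
  have "horner m As \<mu> J p t" unfolding horner_def using p(3) t(2,3) by simp
  then show ?thesis using p(1,2) t(1) by (intro exI[of _ p] exI[of _ t]) simp
qed

context
  fixes m n :: nat and As :: "nat \<Rightarrow> complex mat" and \<alpha> \<beta> :: "nat list" and \<mu> :: complex
  assumes m_pos: "0 < m" and As: "\<And>i. i \<le> m \<Longrightarrow> As i \<in> carrier_mat n n"
    and perm: "distinct (\<alpha> @ 0 # \<beta>)" "set (\<alpha> @ 0 # \<beta>) = {..<m}"
begin

text \<open>The next lemmas describe the solutions \<open>v\<close> of \<open>\<mu> M_{-m} v = M_\<alpha> (M_0 M_\<beta> v + e_m \<otimes> d)\<close>.  The block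
  of \<open>M_\<beta> v\<close> that enters the gate with index \<open>0\<close> is \<open>p 0\<close>, and it parametrises them: it satisfies
  \<open>P(\<mu>) (p 0) = d\<close>, it determines \<open>v\<close>, and every solution of that equation occurs.\<close>
lemma fiedler_wires:
  assumes v: "v \<in> carrier_vec (m * n)" and d: "d \<in> carrier_vec n"
    and eq: "\<mu> \<cdot>\<^sub>v (elem_mat m n (Neg m) (As m) *\<^sub>v v) = affine_run m n As d (\<alpha> @ 0 # \<beta>) v"
  obtains p t where "wires m n As d (inversion_at (\<alpha> @ 0 # \<beta>)) v p t"
    "horner m As \<mu> (inversion_at (\<alpha> @ 0 # \<beta>)) p t"
    "p 0 = blk m n 0 (affine_run m n As d \<beta> v)"
proof -
  let ?\<pi> = "\<alpha> @ 0 # \<beta>"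
  obtain p t where W: "wires m n As d (inversion_at ?\<pi>) v p t"
    using wires_exist[of m As n d] As d by blast
  have "horner m As \<mu> (inversion_at ?\<pi>) p t"
    using pencil_eq_iff_horner[OF m_pos As perm W v] eq by simp
  moreover have "p 0 = blk m n 0 (affine_run m n As d \<beta> v)"
    using upper_input[OF m_pos As perm W v refl] by simp
  ultimately show ?thesis using W that by blast
qed

lemma fiedler_solution_value:
  assumes v: "v \<in> carrier_vec (m * n)" and d: "d \<in> carrier_vec n"
    and eq: "\<mu> \<cdot>\<^sub>v (elem_mat m n (Neg m) (As m) *\<^sub>v v) = affine_run m n As d (\<alpha> @ 0 # \<beta>) v"
  shows "matrix_poly m n As \<mu> *\<^sub>v blk m n 0 (affine_run m n As d \<beta> v) = d"
proof -
  obtain p t where W: "wires m n As d (inversion_at (\<alpha> @ 0 # \<beta>)) v p t"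
    and H: "horner m As \<mu> (inversion_at (\<alpha> @ 0 # \<beta>)) p t"
    and p0: "p 0 = blk m n 0 (affine_run m n As d \<beta> v)"
    using fiedler_wires[OF v d eq] .
  have "t 0 = matrix_poly m n As \<mu> *\<^sub>v p 0"
    by (rule horner_value[OF m_pos As H]) (use wires_rules(3,4)[OF W] in auto)
  then show ?thesis using p0 wires_rules(1)[OF W] by simp
qed

lemma fiedler_solution_unique:
  assumes v: "v \<in> carrier_vec (m * n)" "v' \<in> carrier_vec (m * n)" and d: "d \<in> carrier_vec n"
    and eq: "\<mu> \<cdot>\<^sub>v (elem_mat m n (Neg m) (As m) *\<^sub>v v) = affine_run m n As d (\<alpha> @ 0 # \<beta>) v"
      "\<mu> \<cdot>\<^sub>v (elem_mat m n (Neg m) (As m) *\<^sub>v v') = affine_run m n As d (\<alpha> @ 0 # \<beta>) v'"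
    and same: "blk m n 0 (affine_run m n As d \<beta> v) = blk m n 0 (affine_run m n As d \<beta> v')"
  shows "v = v'"
proof -
  let ?J = "inversion_at (\<alpha> @ 0 # \<beta>)"
  obtain p t where W: "wires m n As d ?J v p t" and H: "horner m As \<mu> ?J p t"
    and p0: "p 0 = blk m n 0 (affine_run m n As d \<beta> v)"
    using fiedler_wires[OF v(1) d eq(1)] .
  obtain p' t' where W': "wires m n As d ?J v' p' t'" and H': "horner m As \<mu> ?J p' t'"
    and p0': "p' 0 = blk m n 0 (affine_run m n As d \<beta> v')"
    using fiedler_wires[OF v(2) d eq(2)] .
  have "p 0 = p' 0" using p0 p0' same by simp
  note uniq = horner_unique[OF H H' this]
  show ?thesis
  proof (rule vec_eq_blkI[OF v])
    fix k assume k: "k < m"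
    show "blk m n k v = blk m n k v'"
    proof (cases "Suc k < m")
      case True
      show ?thesis
      proof (cases "?J k")
        case J: True
        show ?thesis using wires_rules(5)[OF W True J] wires_rules(5)[OF W' True J] uniq(1)[OF k] by simp
      next
        case J: False
        show ?thesis using wires_rules(8)[OF W True J] wires_rules(8)[OF W' True J] uniq(2)[OF True] by simp
      qed
    next
      case False
      then have "k = m - 1" using k by simp
      then show ?thesis using wires_rules(2)[OF W] wires_rules(2)[OF W'] uniq(1)[OF k] by simp
    qed
  qed
qed

lemma fiedler_solution_exists:
  assumes x: "x \<in> carrier_vec n" and d: "matrix_poly m n As \<mu> *\<^sub>v x = d"
  shows "\<exists>v \<in> carrier_vec (m * n).
    \<mu> \<cdot>\<^sub>v (elem_mat m n (Neg m) (As m) *\<^sub>v v) = affine_run m n As d (\<alpha> @ 0 # \<beta>) v \<and>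
    blk m n 0 (affine_run m n As d \<beta> v) = x"
proof -
  let ?J = "inversion_at (\<alpha> @ 0 # \<beta>)"
  have "\<exists>p t. (\<forall>k. p k \<in> carrier_vec n \<and> t k \<in> carrier_vec n) \<and> p 0 = x \<and> horner m As \<mu> ?J p t"
    by (rule horner_exist[OF As x])
  then obtain p t where "\<forall>k. p k \<in> carrier_vec n \<and> t k \<in> carrier_vec n" and p0: "p 0 = x"
    and H: "horner m As \<mu> ?J p t" by (elim exE conjE)
  then have car: "p k \<in> carrier_vec n" "t k \<in> carrier_vec n" for k by simp_all
  have t0: "t 0 = d" using horner_value[OF m_pos As H car] p0 d by simp
  have "(if Suc k < m \<and> \<not> ?J k then t (Suc k) else p k) \<in> carrier_vec n" for k
    using car by simp
  \<comment> \<open>the input block of a consecution is a lower input, the other ones are upper inputs\<close>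
  from vec_of_blocks[of m "\<lambda>k. if Suc k < m \<and> \<not> ?J k then t (Suc k) else p k", OF this]
  obtain v where v: "v \<in> carrier_vec (m * n)"
    and bv: "\<forall>k<m. blk m n k v = (if Suc k < m \<and> \<not> ?J k then t (Suc k) else p k)" by blast
  have W: "wires m n As d ?J v p t"
    unfolding wires_def
  proof (intro conjI allI impI)
    show "p (m - 1) = blk m n (m - 1) v" using bv m_pos by simp
    fix k assume k: "Suc k < m"
    then have A: "As k *\<^sub>v p k \<in> carrier_vec n" using As[of k] car by auto
    show "p k = blk m n k v" "t (Suc k) = t k - As k *\<^sub>v p k" if J: "?J k"
    proof -
      show "p k = blk m n k v" using bv k J by simp
      have tk: "t k = As k *\<^sub>v p k + t (Suc k)" using horner_step(1)[OF H k] J by simp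
      show "t (Suc k) = t k - As k *\<^sub>v p k"
        unfolding tk by (rule vec_eq_add_diff[OF A car(2)])
    qed
    show "p k = p (Suc k)" "t (Suc k) = blk m n k v" if J: "\<not> ?J k"
      using bv k J horner_step(2)[OF H k] by simp_all
  qed (use car t0 in auto)
  have "\<mu> \<cdot>\<^sub>v (elem_mat m n (Neg m) (As m) *\<^sub>v v) = affine_run m n As d (\<alpha> @ 0 # \<beta>) v"
    using pencil_eq_iff_horner[OF m_pos As perm W v] H by simp
  moreover have "blk m n 0 (affine_run m n As d \<beta> v) = x"
    using upper_input[OF m_pos As perm W v refl] p0 by simp
  ultimately show ?thesis using v by blast
qed

end

section \<open>Selecting and placing blocks with Kronecker products\<close>

lemma sum_blocks: "(\<Sum>j<m * n. f j) = (\<Sum>q<m. \<Sum>l<n. f (q * n + l :: nat))"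
proof -
  have "(\<Sum>j<m * n. f j) = (\<Sum>q<m. sum f {q * n..<q * n + n})"
    by (rule sum.nat_group[symmetric])
  also have "\<dots> = (\<Sum>q<m. \<Sum>l<n. f (q * n + l))"
  proof (rule sum.cong[OF refl])
    fix q
    show "sum f {q * n..<q * n + n} = (\<Sum>l<n. f (q * n + l))"
      using sum.shift_bounds_nat_ivl[of f 0 "q * n" n] by (simp add: atLeast0LessThan add.commute)
  qed
  finally show ?thesis .
qed

lemma e_col_index: "q < m \<Longrightarrow> k < m \<Longrightarrow> e_col m (m - k) $$ (q, 0) = (if q = m - 1 - k then 1 else 0)"
  by (simp add: e_col_def mat_of_cols_index)

lemma dim_e_col [simp]: "dim_row (e_col m j) = m" "dim_col (e_col m j) = 1"
  by (simp_all add: e_col_def)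

lemma kronecker_select:
  assumes k: "k < m" and B: "B \<in> carrier_mat r n" and v: "v \<in> carrier_vec (m * n)"
  shows "(transpose_mat (e_col m (m - k)) \<otimes>\<^sub>k B) *\<^sub>v v = B *\<^sub>v blk m n k v"
proof (rule eq_vecI)
  let ?K = "transpose_mat (e_col m (m - k)) \<otimes>\<^sub>k B"
  have K: "?K \<in> carrier_mat r (m * n)" using B by (intro carrier_matI) (simp_all add: kronecker_def)
  then show "dim_vec (?K *\<^sub>v v) = dim_vec (B *\<^sub>v blk m n k v)" using B by simp
  fix i assume "i < dim_vec (B *\<^sub>v blk m n k v)"
  then have i: "i < r" using B by simp
  have entry: "?K $$ (i, q * n + l) = (if q = m - 1 - k then B $$ (i, l) else 0)"
    if "q < m" "l < n" for q l
  proof -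
    have "q * n + l < m * n" using block_index_less[of "m - 1 - q" m l n] that by simp
    then show ?thesis using B i that k by (simp add: kronecker_def e_col_index)
  qed
  have "(?K *\<^sub>v v) $ i = (\<Sum>j<m * n. ?K $$ (i, j) * v $ j)"
    using K v i by (simp add: scalar_prod_def atLeast0LessThan)
  also have "\<dots> = (\<Sum>q<m. \<Sum>l<n. ?K $$ (i, q * n + l) * v $ (q * n + l))" by (rule sum_blocks)
  also have "\<dots> = (\<Sum>q<m. if q = m - 1 - k then \<Sum>l<n. B $$ (i, l) * v $ (q * n + l) else 0)"
    by (intro sum.cong refl) (simp add: entry)
  also have "\<dots> = (\<Sum>l<n. B $$ (i, l) * v $ ((m - 1 - k) * n + l))"
    using k by (simp add: sum.delta)
  also have "\<dots> = (B *\<^sub>v blk m n k v) $ i"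
    using B i by (simp add: scalar_prod_def atLeast0LessThan blk_def)
  finally show "(?K *\<^sub>v v) $ i = (B *\<^sub>v blk m n k v) $ i" .
qed

lemma kronecker_place:
  assumes k: "k < m" and C: "C \<in> carrier_mat n r" and y: "y \<in> carrier_vec r"
  shows "(e_col m (m - k) \<otimes>\<^sub>k C) *\<^sub>v y = place m n k (C *\<^sub>v y)"
proof (rule eq_vecI)
  let ?K = "e_col m (m - k) \<otimes>\<^sub>k C"
  have K: "?K \<in> carrier_mat (m * n) r" using C by (intro carrier_matI) (simp_all add: kronecker_def)
  then show "dim_vec (?K *\<^sub>v y) = dim_vec (place m n k (C *\<^sub>v y))" by (simp add: place_def)
  fix i assume "i < dim_vec (place m n k (C *\<^sub>v y))"
  then have i: "i < m * n" by (simp add: place_def)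
  then have n: "0 < n" and iq: "i div n < m" by (auto intro: Nat.gr0I simp: less_mult_imp_div_less)
  have entry: "?K $$ (i, j) = (if i div n = m - 1 - k then C $$ (i mod n, j) else 0)" if "j < r" for j
    using that i iq k C by (simp add: kronecker_def e_col_index)
  have "(?K *\<^sub>v y) $ i = (\<Sum>j<r. ?K $$ (i, j) * y $ j)"
    using K y i by (simp add: scalar_prod_def atLeast0LessThan)
  also have "\<dots> = (if i div n = m - 1 - k then \<Sum>j<r. C $$ (i mod n, j) * y $ j else 0)"
    by (simp add: entry)
  also have "\<dots> = place m n k (C *\<^sub>v y) $ i"
    using C y i n by (simp add: place_def scalar_prod_def atLeast0LessThan)
  finally show "(?K *\<^sub>v y) $ i = place m n k (C *\<^sub>v y) $ i" .
qed

text \<open>The elementary matrices of \<open>\<tau>_1\<close> and \<open>\<tau>_2\<close> do not meet block \<open>k\<close> if \<open>k \<in> \<sigma>\<close>.  The index \<open>-(k+1)\<close>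
  would, but it occurs in \<open>\<tau>\<close> already, so by the SIP its successor \<open>-k\<close> would have to be an index of
  \<open>\<tau>\<close> as well.\<close>
lemma SIP_Neg_no_successor:
  assumes "SIP (map (shift m) (map Neg (\<rho>1 @ \<omega> @ \<rho>2)))"
    and sub: "set \<rho>1 \<subseteq> set \<omega>" "set \<rho>2 \<subseteq> set \<omega>" "set \<omega> \<subseteq> {..m}" and k: "k \<notin> set \<omega>" "k < m"
  shows "Suc k \<notin> set \<rho>1" and "Suc k \<notin> set \<rho>2"
proof -
  let ?s = "\<lambda>j. m - j"
  have sip: "SIP (map ?s (\<rho>1 @ \<omega> @ \<rho>2))"
  proof -
    have "shift m \<circ> Neg = ?s" by auto
    then show ?thesis using assms(1) by simp
  qed
  have no: False if "SIP (map ?s (a @ Suc k # b @ Suc k # c))" "set b \<subseteq> set \<omega>" for a b c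
  proof -
    have "Suc (m - Suc k) \<in> set (map ?s b)"
      using SIP_between[of "map ?s a" "m - Suc k" "map ?s b" "map ?s c"] that(1) by simp
    then obtain j where j: "j \<in> set b" "m - j = Suc (m - Suc k)" by auto
    then have "j \<le> m" using that(2) sub(3) by auto
    then have "j = k" using j(2) k(2) by simp
    then show False using j(1) that(2) k(1) by auto
  qed
  show "Suc k \<notin> set \<rho>1"
  proof
    assume "Suc k \<in> set \<rho>1"
    then obtain a b c d where "\<rho>1 = a @ Suc k # b" "\<omega> = c @ Suc k # d"
      using sub(1) by (meson split_list subsetD)
    then show False using no[of a "b @ c" "d @ \<rho>2"] sip sub(1) by auto
  qed
  show "Suc k \<notin> set \<rho>2"
  proof
    assume "Suc k \<in> set \<rho>2"
    then obtain a b c d where "\<rho>2 = a @ Suc k # b" "\<omega> = c @ Suc k # d"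
      using sub(2) by (meson split_list subsetD)
    then show False using no[of "\<rho>1 @ c" "d @ a" b] sip sub(2) by auto
  qed
qed

section \<open>The null space of an EGFP\<close>

text \<open>The tuples are cut at \<open>0 \<in> \<sigma>\<close>, where \<open>C y\<close> enters the circuit and the selected block is read
  off, and at \<open>-m \<in> \<tau>\<close>, the only factor of \<open>M_\<tau>\<close> that stays on its side of the pencil.\<close>
locale egfp =
  fixes m n r :: nat and As :: "nat \<Rightarrow> complex mat" and A E B C :: "complex mat"
    and \<sigma> \<omega> \<sigma>1 \<sigma>2 :: "nat list" and \<tau> \<tau>1 \<tau>2 :: "sindex list"
    and X1 X2 Y1 Y2 :: "complex mat list"
    and \<sigma>l \<sigma>r \<omega>l \<omega>r \<rho>1 \<rho>2 :: "nat list"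
  assumes m_pos: "0 < m" and As: "\<forall>i \<le> m. As i \<in> carrier_mat n n"
    and A: "A \<in> carrier_mat r r" and E: "E \<in> carrier_mat r r"
    and C: "C \<in> carrier_mat n r" and B: "B \<in> carrier_mat r n"
    and data: "EGFP_data m n \<sigma> \<omega> \<tau> \<sigma>1 \<sigma>2 \<tau>1 \<tau>2 X1 X2 Y1 Y2"
    and sigma_split: "\<sigma> = \<sigma>l @ 0 # \<sigma>r" and omega_split: "\<omega> = \<omega>l @ m # \<omega>r"
    and tau_lists: "\<tau>1 = map Neg \<rho>1" "\<tau>2 = map Neg \<rho>2"
begin

abbreviation "N \<equiv> m * n"

lemma perm: "distinct (\<sigma> @ \<omega>)" "set (\<sigma> @ \<omega>) = {0..m}" and tau: "\<tau> = map Neg \<omega>"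
  using data by (auto simp: EGFP_data_def)

lemma sigma_less: "set \<sigma> \<subseteq> {..<m}"
proof
  fix i assume i: "i \<in> set \<sigma>"
  have "m \<in> set \<omega>" unfolding omega_split by simp
  then have "i \<noteq> m" using i perm(1) by auto
  moreover have "i \<in> set (\<sigma> @ \<omega>)" using i by simp
  then have "i \<le> m" unfolding perm(2) by simp
  ultimately show "i \<in> {..<m}" by simp
qed

lemma zero_mem: "0 \<in> set \<sigma>"
  unfolding sigma_split by simp

lemma omega_bounds: "i \<in> set \<omega> \<Longrightarrow> 0 < i \<and> i \<le> m \<and> i \<notin> set \<sigma>"
proof -
  assume i: "i \<in> set \<omega>"
  then have "i \<notin> set \<sigma>" using perm(1) by auto
  moreover have "i \<in> set (\<sigma> @ \<omega>)" using i by simp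
  then have "i \<le> m" unfolding perm(2) by simp
  ultimately show ?thesis using zero_mem by (cases "i = 0") auto
qed

lemma omega_lr_bounds: "i \<in> set \<omega>l \<union> set \<omega>r \<Longrightarrow> 0 < i \<and> i < m"
proof -
  assume i: "i \<in> set \<omega>l \<union> set \<omega>r"
  have "distinct \<omega>" using perm(1) by simp
  then have "i \<noteq> m" using i unfolding omega_split by auto
  moreover have "i \<in> set \<omega>" using i unfolding omega_split by auto
  ultimately show ?thesis using omega_bounds[of i] by auto
qed

lemma zero_not_lr: "0 \<notin> set \<sigma>l" "0 \<notin> set \<sigma>r"
proof -
  have "distinct \<sigma>" using perm(1) by simp
  then show "0 \<notin> set \<sigma>l" "0 \<notin> set \<sigma>r" unfolding sigma_split by auto
qed

text \<open>The permutation \<open>(\<alpha>, 0, \<beta>)\<close> of \<open>{0..m-1}\<close> belongs to the Fiedler pencil that is left when the factors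
  of \<open>M_\<tau>\<close> around \<open>M_{-m}\<close> are moved to the other term.\<close>
definition "\<alpha> = rev \<omega>l @ \<sigma>l"
definition "\<beta> = \<sigma>r @ rev \<omega>r"

lemma fiedler_perm: "distinct (\<alpha> @ 0 # \<beta>)" "set (\<alpha> @ 0 # \<beta>) = {..<m}"
proof -
  have d: "distinct ((\<sigma>l @ 0 # \<sigma>r) @ \<omega>l @ m # \<omega>r)"
    using perm(1) unfolding sigma_split omega_split .
  then show "distinct (\<alpha> @ 0 # \<beta>)" by (auto simp: \<alpha>_def \<beta>_def)
  have s: "set ((\<sigma>l @ 0 # \<sigma>r) @ \<omega>l @ m # \<omega>r) = {0..m}"
    using perm(2) unfolding sigma_split omega_split .
  have "set (\<alpha> @ 0 # \<beta>) = set ((\<sigma>l @ 0 # \<sigma>r) @ \<omega>l @ m # \<omega>r) - {m}"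
    using d m_pos by (auto simp: \<alpha>_def \<beta>_def)
  moreover have "{0..m} - {m} = {..<m}" by auto
  ultimately show "set (\<alpha> @ 0 # \<beta>) = {..<m}" unfolding s by simp
qed

lemma rho: "\<tau>1 = map Neg \<rho>1" "set \<rho>1 \<subseteq> set \<omega>" "\<tau>2 = map Neg \<rho>2" "set \<rho>2 \<subseteq> set \<omega>"
  using data tau_lists tau by (auto simp: EGFP_data_def)

lemma As_carrier: "i \<le> m \<Longrightarrow> As i \<in> carrier_mat n n"
  using As by simp

lemma Pos_ok: "set \<rho> \<subseteq> {..<m} \<Longrightarrow> t \<in> set (map Pos \<rho>) \<Longrightarrow> index_ok m t"
  by (auto simp: index_ok_def)

lemma Neg_ok: "set \<rho> \<subseteq> set \<omega> \<Longrightarrow> t \<in> set (map Neg \<rho>) \<Longrightarrow> index_ok m t"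
  using omega_bounds by (auto simp: index_ok_def)

lemma subtuples: "set \<sigma>1 \<subseteq> set \<sigma>" "set \<sigma>2 \<subseteq> set \<sigma>" "set \<sigma>l \<subseteq> set \<sigma>" "set \<sigma>r \<subseteq> set \<sigma>"
  "set \<omega>l \<subseteq> set \<omega>" "set \<omega>r \<subseteq> set \<omega>"
  using data unfolding EGFP_data_def by (auto simp: sigma_split omega_split)

lemma assignments:
  "assignment_ok m n (map Pos \<sigma>1) X1" "assignment_ok m n (map Pos \<sigma>2) X2"
  "assignment_ok m n \<tau>1 Y1" "assignment_ok m n \<tau>2 Y2"
  using data subtuples(1,2) sigma_less Pos_ok[of \<sigma>1] Pos_ok[of \<sigma>2] Neg_ok[OF rho(2)] Neg_ok[OF rho(4)]
  unfolding assignment_ok_iff EGFP_data_def nonsingular_assignment_def rho(1,3)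
  by (auto simp del: set_map)

lemma P_assignments:
  assumes "set \<rho> \<subseteq> set \<sigma>"
  shows "assignment_ok m n (map Pos \<rho>) (map (coeff_assign As) (map Pos \<rho>))"
  by (rule coeff_assignment_ok[OF Pos_ok As_carrier]) (use assms sigma_less in auto)

definition "left_factor v = elem_prod m n \<tau>1 Y1 *\<^sub>v (elem_prod m n (map Pos \<sigma>1) X1 *\<^sub>v v)"
definition "right_factor v = elem_prod m n (map Pos \<sigma>2) X2 *\<^sub>v (elem_prod m n \<tau>2 Y2 *\<^sub>v v)"

lemma left_factor_bij: "bij_betw left_factor (carrier_vec N) (carrier_vec N)"
proof -
  have "bij_betw ((\<lambda>v. elem_prod m n \<tau>1 Y1 *\<^sub>v v) \<circ> (\<lambda>v. elem_prod m n (map Pos \<sigma>1) X1 *\<^sub>v v))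
      (carrier_vec N) (carrier_vec N)"
    by (rule bij_betw_trans[OF elem_prod_bij[OF assignments(1)] elem_prod_bij[OF assignments(3)]])
      (use data in \<open>auto simp: EGFP_data_def\<close>)
  moreover have "(\<lambda>v. elem_prod m n \<tau>1 Y1 *\<^sub>v v) \<circ> (\<lambda>v. elem_prod m n (map Pos \<sigma>1) X1 *\<^sub>v v) = left_factor"
    by (auto simp: left_factor_def)
  ultimately show ?thesis by simp
qed

lemma right_factor_bij: "bij_betw right_factor (carrier_vec N) (carrier_vec N)"
proof -
  have "bij_betw ((\<lambda>v. elem_prod m n (map Pos \<sigma>2) X2 *\<^sub>v v) \<circ> (\<lambda>v. elem_prod m n \<tau>2 Y2 *\<^sub>v v))
      (carrier_vec N) (carrier_vec N)"
    by (rule bij_betw_trans[OF elem_prod_bij[OF assignments(4)] elem_prod_bij[OF assignments(2)]])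
      (use data in \<open>auto simp: EGFP_data_def\<close>)
  moreover have "(\<lambda>v. elem_prod m n (map Pos \<sigma>2) X2 *\<^sub>v v) \<circ> (\<lambda>v. elem_prod m n \<tau>2 Y2 *\<^sub>v v) = right_factor"
    by (auto simp: right_factor_def)
  ultimately show ?thesis by simp
qed

text \<open>The numbers \<open>c_0(\<sigma>, \<sigma>_2)\<close> and \<open>i_0(\<sigma>_1, \<sigma>)\<close>, as block positions.\<close>
definition "row_index = climb (\<sigma> @ \<sigma>2) - 1"
definition "col_index = climb (rev (\<sigma>1 @ \<sigma>)) - 1"

lemma climb_pos: "0 < climb (\<sigma> @ \<sigma>2)" "0 < climb (rev (\<sigma>1 @ \<sigma>))"
  using zero_mem by (simp_all flip: mem_0_iff_climb_pos)

lemma row_index_mem: "row_index \<in> set \<sigma>"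
  unfolding row_index_def using climb_last_mem[OF climb_pos(1)] subtuples(2) by auto

lemma col_index_mem: "col_index \<in> set \<sigma>"
  unfolding col_index_def using climb_last_mem[OF climb_pos(2)] subtuples(1) by auto

lemma index_less: "row_index < m" "col_index < m"
  using row_index_mem col_index_mem sigma_less by auto

lemma consecutions_row: "nat (int m - consecutions 0 (\<sigma> @ \<sigma>2)) = m - row_index"
  unfolding consecutions_0 row_index_def using climb_pos(1) by simp

lemma inversions_col: "nat (int m - inversions 0 (\<sigma>1 @ \<sigma>)) = m - col_index"
  unfolding inversions_0 col_index_def using climb_pos(2) by simp

lemma no_tau_index:
  assumes k: "k \<in> set \<sigma>"
  shows "k \<notin> set \<rho>1" "Suc k \<notin> set \<rho>1" "k \<notin> set \<rho>2" "Suc k \<notin> set \<rho>2"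
proof -
  have k\<omega>: "k \<notin> set \<omega>" and km: "k < m" using k perm(1) sigma_less by auto
  then show "k \<notin> set \<rho>1" "k \<notin> set \<rho>2" using rho by auto
  have sip: "SIP (map (shift m) (map Neg (\<rho>1 @ \<omega> @ \<rho>2)))"
    using data tau rho(1,3) by (simp add: EGFP_data_def)
  have "set \<omega> \<subseteq> {..m}" using omega_bounds by auto
  from SIP_Neg_no_successor[OF sip rho(2,4) this k\<omega> km]
  show "Suc k \<notin> set \<rho>1" "Suc k \<notin> set \<rho>2" by auto
qed

lemma SIP_sigma: "SIP (\<sigma>1 @ \<sigma> @ \<sigma>2)"
  using data by (simp add: EGFP_data_def)

text \<open>The selected block of \<open>x\<close> is the block with which the circuit enters the gate with index \<open>0\<close>.\<close>
lemma row_index_select: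
  assumes v: "v \<in> carrier_vec N"
  shows "blk m n row_index v = blk m n 0 (elem_prod_P m n As (map Pos \<sigma>r) *\<^sub>v right_factor v)"
proof -
  let ?w = "elem_prod m n \<tau>2 Y2 *\<^sub>v v"
  let ?P = "map (coeff_assign As) (map Pos \<sigma>r)"
  have w: "?w \<in> carrier_vec N" by (rule elem_prod_vec_carrier[OF assignments(4) v])
  have ok: "assignment_ok m n (map Pos (\<sigma>r @ \<sigma>2)) (?P @ X2)"
    using assignment_ok_append[OF P_assignments[OF subtuples(4)] assignments(2)] by simp
  have "SIP ((\<sigma>l @ [0]) @ \<sigma>r @ \<sigma>2)"
    using SIP_infix[of \<sigma>1 "\<sigma> @ \<sigma>2" "[]"] SIP_sigma by (simp add: sigma_split)
  moreover have c1: "climb (\<sigma>l @ [0]) = 1"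
    using climb_append_no_0[OF zero_not_lr(1), of "[0]"] climb_snoc[of "[]" 0] by simp
  moreover have "set (\<sigma>l @ [0]) \<subseteq> {..<m}" using subtuples(3) sigma_less m_pos by auto
  ultimately have "blk m n 0 (elem_prod m n (map Pos (\<sigma>r @ \<sigma>2)) (?P @ X2) *\<^sub>v ?w) =
      blk m n (climb ((\<sigma>l @ [0]) @ \<sigma>r @ \<sigma>2) - 1) ?w"
    using blk_elem_prod_climb[OF ok, of "\<sigma>l @ [0]" ?w] w by simp
  also have "(\<sigma>l @ [0]) @ \<sigma>r @ \<sigma>2 = \<sigma> @ \<sigma>2" by (simp add: sigma_split)
  also have "blk m n (climb (\<sigma> @ \<sigma>2) - 1) ?w = blk m n row_index v"
    unfolding row_index_def[symmetric] using no_tau_index[OF row_index_mem] index_less(1) v assignments(4)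
    unfolding rho(3) by (intro blk_elem_prod_Neg)
  also have "elem_prod m n (map Pos (\<sigma>r @ \<sigma>2)) (?P @ X2) *\<^sub>v ?w =
      elem_prod_P m n As (map Pos \<sigma>r) *\<^sub>v right_factor v"
    unfolding map_append right_factor_def elem_prod_P_def
    by (rule elem_prod_append_vec[OF P_assignments[OF subtuples(4)] assignments(2) w])
  finally show ?thesis by simp
qed

text \<open>The column block \<open>e_{m-i_0(\<sigma>_1,\<sigma>)} \<otimes> C\<close> arises from \<open>e_m \<otimes> C\<close>, placed at the output of the gate with
  index \<open>0\<close>, by the factors to the left of that gate.\<close>
lemma col_index_place:
  assumes c: "c \<in> carrier_vec n"
  shows "left_factor (elem_prod_P m n As (map Pos \<sigma>l) *\<^sub>v place m n 0 c) = place m n col_index c"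
proof -
  let ?P = "map (coeff_assign As) (map Pos \<sigma>l)"
  have ok: "assignment_ok m n (map Pos (\<sigma>1 @ \<sigma>l)) (X1 @ ?P)"
    using assignment_ok_append[OF assignments(1) P_assignments[OF subtuples(3)]] by simp
  have "SIP ((\<sigma>1 @ \<sigma>l) @ 0 # \<sigma>r)"
    using SIP_infix[of "[]" "\<sigma>1 @ \<sigma>" \<sigma>2] SIP_sigma by (simp add: sigma_split)
  moreover have c1: "climb (rev (0 # \<sigma>r)) = 1"
    using climb_append_no_0[of "rev \<sigma>r" "[0]"] zero_not_lr(2) climb_snoc[of "[]" 0] by simp
  moreover have "set ((\<sigma>1 @ \<sigma>l) @ 0 # \<sigma>r) \<subseteq> {..<m}" using subtuples sigma_less m_pos by auto
  ultimately have "elem_prod m n (map Pos (\<sigma>1 @ \<sigma>l)) (X1 @ ?P) *\<^sub>v place m n 0 c =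
      place m n (climb (rev ((\<sigma>1 @ \<sigma>l) @ 0 # \<sigma>r)) - 1) c"
    using elem_prod_place_climb[OF ok, of "0 # \<sigma>r" c] c by simp
  also have "(\<sigma>1 @ \<sigma>l) @ 0 # \<sigma>r = \<sigma>1 @ \<sigma>" by (simp add: sigma_split)
  also have "elem_prod m n (map Pos (\<sigma>1 @ \<sigma>l)) (X1 @ ?P) *\<^sub>v place m n 0 c =
      elem_prod m n (map Pos \<sigma>1) X1 *\<^sub>v (elem_prod_P m n As (map Pos \<sigma>l) *\<^sub>v place m n 0 c)"
    unfolding map_append elem_prod_P_def
    by (rule elem_prod_append_vec[OF assignments(1) P_assignments[OF subtuples(3)] place_carrier])
  finally show ?thesis
    unfolding left_factor_def col_index_def[symmetric]
    using elem_prod_Neg_place[of m n \<rho>1 Y1 col_index c] no_tau_index[OF col_index_mem] index_less(2) c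
      assignments(3) unfolding rho(1) by simp
qed

end

lemma append_vec_zero: "0\<^sub>v a @\<^sub>v 0\<^sub>v b = (0\<^sub>v (a + b) :: complex vec)"
  by (intro eq_vecI) auto

lemma mult_mat_vec_uminus:
  fixes M :: "complex mat"
  assumes "M \<in> carrier_mat a b" "v \<in> carrier_vec b"
  shows "M *\<^sub>v (- v) = - (M *\<^sub>v v)"
  using assms by (intro eq_vecI) auto

lemma smult_mat_vec_assoc:
  fixes M :: "complex mat"
  assumes "M \<in> carrier_mat a b" "v \<in> carrier_vec b"
  shows "(z \<cdot>\<^sub>m M) *\<^sub>v v = z \<cdot>\<^sub>v (M *\<^sub>v v)"
  using assms by (intro eq_vecI) auto

lemma zero_mat_mult_vec: "v \<in> carrier_vec b \<Longrightarrow> 0\<^sub>m a b *\<^sub>v v = (0\<^sub>v a :: complex vec)"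
  by (intro eq_vecI) auto

lemma vec_balance:
  fixes a b c :: "complex vec"
  assumes "a \<in> carrier_vec n" "b \<in> carrier_vec n" "c \<in> carrier_vec n"
  shows "a - b + c = 0\<^sub>v n \<longleftrightarrow> a = b + - c"
proof -
  have "a $ i - b $ i + c $ i = 0 \<longleftrightarrow> a $ i = b $ i + - c $ i" for i by (auto simp: algebra_simps)
  then show ?thesis using assms by (auto simp: vec_eq_iff)
qed

lemma four_block_kernel:
  fixes P :: "complex mat"
  assumes P: "P \<in> carrier_mat a b" and Q: "Q \<in> carrier_mat a r" and R: "R \<in> carrier_mat r b"
    and D: "D \<in> carrier_mat r r" and x: "x \<in> carrier_vec b" and y: "y \<in> carrier_vec r"
  shows "x @\<^sub>v y \<in> mat_kernel (four_block_mat P Q R D) \<longleftrightarrow>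
    P *\<^sub>v x + Q *\<^sub>v y = 0\<^sub>v a \<and> R *\<^sub>v x + D *\<^sub>v y = 0\<^sub>v r"
proof -
  have F: "four_block_mat P Q R D \<in> carrier_mat (a + r) (b + r)"
    using four_block_carrier_mat[OF P D] .
  have "P *\<^sub>v x + Q *\<^sub>v y \<in> carrier_vec a" "R *\<^sub>v x + D *\<^sub>v y \<in> carrier_vec r"
    using P Q R D x y by auto
  then show ?thesis
    unfolding mat_kernel[OF F] mem_Collect_eq four_block_mat_mult_vec[OF P Q R D x y]
      append_vec_zero[symmetric]
    using x y by (subst append_vec_eq) auto
qed

context egfp
begin

lemma P_vec_carrier:
  assumes "v \<in> carrier_vec N"
  shows "set \<rho> \<subseteq> {..<m} \<Longrightarrow> elem_prod_P m n As (map Pos \<rho>) *\<^sub>v v \<in> carrier_vec N"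
    and "set \<rho> \<subseteq> set \<omega> \<Longrightarrow> elem_prod_P m n As (map Neg \<rho>) *\<^sub>v v \<in> carrier_vec N"
  by (rule elem_prod_P_vec_carrier[OF _ As_carrier assms]; use Pos_ok Neg_ok in blast)+

lemma omega_r_sub: "set (rev \<omega>l) \<subseteq> {..<m}" "set (rev \<omega>r) \<subseteq> {..<m}"
  "0 \<notin> set (rev \<omega>l)" "0 \<notin> set (rev \<omega>r)"
  using omega_lr_bounds by auto

lemma cancel_omega_l:
  assumes "v \<in> carrier_vec N"
  shows "elem_prod_P m n As (map Pos (rev \<omega>l)) *\<^sub>v (elem_prod_P m n As (map Neg \<omega>l) *\<^sub>v v) = v"
    and "elem_prod_P m n As (map Neg \<omega>l) *\<^sub>v (elem_prod_P m n As (map Pos (rev \<omega>l)) *\<^sub>v v) = v"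
  by (rule elem_prod_P_cancel[OF As_carrier _ assms]; use omega_lr_bounds in auto)+

lemma cancel_omega_r:
  assumes "v \<in> carrier_vec N"
  shows "elem_prod_P m n As (map Pos (rev \<omega>r)) *\<^sub>v (elem_prod_P m n As (map Neg \<omega>r) *\<^sub>v v) = v"
    and "elem_prod_P m n As (map Neg \<omega>r) *\<^sub>v (elem_prod_P m n As (map Pos (rev \<omega>r)) *\<^sub>v v) = v"
  by (rule elem_prod_P_cancel[OF As_carrier _ assms]; use omega_lr_bounds in auto)+

lemma tau_vec:
  assumes v: "v \<in> carrier_vec N"
  shows "elem_prod_P m n As \<tau> *\<^sub>v v = elem_prod_P m n As (map Neg \<omega>l) *\<^sub>v
    (elem_mat m n (Neg m) (As m) *\<^sub>v (elem_prod_P m n As (map Neg \<omega>r) *\<^sub>v v))"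
proof -
  have ok: "index_ok m t" if "t \<in> set (map Neg \<omega>)" for t by (rule Neg_ok[OF order_refl that])
  have t: "\<tau> = map Neg \<omega>l @ Neg m # map Neg \<omega>r" unfolding tau omega_split by simp
  have "elem_prod_P m n As \<tau> *\<^sub>v v = elem_prod_P m n As (map Neg \<omega>l) *\<^sub>v
      (elem_prod_P m n As (Neg m # map Neg \<omega>r) *\<^sub>v v)"
    unfolding t by (rule elem_prod_P_append_vec[OF _ As_carrier v]) (use ok omega_split in auto)
  also have "elem_prod_P m n As (Neg m # map Neg \<omega>r) *\<^sub>v v =
      elem_mat m n (Neg m) (coeff_assign As (Neg m)) *\<^sub>v (elem_prod_P m n As (map Neg \<omega>r) *\<^sub>v v)"
    by (rule elem_prod_P_Cons_vec[OF _ As_carrier v]) (use ok omega_split in auto)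
  finally show ?thesis by simp
qed

lemma run_no_0:
  assumes "0 \<notin> set \<rho>" "set \<rho> \<subseteq> {..<m}" "v \<in> carrier_vec N"
  shows "affine_run m n As d \<rho> v = elem_prod_P m n As (map Pos \<rho>) *\<^sub>v v"
  by (rule affine_run_no_0[OF m_pos As_carrier assms])

lemma sigma_lr_sub: "set \<sigma>l \<subseteq> {..<m}" "set \<sigma>r \<subseteq> {..<m}"
  using subtuples sigma_less by auto

text \<open>The factors \<open>M_{-i}\<close> to the left of \<open>M_{-m}\<close> are cancelled by multiplying the equation with their
  inverses, those to the right by the substitution \<open>w = M_{-\<omega>_r} v\<close>.\<close>
lemma pencil_reduction:
  assumes v: "v \<in> carrier_vec N" and w: "w = elem_prod_P m n As (map Neg \<omega>r) *\<^sub>v v"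
  shows "\<mu> \<cdot>\<^sub>v (elem_prod_P m n As \<tau> *\<^sub>v v) = affine_run m n As d \<sigma> v \<longleftrightarrow>
      \<mu> \<cdot>\<^sub>v (elem_mat m n (Neg m) (As m) *\<^sub>v w) = affine_run m n As d (\<alpha> @ 0 # \<beta>) w"
    and "blk m n 0 (affine_run m n As d \<beta> w) = blk m n 0 (elem_prod_P m n As (map Pos \<sigma>r) *\<^sub>v v)"
proof -
  let ?L = "elem_prod_P m n As (map Neg \<omega>l)" and ?R = "elem_prod_P m n As (map Pos (rev \<omega>l))"
  let ?z = "elem_mat m n (Neg m) (As m) *\<^sub>v w"
  let ?u = "affine_run m n As d \<sigma> v"
  have wc: "w \<in> carrier_vec N" unfolding w by (rule P_vec_carrier(2)[OF v subtuples(6)])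
  have z: "?z \<in> carrier_vec N"
    by (rule elem_mat_vec_carrier[OF _ As_carrier wc]) (use m_pos in \<open>auto simp: index_ok_def\<close>)
  have u: "?u \<in> carrier_vec N" by (rule affine_run_carrier[OF m_pos As_carrier sigma_less v])
  have L: "?L \<in> carrier_mat N N" and R: "?R \<in> carrier_mat N N"
    by (rule elem_prod_P_carrier[OF _ As_carrier];
        use Neg_ok[OF subtuples(5)] Pos_ok[OF omega_r_sub(1)] in blast)+
  have rw: "affine_run m n As d (rev \<omega>r) w = v"
    using run_no_0[OF omega_r_sub(4,2) wc] cancel_omega_r(1)[OF v] w by simp
  have "affine_run m n As d (\<alpha> @ 0 # \<beta>) w = affine_run m n As d (rev \<omega>l) ?u"
    unfolding \<alpha>_def \<beta>_def by (subst sigma_split) (simp add: rw)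
  then have run: "affine_run m n As d (\<alpha> @ 0 # \<beta>) w = ?R *\<^sub>v ?u"
    unfolding run_no_0[OF omega_r_sub(3,1) u] .
  have tau_v: "elem_prod_P m n As \<tau> *\<^sub>v v = ?L *\<^sub>v ?z" unfolding tau_vec[OF v] w ..
  show "\<mu> \<cdot>\<^sub>v (elem_prod_P m n As \<tau> *\<^sub>v v) = ?u \<longleftrightarrow>
      \<mu> \<cdot>\<^sub>v ?z = affine_run m n As d (\<alpha> @ 0 # \<beta>) w"
    unfolding tau_v run
  proof
    assume e: "\<mu> \<cdot>\<^sub>v (?L *\<^sub>v ?z) = ?u"
    have "?R *\<^sub>v (\<mu> \<cdot>\<^sub>v (?L *\<^sub>v ?z)) = \<mu> \<cdot>\<^sub>v (?R *\<^sub>v (?L *\<^sub>v ?z))"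
      by (rule mult_mat_vec[OF R]) (use L z in simp)
    then show "\<mu> \<cdot>\<^sub>v ?z = ?R *\<^sub>v ?u" unfolding e cancel_omega_l(1)[OF z] by simp
  next
    assume e: "\<mu> \<cdot>\<^sub>v ?z = ?R *\<^sub>v ?u"
    have "?L *\<^sub>v (\<mu> \<cdot>\<^sub>v ?z) = \<mu> \<cdot>\<^sub>v (?L *\<^sub>v ?z)" by (rule mult_mat_vec[OF L z])
    then show "\<mu> \<cdot>\<^sub>v (?L *\<^sub>v ?z) = ?u" unfolding e cancel_omega_l(2)[OF u] by simp
  qed
  show "blk m n 0 (affine_run m n As d \<beta> w) = blk m n 0 (elem_prod_P m n As (map Pos \<sigma>r) *\<^sub>v v)"
    unfolding \<beta>_def by (simp add: rw run_no_0[OF zero_not_lr(2) sigma_lr_sub(2) v])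
qed

lemma right_factor_carrier: "v \<in> carrier_vec N \<Longrightarrow> right_factor v \<in> carrier_vec N"
  using right_factor_bij by (rule bij_betw_apply)

lemma P_carrier: "elem_prod_P m n As (map Pos \<sigma>) \<in> carrier_mat N N" "elem_prod_P m n As \<tau> \<in> carrier_mat N N"
  by (rule elem_prod_P_carrier[OF _ As_carrier];
      use Pos_ok[OF sigma_less] Neg_ok[OF order_refl] tau in blast)+

lemma left_factor_add:
  assumes "v \<in> carrier_vec N" "w \<in> carrier_vec N"
  shows "left_factor (v + w) = left_factor v + left_factor w"
  unfolding left_factor_def
    mult_add_distrib_mat_vec[OF elem_prod_carrier[OF assignments(1)] assms]
  by (rule mult_add_distrib_mat_vec[OF elem_prod_carrier[OF assignments(3)]
        elem_prod_vec_carrier[OF assignments(1) assms(1)] elem_prod_vec_carrier[OF assignments(1) assms(2)]])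

lemma left_factor_eq_0: "v \<in> carrier_vec N \<Longrightarrow> left_factor v = 0\<^sub>v N \<longleftrightarrow> v = 0\<^sub>v N"
proof -
  assume v: "v \<in> carrier_vec N"
  have "left_factor (0\<^sub>v N) = 0\<^sub>v N"
    unfolding left_factor_def
    using elem_prod_carrier[OF assignments(1)] elem_prod_carrier[OF assignments(3)] by simp
  then show ?thesis
    using left_factor_bij v by (metis bij_betw_imp_inj_on inj_onD zero_carrier_vec)
qed

abbreviation "L \<equiv> EGFP_P m n As \<sigma> \<tau> \<sigma>1 \<sigma>2 \<tau>1 \<tau>2 X1 X2 Y1 Y2"

lemma L_carrier: "L z \<in> carrier_mat N N"
  unfolding EGFP_P_def
  by (intro mult_carrier_mat[of _ N N] minus_carrier_mat elem_prod_carrier assignments P_carrier(1))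

lemma L_vec:
  assumes x: "x \<in> carrier_vec N"
  shows "L z *\<^sub>v x = left_factor (z \<cdot>\<^sub>v (elem_prod_P m n As \<tau> *\<^sub>v right_factor x) -
    elem_prod_P m n As (map Pos \<sigma>) *\<^sub>v right_factor x)"
proof -
  note cs = elem_prod_carrier[OF assignments(1)] elem_prod_carrier[OF assignments(2)]
    elem_prod_carrier[OF assignments(3)] elem_prod_carrier[OF assignments(4)]
  let ?D = "z \<cdot>\<^sub>m elem_prod_P m n As \<tau> - elem_prod_P m n As (map Pos \<sigma>)"
  have D: "?D \<in> carrier_mat N N" by (rule minus_carrier_mat[OF P_carrier(1)])
  note xr = right_factor_carrier[OF x]
  have KD: "elem_prod m n \<tau>1 Y1 * elem_prod m n (map Pos \<sigma>1) X1 * ?D \<in> carrier_mat N N"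
    using cs D by simp
  have "L z *\<^sub>v x = elem_prod m n \<tau>1 Y1 * elem_prod m n (map Pos \<sigma>1) X1 * ?D *\<^sub>v right_factor x"
    unfolding EGFP_P_def right_factor_def
    using cs KD x by (simp add: assoc_mult_mat_vec[of _ N N _ N])
  also have "\<dots> = left_factor (?D *\<^sub>v right_factor x)"
    unfolding left_factor_def using cs D xr by (simp add: assoc_mult_mat_vec[of _ N N _ N])
  also have "?D *\<^sub>v right_factor x = z \<cdot>\<^sub>v (elem_prod_P m n As \<tau> *\<^sub>v right_factor x) -
    elem_prod_P m n As (map Pos \<sigma>) *\<^sub>v right_factor x"
    using P_carrier xr
    by (simp add: minus_mult_distrib_mat_vec[of _ N N] smult_mat_vec_assoc)
  finally show ?thesis .
qed

lemma affine_run_sigma: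
  assumes v: "v \<in> carrier_vec N" and c: "c \<in> carrier_vec n"
  shows "affine_run m n As (- c) \<sigma> v = elem_prod_P m n As (map Pos \<sigma>) *\<^sub>v v +
    - (elem_prod_P m n As (map Pos \<sigma>l) *\<^sub>v place m n 0 c)"
proof -
  let ?l = "elem_prod_P m n As (map Pos \<sigma>l)" and ?r = "elem_prod_P m n As (map Pos \<sigma>r) *\<^sub>v v"
  have r: "?r \<in> carrier_vec N" by (rule P_vec_carrier(1)[OF v sigma_lr_sub(2)])
  have ok0: "index_ok m (Pos 0)" using m_pos by (simp add: index_ok_def)
  have A0: "- As 0 \<in> carrier_mat n n" using As_carrier[of 0] by simp
  let ?m = "elem_mat m n (Pos 0) (- As 0) *\<^sub>v ?r"
  have mr: "?m \<in> carrier_vec N" by (rule elem_mat_vec_carrier[OF ok0 A0 r])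
  have neg: "place m n 0 (- c) = - place m n 0 c"
  proof (rule eq_vecI)
    fix i assume "i < dim_vec (- place m n 0 c)"
    then have i: "i < m * n" by (simp add: place_def)
    then have "i mod n < n" by (cases n) auto
    then show "place m n 0 (- c) $ i = (- place m n 0 c) $ i" using i c by (simp add: place_def)
  qed (simp add: place_def)
  have pc: "- place m n 0 c \<in> carrier_vec N" by simp
  have l: "?l \<in> carrier_mat N N" by (rule elem_prod_P_carrier[OF Pos_ok[OF sigma_lr_sub(1)] As_carrier])
  have s: "affine_step m n As (- c) 0 ?r = ?m + - place m n 0 c"
    by (simp add: affine_step.simps neg)
  have "affine_run m n As (- c) \<sigma> v = affine_run m n As (- c) \<sigma>l (affine_step m n As (- c) 0 ?r)"
    by (simp add: sigma_split run_no_0[OF zero_not_lr(2) sigma_lr_sub(2) v])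
  also have "\<dots> = ?l *\<^sub>v (?m + - place m n 0 c)"
    unfolding s by (rule run_no_0[OF zero_not_lr(1) sigma_lr_sub(1)]) (use mr pc in simp)
  also have "\<dots> = ?l *\<^sub>v ?m + ?l *\<^sub>v (- place m n 0 c)" by (rule mult_add_distrib_mat_vec[OF l mr pc])
  also have "?l *\<^sub>v (- place m n 0 c) = - (?l *\<^sub>v place m n 0 c)"
    by (rule mult_mat_vec_uminus[OF l place_carrier])
  also have "?l *\<^sub>v ?m = elem_prod_P m n As (map Pos \<sigma>) *\<^sub>v v"
  proof -
    have ok: "index_ok m t" if "t \<in> set (map Pos \<sigma>)" for t by (rule Pos_ok[OF sigma_less that])
    have "elem_prod_P m n As (map Pos \<sigma>) *\<^sub>v v = ?l *\<^sub>v (elem_prod_P m n As (Pos 0 # map Pos \<sigma>r) *\<^sub>v v)"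
      unfolding sigma_split map_append list.map
      by (rule elem_prod_P_append_vec[OF _ As_carrier v]) (use ok sigma_split in auto)
    also have "elem_prod_P m n As (Pos 0 # map Pos \<sigma>r) *\<^sub>v v = elem_mat m n (Pos 0) (coeff_assign As (Pos 0)) *\<^sub>v ?r"
      by (rule elem_prod_P_Cons_vec[OF _ As_carrier v]) (use ok sigma_split in auto)
    finally show ?thesis by simp
  qed
  finally show ?thesis .
qed

text \<open>The first block row of the null vector equation is the circuit equation with \<open>d = -C y\<close>.  The
  invertible left factor cancels because it is also present in \<open>e \<otimes> C\<close>.\<close>
lemma L_kernel_equation:
  assumes x: "x \<in> carrier_vec N" and y: "y \<in> carrier_vec r"
    and w: "w = elem_prod_P m n As (map Neg \<omega>r) *\<^sub>v right_factor x"
  shows "L z *\<^sub>v x + place m n col_index (C *\<^sub>v y) = 0\<^sub>v N \<longleftrightarrow>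
    z \<cdot>\<^sub>v (elem_mat m n (Neg m) (As m) *\<^sub>v w) = affine_run m n As (- (C *\<^sub>v y)) (\<alpha> @ 0 # \<beta>) w"
proof -
  let ?x = "right_factor x" and ?c = "C *\<^sub>v y"
  let ?p = "elem_prod_P m n As (map Pos \<sigma>l) *\<^sub>v place m n 0 ?c"
  let ?t = "z \<cdot>\<^sub>v (elem_prod_P m n As \<tau> *\<^sub>v ?x)" and ?s = "elem_prod_P m n As (map Pos \<sigma>) *\<^sub>v ?x"
  have c: "?c \<in> carrier_vec n" using C y by simp
  note xr = right_factor_carrier[OF x]
  have p: "?p \<in> carrier_vec N" by (rule P_vec_carrier(1)[OF place_carrier sigma_lr_sub(1)])
  have t: "?t \<in> carrier_vec N" and s: "?s \<in> carrier_vec N" using P_carrier xr by auto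
  have ts: "?t - ?s \<in> carrier_vec N" using t s by simp
  have "L z *\<^sub>v x + place m n col_index ?c = left_factor (?t - ?s + ?p)"
    unfolding L_vec[OF x] col_index_place[OF c, symmetric] left_factor_add[OF ts p] ..
  also have "\<dots> = 0\<^sub>v N \<longleftrightarrow> ?t - ?s + ?p = 0\<^sub>v N"
    by (rule left_factor_eq_0) (use ts p in simp)
  also have "\<dots> \<longleftrightarrow> ?t = ?s + - ?p" by (rule vec_balance[OF t s p])
  also have "?s + - ?p = affine_run m n As (- ?c) \<sigma> ?x" by (rule affine_run_sigma[OF xr c, symmetric])
  also have "?t = \<dots> \<longleftrightarrow>
    z \<cdot>\<^sub>v (elem_mat m n (Neg m) (As m) *\<^sub>v w) = affine_run m n As (- ?c) (\<alpha> @ 0 # \<beta>) w"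
    by (rule pencil_reduction(1)[OF xr w])
  finally show ?thesis .
qed

abbreviation "LL \<equiv> EGFP_S m n As A E B C \<sigma> \<tau> \<sigma>1 \<sigma>2 \<tau>1 \<tau>2 X1 X2 Y1 Y2"
abbreviation "S \<equiv> system_matrix m n As A E B C"

lemma D_carrier: "A - z \<cdot>\<^sub>m E \<in> carrier_mat r r"
  using A E by (intro minus_carrier_mat) simp

lemma matrix_poly_carrier: "matrix_poly m n As z \<in> carrier_mat n n"
  by (simp add: matrix_poly_def)

lemma kronecker_carriers:
  "e_col m j \<otimes>\<^sub>k C \<in> carrier_mat N r" "transpose_mat (e_col m j) \<otimes>\<^sub>k B \<in> carrier_mat r N"
  "transpose_mat (e_col m j) \<otimes>\<^sub>k 1\<^sub>m n \<in> carrier_mat n N"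
  using B C by (auto simp: kronecker_def)

lemma LL_carrier: "LL z \<in> carrier_mat (N + r) (N + r)"
  unfolding EGFP_S_def by (rule four_block_carrier_mat[OF L_carrier D_carrier])

lemma S_carrier: "S z \<in> carrier_mat (n + r) (n + r)"
  unfolding system_matrix_def by (rule four_block_carrier_mat[OF matrix_poly_carrier D_carrier])

lemma LL_kernel:
  assumes x: "x \<in> carrier_vec N" and y: "y \<in> carrier_vec r"
  shows "x @\<^sub>v y \<in> mat_kernel (LL z) \<longleftrightarrow>
    L z *\<^sub>v x + place m n col_index (C *\<^sub>v y) = 0\<^sub>v N \<and>
    B *\<^sub>v blk m n row_index x + (A - z \<cdot>\<^sub>m E) *\<^sub>v y = 0\<^sub>v r"
  unfolding EGFP_S_def consecutions_row inversions_col
    four_block_kernel[OF L_carrier kronecker_carriers(1,2) D_carrier x y]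
    kronecker_place[OF index_less(2) C y] kronecker_select[OF index_less(1) B x] ..

lemma S_kernel:
  assumes "x \<in> carrier_vec n" and "y \<in> carrier_vec r"
  shows "x @\<^sub>v y \<in> mat_kernel (S z) \<longleftrightarrow>
    matrix_poly m n As z *\<^sub>v x + C *\<^sub>v y = 0\<^sub>v n \<and> B *\<^sub>v x + (A - z \<cdot>\<^sub>m E) *\<^sub>v y = 0\<^sub>v r"
  unfolding system_matrix_def four_block_kernel[OF matrix_poly_carrier C B D_carrier assms] ..

text \<open>The matrix of the map \<open>(x, y) \<mapsto> (block row_index of x, y)\<close>.\<close>
definition "recovery = four_block_mat
  (transpose_mat (e_col m (nat (int m - consecutions 0 (\<sigma> @ \<sigma>2)))) \<otimes>\<^sub>k 1\<^sub>m n) (0\<^sub>m n r) (0\<^sub>m r N) (1\<^sub>m r)"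

lemma recovery_carrier: "recovery \<in> carrier_mat (n + r) (N + r)"
  unfolding recovery_def by (rule four_block_carrier_mat[OF kronecker_carriers(3) one_carrier_mat])

lemma recovery_vec:
  assumes x: "x \<in> carrier_vec N" and y: "y \<in> carrier_vec r"
  shows "recovery *\<^sub>v (x @\<^sub>v y) = blk m n row_index x @\<^sub>v y"
  unfolding recovery_def consecutions_row
    four_block_mat_mult_vec[OF kronecker_carriers(3) zero_carrier_mat zero_carrier_mat one_carrier_mat x y]
    kronecker_select[OF index_less(1) one_carrier_mat x] zero_mat_mult_vec[OF x] zero_mat_mult_vec[OF y]
  using y by simp

lemma vec_add_eq_0_iff:
  fixes a c :: "complex vec"
  assumes "a \<in> carrier_vec k" "c \<in> carrier_vec k"
  shows "a + c = 0\<^sub>v k \<longleftrightarrow> a = - c"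
proof -
  have "a $ i + c $ i = 0 \<longleftrightarrow> a $ i = - c $ i" for i by (auto simp: add_eq_0_iff2)
  then show ?thesis using assms by (auto simp: vec_eq_iff)
qed

text \<open>Null vectors of the pencil correspond to pairs of a solution of the circuit equation and \<open>y\<close>.
  The solutions of the circuit equation are parametrised by the block that enters the gate with
  index \<open>0\<close>, and this block is the upper part of the recovered vector.\<close>

theorem recovery_bij: "bij_betw (\<lambda>v. recovery *\<^sub>v v) (mat_kernel (LL z)) (mat_kernel (S z))"
proof -
  \<comment> \<open>the substitution that leads to the Fiedler pencil\<close>
  define red where "red x = elem_prod_P m n As (map Neg \<omega>r) *\<^sub>v right_factor x" for x
  have red_car: "red x \<in> carrier_vec N" if "x \<in> carrier_vec N" for x
    unfolding red_def by (rule P_vec_carrier(2)[OF right_factor_carrier[OF that] subtuples(6)])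
  have red_surj: "\<exists>x \<in> carrier_vec N. red x = w" if w: "w \<in> carrier_vec N" for w
  proof -
    let ?u = "elem_prod_P m n As (map Pos (rev \<omega>r)) *\<^sub>v w"
    have "?u \<in> carrier_vec N" by (rule P_vec_carrier(1)[OF w omega_r_sub(2)])
    then have "?u \<in> right_factor ` carrier_vec N" using right_factor_bij by (simp add: bij_betw_def)
    then obtain x where x: "x \<in> carrier_vec N" "right_factor x = ?u" by (metis imageE)
    have "red x = w" unfolding red_def x(2) by (rule cancel_omega_r(2)[OF w])
    then show ?thesis using x(1) by blast
  qed
  have right_red: "right_factor x = elem_prod_P m n As (map Pos (rev \<omega>r)) *\<^sub>v red x"
    if "x \<in> carrier_vec N" for x
    unfolding red_def by (rule cancel_omega_r(1)[OF right_factor_carrier[OF that], symmetric])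
  have red_inj: "x = x'" if x: "x \<in> carrier_vec N" "x' \<in> carrier_vec N" and e: "red x = red x'" for x x'
  proof -
    have "right_factor x = right_factor x'"
      unfolding right_red[OF x(1)] right_red[OF x(2)] e ..
    then show ?thesis using bij_betw_imp_inj_on[OF right_factor_bij] x by (simp add: inj_on_eq_iff)
  qed
  have C_car: "- (C *\<^sub>v y) \<in> carrier_vec n" if "y \<in> carrier_vec r" for y using C that by simp
  have sel: "blk m n row_index x = blk m n 0 (affine_run m n As d \<beta> (red x))"
    if "x \<in> carrier_vec N" for x d
    unfolding row_index_select[OF that]
    by (rule pencil_reduction(2)[OF right_factor_carrier[OF that] red_def, symmetric])
  note top = L_kernel_equation[OF _ _ red_def]
  have split: "\<exists>x \<in> carrier_vec a. \<exists>y \<in> carrier_vec r. v = x @\<^sub>v y"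
    if "v \<in> carrier_vec (a + r)" for v :: "complex vec" and a
    using obtain_append[OF that] by blast
  show ?thesis
    unfolding bij_betw_def
  proof (intro conjI inj_onI equalityI subsetI)
    fix v v' assume v: "v \<in> mat_kernel (LL z)" "v' \<in> mat_kernel (LL z)"
      and e: "recovery *\<^sub>v v = recovery *\<^sub>v v'"
    from split[OF mat_kernelD(1)[OF LL_carrier v(1)]]
    obtain x y where x: "x \<in> carrier_vec N" and y: "y \<in> carrier_vec r" and vxy: "v = x @\<^sub>v y" by blast
    from split[OF mat_kernelD(1)[OF LL_carrier v(2)]]
    obtain x' y' where x': "x' \<in> carrier_vec N" and y': "y' \<in> carrier_vec r" and vxy': "v' = x' @\<^sub>v y'" by blast
    have "blk m n row_index x @\<^sub>v y = blk m n row_index x' @\<^sub>v y'"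
      using e unfolding vxy vxy' recovery_vec[OF x y] recovery_vec[OF x' y'] .
    then have b: "blk m n row_index x = blk m n row_index x'" and yy: "y = y'"
      by (subst (asm) append_vec_eq[of _ n]; simp)+
    have "red x = red x'"
    proof (rule fiedler_solution_unique[OF m_pos As_carrier fiedler_perm])
      show "- (C *\<^sub>v y) \<in> carrier_vec n" by (rule C_car[OF y])
      show "z \<cdot>\<^sub>v (elem_mat m n (Neg m) (As m) *\<^sub>v red x) = affine_run m n As (- (C *\<^sub>v y)) (\<alpha> @ 0 # \<beta>) (red x)"
        using v(1) unfolding vxy LL_kernel[OF x y] top[OF x y] by simp
      show "z \<cdot>\<^sub>v (elem_mat m n (Neg m) (As m) *\<^sub>v red x') = affine_run m n As (- (C *\<^sub>v y)) (\<alpha> @ 0 # \<beta>) (red x')"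
        using v(2) unfolding vxy' LL_kernel[OF x' y'] top[OF x' y'] yy by simp
      show "blk m n 0 (affine_run m n As (- (C *\<^sub>v y)) \<beta> (red x)) =
          blk m n 0 (affine_run m n As (- (C *\<^sub>v y)) \<beta> (red x'))"
        using b unfolding sel[OF x, of "- (C *\<^sub>v y)"] sel[OF x', of "- (C *\<^sub>v y)"] .
    qed (use red_car x x' in auto)
    then show "v = v'" using red_inj[OF x x'] vxy vxy' yy by simp
  next
    fix u assume "u \<in> (\<lambda>v. recovery *\<^sub>v v) ` mat_kernel (LL z)"
    then obtain v where v: "v \<in> mat_kernel (LL z)" and u: "u = recovery *\<^sub>v v" by blast
    from split[OF mat_kernelD(1)[OF LL_carrier v]]
    obtain x y where x: "x \<in> carrier_vec N" and y: "y \<in> carrier_vec r" and vxy: "v = x @\<^sub>v y" by blast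
    have k: "z \<cdot>\<^sub>v (elem_mat m n (Neg m) (As m) *\<^sub>v red x) = affine_run m n As (- (C *\<^sub>v y)) (\<alpha> @ 0 # \<beta>) (red x)"
      "B *\<^sub>v blk m n row_index x + (A - z \<cdot>\<^sub>m E) *\<^sub>v y = 0\<^sub>v r"
      using v unfolding vxy LL_kernel[OF x y] top[OF x y] by simp_all
    have "matrix_poly m n As z *\<^sub>v blk m n row_index x = - (C *\<^sub>v y)"
      unfolding sel[OF x, of "- (C *\<^sub>v y)"]
      by (rule fiedler_solution_value[OF m_pos As_carrier fiedler_perm red_car[OF x] C_car[OF y] k(1)])
    then have "matrix_poly m n As z *\<^sub>v blk m n row_index x + C *\<^sub>v y = 0\<^sub>v n"
      by (rule vec_add_eq_0_iff[OF mult_mat_vec_carrier[OF matrix_poly_carrier blk_carrier]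
            mult_mat_vec_carrier[OF C y], THEN iffD2])
    then show "u \<in> mat_kernel (S z)"
      unfolding u vxy recovery_vec[OF x y] S_kernel[OF blk_carrier y] using k(2) by simp
  next
    fix u assume u: "u \<in> mat_kernel (S z)"
    from split[OF mat_kernelD(1)[OF S_carrier u]]
    obtain x y where x: "x \<in> carrier_vec n" and y: "y \<in> carrier_vec r" and uxy: "u = x @\<^sub>v y" by blast
    have k: "matrix_poly m n As z *\<^sub>v x + C *\<^sub>v y = 0\<^sub>v n" "B *\<^sub>v x + (A - z \<cdot>\<^sub>m E) *\<^sub>v y = 0\<^sub>v r"
      using u unfolding uxy S_kernel[OF x y] by simp_all
    have "matrix_poly m n As z *\<^sub>v x = - (C *\<^sub>v y)"
      using k(1) vec_add_eq_0_iff[OF mult_mat_vec_carrier[OF matrix_poly_carrier x]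
          mult_mat_vec_carrier[OF C y]] by simp
    from fiedler_solution_exists[OF m_pos As_carrier fiedler_perm x this]
    obtain w where w: "w \<in> carrier_vec N"
      "z \<cdot>\<^sub>v (elem_mat m n (Neg m) (As m) *\<^sub>v w) = affine_run m n As (- (C *\<^sub>v y)) (\<alpha> @ 0 # \<beta>) w"
      "blk m n 0 (affine_run m n As (- (C *\<^sub>v y)) \<beta> w) = x" by blast
    obtain x0 where x0: "x0 \<in> carrier_vec N" "red x0 = w" using red_surj[OF w(1)] by blast
    have b: "blk m n row_index x0 = x" using w(3) unfolding sel[OF x0(1), of "- (C *\<^sub>v y)"] x0(2) .
    have "x0 @\<^sub>v y \<in> mat_kernel (LL z)"
      unfolding LL_kernel[OF x0(1) y] top[OF x0(1) y] x0(2) b using w(2) k(2) by simp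
    moreover have "recovery *\<^sub>v (x0 @\<^sub>v y) = u" unfolding recovery_vec[OF x0(1) y] b uxy ..
    ultimately show "u \<in> (\<lambda>v. recovery *\<^sub>v v) ` mat_kernel (LL z)" by blast
  qed
qed

end

section \<open>Transposition\<close>

lemma transpose_uminus: "transpose_mat (- M) = - transpose_mat (M :: complex mat)"
  by (intro eq_matI) auto

lemma transpose_diag_block_mat:
  "transpose_mat (diag_block_mat Ms) = diag_block_mat (map transpose_mat (Ms :: complex mat list))"
proof (induction Ms)
  case (Cons M Ms)
  let ?D = "diag_block_mat Ms"
  have c: "M \<in> carrier_mat (dim_row M) (dim_col M)" "?D \<in> carrier_mat (dim_row ?D) (dim_col ?D)" by auto
  have "transpose_mat (diag_block_mat (M # Ms)) =
      four_block_mat (transpose_mat M) (transpose_mat (0\<^sub>m (dim_row ?D) (dim_col M)))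
        (transpose_mat (0\<^sub>m (dim_row M) (dim_col ?D))) (transpose_mat ?D)"
    unfolding diag_block_mat.simps Let_def
    by (rule transpose_four_block_mat[OF c(1) zero_carrier_mat zero_carrier_mat c(2)])
  then show ?case by (simp add: Let_def flip: Cons.IH)
qed simp

lemma transpose_elem_mat:
  assumes "index_ok m t" and X: "X \<in> carrier_mat n n"
  shows "transpose_mat (elem_mat m n t X) = elem_mat m n t (transpose_mat X)"
proof -
  have P: "transpose_mat (four_block_mat X (1\<^sub>m n) (1\<^sub>m n) (0\<^sub>m n n)) =
      four_block_mat (transpose_mat X) (1\<^sub>m n) (1\<^sub>m n) (0\<^sub>m n n)"
    using transpose_four_block_mat[OF X one_carrier_mat one_carrier_mat zero_carrier_mat] by simp
  have N: "transpose_mat (four_block_mat (0\<^sub>m n n) (1\<^sub>m n) (1\<^sub>m n) X) =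
      four_block_mat (0\<^sub>m n n) (1\<^sub>m n) (1\<^sub>m n) (transpose_mat X)"
    using transpose_four_block_mat[OF zero_carrier_mat one_carrier_mat one_carrier_mat X] by simp
  show ?thesis
    using assms(1) by (cases t) (auto simp: index_ok_def elem_mat.simps transpose_diag_block_mat P N
        simp del: diag_block_mat.simps)
qed

lemma transpose_elem_prod:
  assumes "assignment_ok m n ts Xs"
  shows "transpose_mat (elem_prod m n ts Xs) = elem_prod m n (rev ts) (rev (map transpose_mat Xs))"
  using assms
proof (induction ts arbitrary: Xs)
  case (Cons t ts)
  then obtain Y Ys where Y: "Xs = Y # Ys" "index_ok m t" "Y \<in> carrier_mat n n" "assignment_ok m n ts Ys"
    by (auto elim: assignment_ok_ConsE)
  have ok: "assignment_ok m n (rev ts) (rev (map transpose_mat Ys))"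
    using Y(4) by (auto simp: assignment_ok_iff)
  have okt: "assignment_ok m n [t] [transpose_mat Y]" using Y(2,3) by simp
  have "transpose_mat (elem_prod m n (t # ts) (Y # Ys)) =
      elem_prod m n (rev ts) (rev (map transpose_mat Ys)) * elem_mat m n t (transpose_mat Y)"
    using transpose_mult[OF elem_mat_carrier[OF Y(2,3)] elem_prod_carrier[OF Y(4)]]
      transpose_elem_mat[OF Y(2,3)] Cons.IH[OF Y(4)] by simp
  also have "\<dots> = elem_prod m n (rev ts @ [t]) (rev (map transpose_mat Ys) @ [transpose_mat Y])"
    using elem_prod_append[OF ok okt] elem_mat_carrier[OF Y(2), of "transpose_mat Y" n] Y(3) by simp
  finally show ?case unfolding Y(1) by simp
qed simp

lemma transpose_elem_prod_P:
  assumes ok: "\<And>t. t \<in> set ts \<Longrightarrow> index_ok m t" and As: "\<And>i. i \<le> m \<Longrightarrow> As i \<in> carrier_mat n n"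
  shows "transpose_mat (elem_prod_P m n As ts) = elem_prod_P m n (\<lambda>i. transpose_mat (As i)) (rev ts)"
proof -
  have "transpose_mat (coeff_assign As t) = coeff_assign (\<lambda>i. transpose_mat (As i)) t" for t
    by (cases t) (simp_all add: transpose_uminus)
  then have coeffs: "map transpose_mat (map (coeff_assign As) ts) = map (coeff_assign (\<lambda>i. transpose_mat (As i))) ts"
    by simp
  have "transpose_mat (elem_prod m n ts (map (coeff_assign As) ts)) =
      elem_prod m n (rev ts) (rev (map transpose_mat (map (coeff_assign As) ts)))"
    by (rule transpose_elem_prod[OF coeff_assignment_ok]) (use ok As in auto)
  then show ?thesis unfolding elem_prod_P_def coeffs rev_map .
qed

lemma invertible_transpose:
  fixes X :: "complex mat"
  assumes X: "X \<in> carrier_mat n n" and inv: "invertible_mat X"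
  shows "invertible_mat (transpose_mat X)"
proof -
  obtain Y where Y: "inverts_mat X Y" "inverts_mat Y X"
    using inv unfolding invertible_mat_def by blast
  then have XY: "X * Y = 1\<^sub>m n" and YX: "Y * X = 1\<^sub>m (dim_row Y)"
    using X unfolding inverts_mat_def by auto
  have "dim_col Y = n" using arg_cong[OF XY, of dim_col] by simp
  moreover have r: "dim_row Y = n" using arg_cong[OF YX, of dim_col] X by simp
  ultimately have Yc: "Y \<in> carrier_mat n n" by (intro carrier_matI)
  have "transpose_mat Y * transpose_mat X = 1\<^sub>m n" "transpose_mat X * transpose_mat Y = 1\<^sub>m n"
    using transpose_mult[OF X Yc, symmetric] transpose_mult[OF Yc X, symmetric] r
    unfolding XY YX by simp_all
  then show ?thesis
    using X Yc unfolding invertible_mat_def inverts_mat_def by (auto intro: exI[of _ "transpose_mat Y"])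
qed

lemma nonsingular_assignment_rev:
  assumes "nonsingular_assignment m n ts Xs"
  shows "nonsingular_assignment m n (rev ts) (rev (map transpose_mat Xs))"
proof -
  have len: "length Xs = length ts" and car: "set Xs \<subseteq> carrier_mat n n"
    and inv: "\<And>k. k < length ts \<Longrightarrow> ts ! k \<in> {Pos 0, Neg 0, Pos m, Neg m} \<Longrightarrow> invertible_mat (Xs ! k)"
    using assms by (auto simp: nonsingular_assignment_def)
  show ?thesis unfolding nonsingular_assignment_def
  proof (intro conjI allI impI)
    fix k assume k: "k < length (rev ts)" and t: "rev ts ! k \<in> {Pos 0, Neg 0, Pos m, Neg m}"
    let ?k = "length ts - Suc k"
    have "rev ts ! k = ts ! ?k" using k by (simp add: rev_nth)
    then have "invertible_mat (Xs ! ?k)" using inv[of ?k] k t by simp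
    moreover have "Xs ! ?k \<in> carrier_mat n n" using car len k by (auto simp: subset_iff)
    ultimately have "invertible_mat (transpose_mat (Xs ! ?k))" by (rule invertible_transpose[rotated])
    then show "invertible_mat (rev (map transpose_mat Xs) ! k)" using k len by (simp add: rev_nth)
  qed (use len car in auto)
qed

text \<open>All conditions are symmetric under reversal, with the outer tuples exchanged; in particular the SIP
  is.  So the transposed pencil is again an EGFP.\<close>
lemma EGFP_data_rev:
  assumes "EGFP_data m n \<sigma> \<omega> \<tau> \<sigma>1 \<sigma>2 \<tau>1 \<tau>2 X1 X2 Y1 Y2"
  shows "EGFP_data m n (rev \<sigma>) (rev \<omega>) (rev \<tau>) (rev \<sigma>2) (rev \<sigma>1) (rev \<tau>2) (rev \<tau>1)
    (rev (map transpose_mat X2)) (rev (map transpose_mat X1))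
    (rev (map transpose_mat Y2)) (rev (map transpose_mat Y1))"
proof -
  have n: "nonsingular_assignment m n (map Pos \<sigma>1) X1" "nonsingular_assignment m n (map Pos \<sigma>2) X2"
    "nonsingular_assignment m n \<tau>1 Y1" "nonsingular_assignment m n \<tau>2 Y2"
    using assms by (auto simp: EGFP_data_def)
  have s0: "SIP (\<sigma>1 @ \<sigma> @ \<sigma>2)" "SIP (map (shift m) (\<tau>1 @ \<tau> @ \<tau>2))"
    using assms unfolding EGFP_data_def by blast+
  have s: "SIP (rev \<sigma>2 @ rev \<sigma> @ rev \<sigma>1)" "SIP (map (shift m) (rev \<tau>2 @ rev \<tau> @ rev \<tau>1))"
    using SIP_rev[OF s0(1)] SIP_rev[OF s0(2)] by (simp_all add: rev_map)
  have d: "distinct (\<sigma> @ \<omega>)" "set (\<sigma> @ \<omega>) = {0..m}" and \<tau>: "\<tau> = map Neg \<omega>"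
    and sub: "set \<sigma>1 \<subseteq> set \<sigma> - {m - 1, m}" "set \<sigma>2 \<subseteq> set \<sigma> - {m - 1, m}"
      "set \<tau>1 \<subseteq> set \<tau> - {Neg 1, Neg 0}" "set \<tau>2 \<subseteq> set \<tau> - {Neg 1, Neg 0}"
    using assms unfolding EGFP_data_def by blast+
  have "distinct (rev \<sigma> @ rev \<omega>)" "set (rev \<sigma> @ rev \<omega>) = {0..m}" using d by auto
  moreover have "rev \<tau> = map Neg (rev \<omega>)" by (simp add: \<tau> rev_map)
  ultimately show ?thesis
    unfolding EGFP_data_def set_rev rev_map[symmetric]
    using s sub n[THEN nonsingular_assignment_rev] by (simp add: rev_map[symmetric])
qed

lemma transpose_kronecker: "transpose_mat (X \<otimes>\<^sub>k Y) = transpose_mat X \<otimes>\<^sub>k transpose_mat Y"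
proof -
  have less: "i div d < b" "i mod d < d" if "i < b * d" for i b d :: nat
  proof -
    have "0 < d" using that by (cases d) auto
    then show "i div d < b" "i mod d < d" using that by (simp_all add: less_mult_imp_div_less)
  qed
  show ?thesis by (intro eq_matI) (auto simp: kronecker_def less)
qed

lemma inversions_rev: "inversions 0 (rev \<alpha>) = consecutions 0 \<alpha>"
  by (simp add: inversions_0 consecutions_0)

lemma consecutions_rev: "consecutions 0 (rev \<alpha>) = inversions 0 \<alpha>"
  by (simp add: inversions_0 consecutions_0)

lemma transpose_system_matrix:
  assumes "A \<in> carrier_mat r r" "E \<in> carrier_mat r r" "C \<in> carrier_mat n r" "B \<in> carrier_mat r n"
    and As: "\<forall>i\<le>m. As i \<in> carrier_mat n n"
  shows "transpose_mat (system_matrix m n As A E B C z) =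
    system_matrix m n (\<lambda>i. transpose_mat (As i)) (transpose_mat A) (transpose_mat E)
      (transpose_mat C) (transpose_mat B) z"
proof -
  have "transpose_mat (matrix_poly m n As z) = matrix_poly m n (\<lambda>i. transpose_mat (As i)) z"
    using As by (intro eq_matI) (auto simp: matrix_poly_def intro!: sum.cong)
  moreover have "transpose_mat (A - z \<cdot>\<^sub>m E) = transpose_mat A - z \<cdot>\<^sub>m transpose_mat E"
    using assms by (intro eq_matI) auto
  moreover have "matrix_poly m n As z \<in> carrier_mat n n" "A - z \<cdot>\<^sub>m E \<in> carrier_mat r r"
    using assms(2) by (simp_all add: matrix_poly_def minus_carrier_mat)
  ultimately show ?thesis
    unfolding system_matrix_def
    using transpose_four_block_mat[of "matrix_poly m n As z" n n C r B r "A - z \<cdot>\<^sub>m E"] assms by simp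
qed

context egfp
begin

abbreviation "As_T i \<equiv> transpose_mat (As i)"

lemma transpose_L:
  "transpose_mat (L z) = EGFP_P m n As_T (rev \<sigma>) (rev \<tau>) (rev \<sigma>2) (rev \<sigma>1) (rev \<tau>2) (rev \<tau>1)
    (rev (map transpose_mat X2)) (rev (map transpose_mat X1))
    (rev (map transpose_mat Y2)) (rev (map transpose_mat Y1)) z"
proof -
  note cs = elem_prod_carrier[OF assignments(1)] elem_prod_carrier[OF assignments(2)]
    elem_prod_carrier[OF assignments(3)] elem_prod_carrier[OF assignments(4)]
  let ?D = "z \<cdot>\<^sub>m elem_prod_P m n As \<tau> - elem_prod_P m n As (map Pos \<sigma>)"
  have D: "?D \<in> carrier_mat N N" by (rule minus_carrier_mat[OF P_carrier(1)])
  have tP: "transpose_mat (elem_prod_P m n As (map Pos \<sigma>)) = elem_prod_P m n As_T (map Pos (rev \<sigma>))"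
    unfolding rev_map[symmetric] by (rule transpose_elem_prod_P[OF Pos_ok[OF sigma_less] As_carrier])
  have tT: "transpose_mat (elem_prod_P m n As \<tau>) = elem_prod_P m n As_T (rev \<tau>)"
    by (rule transpose_elem_prod_P[OF _ As_carrier]) (use Neg_ok[OF order_refl] tau in blast)
  have tD: "transpose_mat ?D = z \<cdot>\<^sub>m elem_prod_P m n As_T (rev \<tau>) - elem_prod_P m n As_T (map Pos (rev \<sigma>))"
    unfolding tP[symmetric] tT[symmetric] using P_carrier by (intro eq_matI) auto
  note ts = transpose_elem_prod[OF assignments(1)] transpose_elem_prod[OF assignments(2)]
    transpose_elem_prod[OF assignments(3)] transpose_elem_prod[OF assignments(4)]
  have dims: "elem_prod m n \<tau>1 Y1 * elem_prod m n (map Pos \<sigma>1) X1 \<in> carrier_mat N N"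
    "elem_prod m n \<tau>1 Y1 * elem_prod m n (map Pos \<sigma>1) X1 * ?D \<in> carrier_mat N N"
    "elem_prod m n \<tau>1 Y1 * elem_prod m n (map Pos \<sigma>1) X1 * ?D * elem_prod m n (map Pos \<sigma>2) X2 \<in> carrier_mat N N"
    by (intro mult_carrier_mat[of _ N N] cs D)+
  let ?a = "transpose_mat (elem_prod m n \<tau>1 Y1)" and ?b = "transpose_mat (elem_prod m n (map Pos \<sigma>1) X1)"
    and ?c = "transpose_mat (elem_prod m n (map Pos \<sigma>2) X2)" and ?d = "transpose_mat (elem_prod m n \<tau>2 Y2)"
  have tc: "?a \<in> carrier_mat N N" "?b \<in> carrier_mat N N" "?c \<in> carrier_mat N N" "?d \<in> carrier_mat N N"
    "transpose_mat ?D \<in> carrier_mat N N"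
    using cs D by simp_all
  have "transpose_mat (L z) = ?d * (?c * (transpose_mat ?D * (?b * ?a)))"
    unfolding EGFP_P_def transpose_mult[OF dims(3) cs(4)] transpose_mult[OF dims(2) cs(2)]
      transpose_mult[OF dims(1) D] transpose_mult[OF cs(3) cs(1)] ..
  also have "\<dots> = ?d * ?c * transpose_mat ?D * ?b * ?a"
  proof -
    have x1: "?b * ?a \<in> carrier_mat N N" "transpose_mat ?D * (?b * ?a) \<in> carrier_mat N N"
      "?d * ?c \<in> carrier_mat N N" "?d * ?c * transpose_mat ?D \<in> carrier_mat N N"
      by (intro mult_carrier_mat[of _ N N] tc)+
    show ?thesis
      unfolding assoc_mult_mat[OF tc(4) tc(3) x1(2), symmetric] assoc_mult_mat[OF x1(3) tc(5) x1(1), symmetric]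
        assoc_mult_mat[OF x1(4) tc(2) tc(1), symmetric] ..
  qed
  finally show ?thesis unfolding EGFP_P_def tD ts rev_map .
qed

lemma transpose_LL:
  "transpose_mat (LL z) = EGFP_S m n As_T (transpose_mat A) (transpose_mat E) (transpose_mat C) (transpose_mat B)
    (rev \<sigma>) (rev \<tau>) (rev \<sigma>2) (rev \<sigma>1) (rev \<tau>2) (rev \<tau>1)
    (rev (map transpose_mat X2)) (rev (map transpose_mat X1))
    (rev (map transpose_mat Y2)) (rev (map transpose_mat Y1)) z"
proof -
  have D: "transpose_mat (A - z \<cdot>\<^sub>m E) = transpose_mat A - z \<cdot>\<^sub>m transpose_mat E"
    using A E by (intro eq_matI) auto
  show ?thesis
    unfolding EGFP_S_def transpose_four_block_mat[OF L_carrier kronecker_carriers(1,2) D_carrier]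
      transpose_L transpose_kronecker D transpose_transpose rev_append[symmetric]
      inversions_rev consecutions_rev ..
qed

end

section \<open>Recovery of eigenvectors\<close>

lemma egfp_exists:
  assumes "0 < m" "\<forall>i \<le> m. As i \<in> carrier_mat n n"
    "A \<in> carrier_mat r r" "E \<in> carrier_mat r r" "C \<in> carrier_mat n r" "B \<in> carrier_mat r n"
    and data: "EGFP_data m n \<sigma> \<omega> \<tau> \<sigma>1 \<sigma>2 \<tau>1 \<tau>2 X1 X2 Y1 Y2"
    and zero: "0 \<in> set \<sigma>" and top: "Neg m \<in> set \<tau>"
  shows "\<exists>\<sigma>l \<sigma>r \<omega>l \<omega>r \<rho>1 \<rho>2.
    egfp m n r As A E B C \<sigma> \<omega> \<sigma>1 \<sigma>2 \<tau> \<tau>1 \<tau>2 X1 X2 Y1 Y2 \<sigma>l \<sigma>r \<omega>l \<omega>r \<rho>1 \<rho>2"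
proof -
  have \<tau>: "\<tau> = map Neg \<omega>" and sub: "set \<tau>1 \<subseteq> set \<tau>" "set \<tau>2 \<subseteq> set \<tau>"
    using data unfolding EGFP_data_def by blast+
  have "m \<in> set \<omega>" using top \<tau> by auto
  then obtain \<omega>l \<omega>r where "\<omega> = \<omega>l @ m # \<omega>r" by (meson split_list)
  moreover obtain \<sigma>l \<sigma>r where "\<sigma> = \<sigma>l @ 0 # \<sigma>r" using zero by (meson split_list)
  moreover have "\<forall>t \<in> set \<tau>1. \<exists>i. t = Neg i" "\<forall>t \<in> set \<tau>2. \<exists>i. t = Neg i" using sub \<tau> by auto
  then obtain \<rho>1 \<rho>2 where "\<tau>1 = map Neg \<rho>1" "\<tau>2 = map Neg \<rho>2" by (metis ex_map_conv)
  ultimately show ?thesis unfolding egfp_def using assms(1-6) data by blast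
qed

lemma recovery_append_rows:
  fixes P Zmn Zr :: "complex mat"
  assumes P: "P \<in> carrier_mat a b" and Zmn: "Zmn \<in> carrier_mat b p" and Zr: "Zr \<in> carrier_mat r p"
  shows "four_block_mat P (0\<^sub>m a r) (0\<^sub>m r b) (1\<^sub>m r) * (Zmn @\<^sub>r Zr) = (P * Zmn) @\<^sub>r Zr"
proof -
  have PZ: "P * Zmn \<in> carrier_mat a p" using P Zmn by simp
  have "four_block_mat P (0\<^sub>m a r) (0\<^sub>m r b) (1\<^sub>m r) * (Zmn @\<^sub>r Zr) =
    four_block_mat (P * Zmn + 0\<^sub>m a r * Zr) (P * 0\<^sub>m b 0 + 0\<^sub>m a r * 0\<^sub>m r 0)
      (0\<^sub>m r b * Zmn + 1\<^sub>m r * Zr) (0\<^sub>m r b * 0\<^sub>m b 0 + 1\<^sub>m r * 0\<^sub>m r 0)"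
    unfolding append_rows_def using Zmn Zr
    by (simp add: mult_four_block_mat[OF P zero_carrier_mat zero_carrier_mat one_carrier_mat Zmn zero_carrier_mat Zr zero_carrier_mat])
  also have "\<dots> = (P * Zmn) @\<^sub>r Zr"
    unfolding append_rows_def using P Zmn Zr PZ by simp
  finally show ?thesis .
qed

theorem right_eigenvector_recovery:
  assumes hyps: "0 < m" "\<forall>i \<le> m. As i \<in> carrier_mat n n"
    "A \<in> carrier_mat r r" "E \<in> carrier_mat r r" "C \<in> carrier_mat n r" "B \<in> carrier_mat r n"
    "EGFP_data m n \<sigma> \<omega> \<tau> \<sigma>1 \<sigma>2 \<tau>1 \<tau>2 X1 X2 Y1 Y2" "0 \<in> set \<sigma>" "Neg m \<in> set \<tau>"
    and Z: "Zmn \<in> carrier_mat (m * n) p" "Zr \<in> carrier_mat r p"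
    and basis: "is_basis_of (Zmn @\<^sub>r Zr)
      (mat_kernel (EGFP_S m n As A E B C \<sigma> \<tau> \<sigma>1 \<sigma>2 \<tau>1 \<tau>2 X1 X2 Y1 Y2 z))"
  shows "is_basis_of
    (((transpose_mat (e_col m (nat (int m - consecutions 0 (\<sigma> @ \<sigma>2)))) \<otimes>\<^sub>k 1\<^sub>m n) * Zmn) @\<^sub>r Zr)
    (mat_kernel (system_matrix m n As A E B C z))"
proof -
  obtain \<sigma>l \<sigma>r \<omega>l \<omega>r \<rho>1 \<rho>2 where
    "egfp m n r As A E B C \<sigma> \<omega> \<sigma>1 \<sigma>2 \<tau> \<tau>1 \<tau>2 X1 X2 Y1 Y2 \<sigma>l \<sigma>r \<omega>l \<omega>r \<rho>1 \<rho>2"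
    using egfp_exists[OF hyps] by blast
  then interpret egfp m n r As A E B C \<sigma> \<omega> \<sigma>1 \<sigma>2 \<tau> \<tau>1 \<tau>2 X1 X2 Y1 Y2 \<sigma>l \<sigma>r \<omega>l \<omega>r \<rho>1 \<rho>2 .
  have "is_basis_of (recovery * (Zmn @\<^sub>r Zr)) (mat_kernel (S z))"
    by (rule is_basis_of_image[OF LL_carrier S_carrier carrier_append_rows[OF Z] recovery_carrier
          recovery_bij basis])
  then show ?thesis
    unfolding recovery_def recovery_append_rows[OF kronecker_carriers(3) Z] .
qed

text \<open>The left null space is the right null space of the transpose, and the consecutions of the reversed
  tuple are the inversions of the original one.\<close>
theorem left_eigenvector_recovery:
  assumes hyps: "0 < m" "\<forall>i \<le> m. As i \<in> carrier_mat n n"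
    "A \<in> carrier_mat r r" "E \<in> carrier_mat r r" "C \<in> carrier_mat n r" "B \<in> carrier_mat r n"
    "EGFP_data m n \<sigma> \<omega> \<tau> \<sigma>1 \<sigma>2 \<tau>1 \<tau>2 X1 X2 Y1 Y2" "0 \<in> set \<sigma>" "Neg m \<in> set \<tau>"
    and Z: "Zmn \<in> carrier_mat (m * n) p" "Zr \<in> carrier_mat r p"
    and basis: "is_basis_of (Zmn @\<^sub>r Zr)
      (left_null_space (EGFP_S m n As A E B C \<sigma> \<tau> \<sigma>1 \<sigma>2 \<tau>1 \<tau>2 X1 X2 Y1 Y2 z))"
  shows "is_basis_of
    (((transpose_mat (e_col m (nat (int m - inversions 0 (\<sigma>1 @ \<sigma>)))) \<otimes>\<^sub>k 1\<^sub>m n) * Zmn) @\<^sub>r Zr)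
    (left_null_space (system_matrix m n As A E B C z))"
proof -
  obtain \<sigma>l \<sigma>r \<omega>l \<omega>r \<rho>1 \<rho>2 where
    "egfp m n r As A E B C \<sigma> \<omega> \<sigma>1 \<sigma>2 \<tau> \<tau>1 \<tau>2 X1 X2 Y1 Y2 \<sigma>l \<sigma>r \<omega>l \<omega>r \<rho>1 \<rho>2"
    using egfp_exists[OF hyps] by blast
  then interpret egfp m n r As A E B C \<sigma> \<omega> \<sigma>1 \<sigma>2 \<tau> \<tau>1 \<tau>2 X1 X2 Y1 Y2 \<sigma>l \<sigma>r \<omega>l \<omega>r \<rho>1 \<rho>2 .
  note basis' = basis[unfolded left_null_space_eq_kernel_transpose transpose_LL]
  have "is_basis_of
    (((transpose_mat (e_col m (nat (int m - consecutions 0 (rev \<sigma> @ rev \<sigma>1)))) \<otimes>\<^sub>k 1\<^sub>m n) * Zmn) @\<^sub>r Zr)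
    (mat_kernel (system_matrix m n As_T (transpose_mat A) (transpose_mat E) (transpose_mat C) (transpose_mat B) z))"
    by (rule right_eigenvector_recovery[OF hyps(1) _ _ _ _ _ EGFP_data_rev[OF hyps(7)] _ _ Z basis'])
      (use hyps in auto)
  then show ?thesis
    unfolding left_null_space_eq_kernel_transpose transpose_system_matrix[OF hyps(3-6,2)]
      rev_append[symmetric] consecutions_rev .
qed

theorem theorem5p19:
  fixes m n r p :: nat
    and As :: "nat \<Rightarrow> complex mat"
    and A E B C Z Zmn Zr :: "complex mat"
    and \<sigma> \<omega> \<sigma>1 \<sigma>2 :: "nat list"
    and \<tau> \<tau>1 \<tau>2 :: "sindex list"
    and X1 X2 Y1 Y2 :: "complex mat list"
    and \<mu> :: complex
    and S LL :: "complex \<Rightarrow> complex mat"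
  assumes "m \<ge> 2"
    and "matrix_poly_of_degree m n As"
    and "A \<in> carrier_mat r r" and "E \<in> carrier_mat r r" and "invertible_mat E"
    and "C \<in> carrier_mat n r" and "B \<in> carrier_mat r n"
    and "S = system_matrix m n As A E B C"
    and "EGFP_data m n \<sigma> \<omega> \<tau> \<sigma>1 \<sigma>2 \<tau>1 \<tau>2 X1 X2 Y1 Y2"
    and "0 \<in> set \<sigma>" and "Neg m \<in> set \<tau>"
    and "LL = EGFP_S m n As A E B C \<sigma> \<tau> \<sigma>1 \<sigma>2 \<tau>1 \<tau>2 X1 X2 Y1 Y2"
    and "regular S" and "eigenvalue_of S \<mu>"
    and "Zmn \<in> carrier_mat (m * n) p" and "Zr \<in> carrier_mat r p"
    and "Z = Zmn @\<^sub>r Zr"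
    and "vec_space.rank (m * n + r) Z = p"
  shows "(is_basis_of Z (mat_kernel (LL \<mu>)) \<longrightarrow>
          is_basis_of
            (((transpose_mat (e_col m (nat (int m - consecutions 0 (\<sigma> @ \<sigma>2)))) \<otimes>\<^sub>k 1\<^sub>m n) * Zmn) @\<^sub>r Zr)
            (mat_kernel (S \<mu>)))
       \<and> (is_basis_of Z (left_null_space (LL \<mu>)) \<longrightarrow>
          is_basis_of
            (((transpose_mat (e_col m (nat (int m - inversions 0 (\<sigma>1 @ \<sigma>)))) \<otimes>\<^sub>k 1\<^sub>m n) * Zmn) @\<^sub>r Zr)
            (left_null_space (S \<mu>)))"
proof (intro conjI impI)
  have m: "0 < m" using assms(1) by simp
  have As: "\<forall>i \<le> m. As i \<in> carrier_mat n n" using assms(2) by (simp add: matrix_poly_of_degree_def)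
  note hyps = m As assms(3,4,6,7,9,10,11)
  show "is_basis_of
      (((transpose_mat (e_col m (nat (int m - consecutions 0 (\<sigma> @ \<sigma>2)))) \<otimes>\<^sub>k 1\<^sub>m n) * Zmn) @\<^sub>r Zr)
      (mat_kernel (S \<mu>))" if "is_basis_of Z (mat_kernel (LL \<mu>))"
    unfolding assms(8)
    by (rule right_eigenvector_recovery[OF hyps assms(15,16)])
      (use that assms(12,17) in simp)
  show "is_basis_of
      (((transpose_mat (e_col m (nat (int m - inversions 0 (\<sigma>1 @ \<sigma>)))) \<otimes>\<^sub>k 1\<^sub>m n) * Zmn) @\<^sub>r Zr)
      (left_null_space (S \<mu>))" if "is_basis_of Z (left_null_space (LL \<mu>))"
    unfolding assms(8)
    by (rule left_eigenvector_recovery[OF hyps assms(15,16)])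
      (use that assms(12,17) in simp)
qed

end
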